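(* Let $H$ be a Hopf algebra with a character $\delta$ such that $S_\delta^2=\mathrm{Id}$, and let $n\ge0$. The cyclic bicomplex $CC^*_\delta(H,n)$ is isomorphic to the bicomplex $\mathcal{X}^{2n+1}_\delta(W(H),I(H))$ (up to the vertical degree shift by one built into the definition of $CC^*_\delta(H,n)$).
   Context: $H$ is a Hopf algebra over $\mathbb{C}$ with counit $\epsilon$, antipode $S$, $\Delta(h)=\sum h_0\otimes h_1$; a character is a non-zero algebra map $\delta:H\to\mathbb{C}$; $S_\delta(h)=\sum\delta(h_0)S(h_1)$. Coinvariants ("coinv") of an $H$-module $V$: $\mathrm{span}\{hv-\delta(h)v\}$; $V_\delta=V/\mathrm{coinv}$. Weil complex: $W(H)$ is the non-unital DG algebra freely generated by symbols $h$ (degree 1) and $\omega_h$ (degree 2), linear in $h\in H$, with derivation $\partial(h)=\omega_h-\sum h_0h_1$, $\partial(\omega_h)=\sum\omega_{h_0}h_1-\sum h_0\omega_{h_1}$. $H$ acts by $g\cdot h=gh$, $g\cdot\omega_h=\omega_{gh}$, extended by $g(xy)=\sum g_0(x)g_1(y)$. $I(H)$ is the ideal generated by the $\omega_h$, $W_n(H)=W(H)/I(H)^{n+1}$. $\partial_0$ is the derivation with $\partial_0(h)=-\sum h_0h_1$, $\partial_0(\omega_h)=\partial(\omega_h)$; for a generator $a$, $t(ax)=(-1)^{|a||x|}xa$, $b_t(ax)=t(\partial_0(a)x)$, $b=\partial+b_t$; $N=1+t+\cdots+t^{p-1}$ on products of $p$ generators. All these operators descend to $W_n(H)_\delta$.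 The bicomplex $CC^*_\delta(W_n(H))$ is the 2-periodic sequence of complexes $$\cdots\to(W_n(H)_\delta,b)\xrightarrow{t-1}(W_n(H)_\delta,\partial)\xrightarrow{N}(W_n(H)_\delta,b)\xrightarrow{t-1}(W_n(H)_\delta,\partial)\to\cdots,$$ and $CC^*_\delta(H,n)$ is this bicomplex shifted by one in the vertical direction (degree $m$ corresponding to degree $m+1$ in $W_n(H)_\delta$). For an $H$ DG algebra $R$ (DG algebra with compatible $H$-action satisfying $h(xy)=\sum h_0(x)h_1(y)$) and an $H$-invariant DG ideal $I$, $\Omega^1(R)=\tilde R\otimes R$ ($\tilde R$ = $R$ with unit adjoined, $h\cdot1=\epsilon(h)1$) is the bimodule of non-commutative 1-forms $x\,dy$ with diagonal $H$-action and induced differential; $\Omega^1(R)_{\natural,\delta}=\Omega^1(R)/([\Omega^1(R),R]+\mathrm{coinv})$ (graded commutators), $\natural$ the projection; and $\mathcal{X}^{2n+1}_\delta(R,I)$ is the super-complex of complexes $$R/(I^{n+1}+\mathrm{coinv})\rightleftarrows\Omega^1(R)_{\natural,\delta}/\natural(I^{n+1}dR+I^ndI),$$ with $d(x)=\natural(dx)$, $b(\natural(x\,dy))=[x,y]$ ($I^0$ means $\tilde R$), regarded as a 2-periodic bicomplex. *)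

theory Defs
  imports Complex_Main "HOL-Library.Poly_Mapping" "HOL-Library.Product_Plus"
begin

section \<open>Complex vector spaces and algebras\<close>

class scaleC =
  fixes scaleC :: "complex \<Rightarrow> 'a \<Rightarrow> 'a"  (infixr "*\<^sub>C" 75)

class complex_vector = scaleC + ab_group_add +
  assumes scaleC_add_right: "a *\<^sub>C (x + y) = a *\<^sub>C x + a *\<^sub>C y"
    and scaleC_add_left: "(a + b) *\<^sub>C x = a *\<^sub>C x + b *\<^sub>C x"
    and scaleC_scaleC [simp]: "a *\<^sub>C (b *\<^sub>C x) = (a * b) *\<^sub>C x"
    and scaleC_one [simp]: "1 *\<^sub>C x = x"

class complex_algebra = complex_vector + ring +
  assumes mult_scaleC_left [simp]: "(a *\<^sub>C x) * y = a *\<^sub>C (x * y)"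
    and mult_scaleC_right [simp]: "x * (a *\<^sub>C y) = a *\<^sub>C (x * y)"

class complex_algebra_1 = complex_algebra + ring_1

global_interpretation complex_vector: vector_space "scaleC :: complex \<Rightarrow> 'a \<Rightarrow> 'a::complex_vector"
  defines csubspace = complex_vector.subspace and cspan = complex_vector.span
  by unfold_locales (simp_all add: scaleC_add_right scaleC_add_left)

definition clinear :: "('a::complex_vector \<Rightarrow> 'b::complex_vector) \<Rightarrow> bool" where
  "clinear f \<longleftrightarrow> Vector_Spaces.linear scaleC scaleC f"

lemma clinearI:
  assumes "\<And>x y. f (x + y) = f x + f y" and "\<And>c x. f (c *\<^sub>C x) = c *\<^sub>C f x"
  shows "clinear f"
  unfolding clinear_def using assms
  by unfold_locales (simp_all add: scaleC_add_right scaleC_add_left)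

lemma clinear_add: "clinear f \<Longrightarrow> f (x + y) = f x + f y"
  by (simp add: clinear_def Vector_Spaces.linear_iff)

lemma clinear_scaleC: "clinear f \<Longrightarrow> f (c *\<^sub>C x) = c *\<^sub>C f x"
  by (simp add: clinear_def Vector_Spaces.linear_iff)

definition two_sided_ideal :: "'a::complex_algebra set \<Rightarrow> bool" where
  "two_sided_ideal J \<longleftrightarrow> csubspace J \<and> (\<forall>x\<in>J. \<forall>r. r * x \<in> J \<and> x * r \<in> J)"

lemma two_sided_ideal_hull: "two_sided_ideal (two_sided_ideal hull A)"
proof (rule hull_in)
  show "two_sided_ideal (\<Inter>T)" if "Ball T two_sided_ideal" for T :: "'a set set"
    using that complex_vector.subspace_Inter[of T] by (auto simp: two_sided_ideal_def)
qed

instantiation complex :: complex_algebra_1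
begin
definition scaleC_complex_def [simp]: "a *\<^sub>C (z::complex) = a * z"
instance by standard (simp_all add: algebra_simps)
end

instantiation prod :: (complex_vector, complex_vector) complex_vector
begin
definition scaleC_prod_def: "c *\<^sub>C p = (c *\<^sub>C fst p, c *\<^sub>C snd p)"
instance
  by standard (simp_all add: scaleC_prod_def scaleC_add_right scaleC_add_left prod_eq_iff)
end

instantiation poly_mapping :: (type, complex_vector) complex_vector
begin
definition scaleC_poly_mapping_def: "c *\<^sub>C p = Poly_Mapping.map ((*\<^sub>C) c) p"
lemma lookup_scaleC: "Poly_Mapping.lookup (c *\<^sub>C p) k = c *\<^sub>C Poly_Mapping.lookup p k"
  unfolding scaleC_poly_mapping_def by (transfer; simp add: when_def)
instance
  by standard
    (simp_all add: poly_mapping_eqI lookup_scaleC lookup_add scaleC_add_right scaleC_add_left)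
end

lemma scaleC_single: "c *\<^sub>C Poly_Mapping.single k a = Poly_Mapping.single k (c *\<^sub>C a)"
  by (rule poly_mapping_eqI) (simp add: lookup_scaleC lookup_single when_def)

lemma poly_mapping_single_induct [case_names zero add]:
  fixes p :: "'k \<Rightarrow>\<^sub>0 'b::monoid_add"
  assumes "P 0" and "\<And>q k a. P q \<Longrightarrow> P (q + Poly_Mapping.single k a)"
  shows "P p"
proof (induction p rule: update_induct)
  case const then show ?case by (rule assms(1))
next
  case (update f a b)
  have "Poly_Mapping.update a b f = f + Poly_Mapping.single a b"
    using update
    by (intro poly_mapping_eqI)
       (auto simp: lookup_update lookup_add lookup_single when_def in_keys_iff)
  then show ?case using assms(2) update by metis
qed

instance poly_mapping :: (monoid_add, complex_algebra_1) complex_algebra_1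
proof
  fix c :: complex and p q :: "'a \<Rightarrow>\<^sub>0 'b"
  have 1: "(c *\<^sub>C Poly_Mapping.single k a) * q = c *\<^sub>C (Poly_Mapping.single k a * q)" for k a
    by (induction q rule: poly_mapping_single_induct)
       (simp_all add: mult_single scaleC_single distrib_left scaleC_add_right)
  show "(c *\<^sub>C p) * q = c *\<^sub>C (p * q)"
    by (induction p rule: poly_mapping_single_induct)
       (simp_all add: 1 distrib_right scaleC_add_right)
  have 2: "p * (c *\<^sub>C Poly_Mapping.single k a) = c *\<^sub>C (p * Poly_Mapping.single k a)" for k a
    by (induction p rule: poly_mapping_single_induct)
       (simp_all add: mult_single scaleC_single distrib_right scaleC_add_right)
  show "p * (c *\<^sub>C q) = c *\<^sub>C (p * q)"
    by (induction q rule: poly_mapping_single_induct)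
       (simp_all add: 2 distrib_left scaleC_add_right)
qed

text \<open>Lists under concatenation are the free monoid, so \<open>'g list \<Rightarrow>\<^sub>0 complex\<close>, with the
  convolution product of \<^theory>\<open>HOL-Library.Poly_Mapping\<close>, is the free unital algebra on the
  symbols \<open>'g\<close>.\<close>

instantiation list :: (type) monoid_add
begin
definition zero_list_def: "0 = []"
definition plus_list_def: "xs + ys = xs @ ys"
instance by standard (simp_all add: zero_list_def plus_list_def)
end

definition free_lift :: "('k \<Rightarrow> 'a::complex_vector) \<Rightarrow> ('k \<Rightarrow>\<^sub>0 complex) \<Rightarrow> 'a" where
  "free_lift \<phi> p = (\<Sum>k\<in>Poly_Mapping.keys p. Poly_Mapping.lookup p k *\<^sub>C \<phi> k)"

lemma free_lift_superset:
  assumes "finite A" and "Poly_Mapping.keys p \<subseteq> A"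
  shows "free_lift \<phi> p = (\<Sum>k\<in>A. Poly_Mapping.lookup p k *\<^sub>C \<phi> k)"
  unfolding free_lift_def
  by (rule sum.mono_neutral_left) (use assms in \<open>auto simp: in_keys_iff\<close>)

lemma free_lift_add: "free_lift \<phi> (p + q) = free_lift \<phi> p + free_lift \<phi> q"
proof -
  let ?A = "Poly_Mapping.keys p \<union> Poly_Mapping.keys q"
  have "Poly_Mapping.keys (p + q) \<subseteq> ?A" by (rule keys_add)
  then show ?thesis
    by (simp add: free_lift_superset[of ?A] lookup_add scaleC_add_left sum.distrib)
qed

lemma free_lift_scaleC: "free_lift \<phi> (c *\<^sub>C p) = c *\<^sub>C free_lift \<phi> p"
proof -
  have "Poly_Mapping.keys (c *\<^sub>C p) \<subseteq> Poly_Mapping.keys p"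
    by (auto simp: in_keys_iff lookup_scaleC)
  then show ?thesis
    by (simp add: free_lift_superset[of "Poly_Mapping.keys p"] lookup_scaleC
        complex_vector.scale_sum_right)
qed

lemma free_lift_single [simp]: "free_lift \<phi> (Poly_Mapping.single k c) = c *\<^sub>C \<phi> k"
  by (cases "c = 0") (simp_all add: free_lift_def)

lemma free_lift_zero [simp]: "free_lift \<phi> 0 = 0"
  by (simp add: free_lift_def)

lemma free_lift_diff: "free_lift \<phi> (p - q) = free_lift \<phi> p - free_lift \<phi> q"
  using free_lift_add[of \<phi> "p - q" q] by (simp add: algebra_simps)


section \<open>Tensor products\<close>

definition bilinear_rel ::
    "(('a::complex_vector \<times> 'b::complex_vector) \<Rightarrow>\<^sub>0 complex) set" where
  "bilinear_rel = cspan
    (let s = (\<lambda>x y. Poly_Mapping.single (x, y) 1) in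
      {s (x + x') y - s x y - s x' y | x x' y. True} \<union>
      {s x (y + y') - s x y - s x y' | x y y'. True} \<union>
      {s (c *\<^sub>C x) y - c *\<^sub>C s x y | c x y. True} \<union>
      {s x (c *\<^sub>C y) - c *\<^sub>C s x y | c x y. True})"

lemma bilinear_rel_subspace: "csubspace bilinear_rel"
  by (simp add: bilinear_rel_def complex_vector.subspace_span)

definition tensor_eq ::
    "(('a::complex_vector \<times> 'b::complex_vector) \<Rightarrow>\<^sub>0 complex) \<Rightarrow> (('a \<times> 'b) \<Rightarrow>\<^sub>0 complex) \<Rightarrow> bool" where
  "tensor_eq p q \<longleftrightarrow> p - q \<in> bilinear_rel"

lemma csubspace_equivp:
  assumes "csubspace U"
  shows "equivp (\<lambda>p q. p - q \<in> U)"
proof (rule equivpI)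
  show "reflp (\<lambda>p q. p - q \<in> U)"
    by (rule reflpI) (simp add: complex_vector.subspace_0[OF assms])
  show "symp (\<lambda>p q. p - q \<in> U)"
    by (rule sympI) (metis assms complex_vector.subspace_neg minus_diff_eq)
  show "transp (\<lambda>p q. p - q \<in> U)"
  proof (rule transpI)
    fix x y z assume "x - y \<in> U" "y - z \<in> U"
    from complex_vector.subspace_add[OF assms this] show "x - z \<in> U" by simp
  qed
qed

quotient_type (overloaded) ('a, 'b) tensor =
    "('a::complex_vector \<times> 'b::complex_vector) \<Rightarrow>\<^sub>0 complex" / tensor_eq
  using csubspace_equivp[OF bilinear_rel_subspace]
  by (simp add: tensor_eq_def[abs_def])

instantiation tensor :: (complex_vector, complex_vector) complex_vector
begin

lift_definition zero_tensor :: "('a, 'b) tensor" is 0 .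

lift_definition plus_tensor :: "('a, 'b) tensor \<Rightarrow> ('a, 'b) tensor \<Rightarrow> ('a, 'b) tensor" is "(+)"
  unfolding tensor_eq_def add_diff_add
  by (rule complex_vector.subspace_add[OF bilinear_rel_subspace])

lift_definition uminus_tensor :: "('a, 'b) tensor \<Rightarrow> ('a, 'b) tensor" is uminus
  unfolding tensor_eq_def minus_diff_minus
  by (rule complex_vector.subspace_neg[OF bilinear_rel_subspace])

definition minus_tensor :: "('a, 'b) tensor \<Rightarrow> ('a, 'b) tensor \<Rightarrow> ('a, 'b) tensor" where
  "minus_tensor s t = s + - t"

lift_definition scaleC_tensor :: "complex \<Rightarrow> ('a, 'b) tensor \<Rightarrow> ('a, 'b) tensor" is "(*\<^sub>C)"
  unfolding tensor_eq_def complex_vector.scale_right_diff_distrib[symmetric]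
  by (rule complex_vector.subspace_scale[OF bilinear_rel_subspace])

lemma tensor_eq_refl: "tensor_eq p p"
  by (simp add: tensor_eq_def complex_vector.subspace_0[OF bilinear_rel_subspace])

instance
proof
  fix r s t :: "('a, 'b) tensor" and a b :: complex
  show "r + s + t = r + (s + t)"
    by transfer (simp add: tensor_eq_refl add.assoc)
  show "r + s = s + r"
    by transfer (simp add: tensor_eq_refl add.commute)
  show "0 + r = r"
    by transfer (simp add: tensor_eq_refl)
  show "- r + r = 0"
    by transfer (simp add: tensor_eq_refl)
  show "r - s = r + - s"
    by (rule minus_tensor_def)
  show "a *\<^sub>C (r + s) = a *\<^sub>C r + a *\<^sub>C s"
    by transfer (simp add: tensor_eq_refl scaleC_add_right)
  show "(a + b) *\<^sub>C r = a *\<^sub>C r + b *\<^sub>C r"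
    by transfer (simp add: tensor_eq_refl scaleC_add_left)
  show "a *\<^sub>C (b *\<^sub>C r) = (a * b) *\<^sub>C r"
    by transfer (simp add: tensor_eq_refl)
  show "1 *\<^sub>C r = r"
    by transfer (simp add: tensor_eq_refl)
qed

end

lift_definition pure_tensor :: "'a::complex_vector \<Rightarrow> 'b::complex_vector \<Rightarrow> ('a, 'b) tensor"
    (infixr "\<otimes>\<^sub>C" 72)
  is "\<lambda>x y. Poly_Mapping.single (x, y) 1" .

text \<open>For bilinear \<open>f\<close>, \<open>tensor_lift f\<close> is the induced linear map on the tensor product: the choice of
  representative made by \<^const>\<open>rep_tensor\<close> is irrelevant, see \<open>tensor_lift_pure\<close> below.  In Sweedler
  notation, \<open>tensor_lift f (comult H h)\<close> is the sum of the \<open>f h\<^sub>0 h\<^sub>1\<close>.\<close>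

definition tensor_lift ::
    "('a::complex_vector \<Rightarrow> 'b::complex_vector \<Rightarrow> 'c::complex_vector) \<Rightarrow> ('a, 'b) tensor \<Rightarrow> 'c" where
  "tensor_lift f t = free_lift (\<lambda>(x, y). f x y) (rep_tensor t)"

definition cbilinear ::
    "('a::complex_vector \<Rightarrow> 'b::complex_vector \<Rightarrow> 'c::complex_vector) \<Rightarrow> bool" where
  "cbilinear f \<longleftrightarrow> (\<forall>y. clinear (\<lambda>x. f x y)) \<and> (\<forall>x. clinear (f x))"

lemma free_lift_bilinear_rel:
  assumes "cbilinear f" and "p \<in> bilinear_rel"
  shows "free_lift (\<lambda>(x, y). f x y) p = 0"
proof -
  have 1: "clinear (\<lambda>x. f x y)" and 2: "clinear (f x)" for x y
    using assms(1) by (auto simp: cbilinear_def)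
  note L = clinear_add[OF 1] clinear_scaleC[OF 1] clinear_add[OF 2] clinear_scaleC[OF 2]
  have "csubspace {p. free_lift (\<lambda>(x, y). f x y) p = 0}"
    by (rule complex_vector.subspaceI) (simp_all add: free_lift_add free_lift_scaleC)
  then have "bilinear_rel \<subseteq> {p. free_lift (\<lambda>(x, y). f x y) p = 0}"
    unfolding bilinear_rel_def
    by (rule complex_vector.span_minimal[rotated])
       (auto simp: Let_def free_lift_diff free_lift_scaleC L)
  then show ?thesis using assms(2) by blast
qed

lemma tensor_lift_abs:
  assumes "cbilinear f"
  shows "tensor_lift f (abs_tensor p) = free_lift (\<lambda>(x, y). f x y) p"
proof -
  have "tensor_eq (rep_tensor (abs_tensor p)) p"
    by (rule Quotient3_rep_abs[OF Quotient3_tensor]) (rule tensor_eq_refl)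
  then have "rep_tensor (abs_tensor p) - p \<in> bilinear_rel"
    by (simp add: tensor_eq_def)
  from free_lift_bilinear_rel[OF assms this] show ?thesis
    by (simp add: tensor_lift_def free_lift_diff)
qed

lemma tensor_lift_pure: "cbilinear f \<Longrightarrow> tensor_lift f (x \<otimes>\<^sub>C y) = f x y"
  by (simp add: pure_tensor.abs_eq tensor_lift_abs)

lemma clinear_tensor_lift:
  assumes "cbilinear f"
  shows "clinear (tensor_lift f)"
proof (rule clinearI)
  show "tensor_lift f (s + t) = tensor_lift f s + tensor_lift f t" for s t
    by (induction s; induction t)
       (simp add: plus_tensor.abs_eq tensor_lift_abs[OF assms] free_lift_add)
  show "tensor_lift f (c *\<^sub>C t) = c *\<^sub>C tensor_lift f t" for c t
    by (induction t)
       (simp add: scaleC_tensor.abs_eq tensor_lift_abs[OF assms] free_lift_scaleC)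
qed


section \<open>Hopf algebras\<close>

record (overloaded) 'h hopf_data =
  comult :: "'h \<Rightarrow> ('h, 'h) tensor"
  counit :: "'h \<Rightarrow> complex"
  antipode :: "'h \<Rightarrow> 'h"

abbreviation sweedler ::
    "'h::complex_vector hopf_data \<Rightarrow> 'h \<Rightarrow> ('h \<Rightarrow> 'h \<Rightarrow> 'c::complex_vector) \<Rightarrow> 'c" where
  "sweedler H h f \<equiv> tensor_lift f (comult H h)"

locale hopf_algebra =
  fixes H :: "'h::complex_algebra_1 hopf_data"
  assumes comult_linear: "clinear (comult H)"
    and counit_linear: "clinear (counit H)"
    and antipode_linear: "clinear (antipode H)"
    and coassoc:
      "sweedler H h (\<lambda>a b. sweedler H a (\<lambda>a0 a1. a0 \<otimes>\<^sub>C a1 \<otimes>\<^sub>C b)) =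
       sweedler H h (\<lambda>a b. sweedler H b (\<lambda>b0 b1. a \<otimes>\<^sub>C b0 \<otimes>\<^sub>C b1))"
    and counit_left: "sweedler H h (\<lambda>a b. counit H a *\<^sub>C b) = h"
    and counit_right: "sweedler H h (\<lambda>a b. counit H b *\<^sub>C a) = h"
    and comult_one: "comult H 1 = 1 \<otimes>\<^sub>C 1"
    and comult_mult:
      "comult H (g * h) =
       sweedler H g (\<lambda>g0 g1. sweedler H h (\<lambda>h0 h1. (g0 * h0) \<otimes>\<^sub>C (g1 * h1)))"
    and counit_one: "counit H 1 = 1"
    and counit_mult: "counit H (g * h) = counit H g * counit H h"
    and antipode_left: "sweedler H h (\<lambda>a b. antipode H a * b) = counit H h *\<^sub>C 1"
    and antipode_right: "sweedler H h (\<lambda>a b. a * antipode H b) = counit H h *\<^sub>C 1"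

definition character :: "('h::complex_algebra_1 \<Rightarrow> complex) \<Rightarrow> bool" where
  "character \<delta> \<longleftrightarrow> clinear \<delta> \<and> (\<forall>g h. \<delta> (g * h) = \<delta> g * \<delta> h) \<and> (\<exists>h. \<delta> h \<noteq> 0)"

definition twisted_antipode ::
    "'h::complex_algebra_1 hopf_data \<Rightarrow> ('h \<Rightarrow> complex) \<Rightarrow> 'h \<Rightarrow> 'h" where
  "twisted_antipode H \<delta> h = sweedler H h (\<lambda>h0 h1. \<delta> h0 *\<^sub>C antipode H h1)"

definition coinv ::
    "('h \<Rightarrow> complex) \<Rightarrow> ('h \<Rightarrow> 'v \<Rightarrow> 'v) \<Rightarrow> 'v::complex_vector set" where
  "coinv \<delta> act = cspan {act h v - \<delta> h *\<^sub>C v | h v. True}"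


section \<open>Quotient spaces and bicomplexes\<close>

record 'a cspace =
  vs_carrier :: "'a set"
  vs_add :: "'a \<Rightarrow> 'a \<Rightarrow> 'a"
  vs_zero :: 'a
  vs_scale :: "complex \<Rightarrow> 'a \<Rightarrow> 'a"

definition is_cspace :: "'a cspace \<Rightarrow> bool" where
  "is_cspace M \<longleftrightarrow>
    (let V = vs_carrier M; add = vs_add M; e = vs_zero M; sc = vs_scale M in
      e \<in> V \<and> (\<forall>x\<in>V. \<forall>y\<in>V. add x y \<in> V) \<and> (\<forall>c. \<forall>x\<in>V. sc c x \<in> V) \<and>
      (\<forall>x\<in>V. \<forall>y\<in>V. \<forall>z\<in>V. add (add x y) z = add x (add y z)) \<and>
      (\<forall>x\<in>V. \<forall>y\<in>V. add x y = add y x) \<and>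
      (\<forall>x\<in>V. add e x = x) \<and> (\<forall>x\<in>V. \<exists>y\<in>V. add x y = e) \<and>
      (\<forall>c. \<forall>x\<in>V. \<forall>y\<in>V. sc c (add x y) = add (sc c x) (sc c y)) \<and>
      (\<forall>c d. \<forall>x\<in>V. sc (c + d) x = add (sc c x) (sc d x)) \<and>
      (\<forall>c d. \<forall>x\<in>V. sc c (sc d x) = sc (c * d) x) \<and> (\<forall>x\<in>V. sc 1 x = x))"

definition vs_linear :: "'a cspace \<Rightarrow> 'b cspace \<Rightarrow> ('a \<Rightarrow> 'b) \<Rightarrow> bool" where
  "vs_linear M N f \<longleftrightarrow>
    f ` vs_carrier M \<subseteq> vs_carrier N \<and>
    (\<forall>x\<in>vs_carrier M. \<forall>y\<in>vs_carrier M. f (vs_add M x y) = vs_add N (f x) (f y)) \<and>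
    (\<forall>c. \<forall>x\<in>vs_carrier M. f (vs_scale M c x) = vs_scale N c (f x))"

definition vs_iso :: "'a cspace \<Rightarrow> 'b cspace \<Rightarrow> ('a \<Rightarrow> 'b) \<Rightarrow> bool" where
  "vs_iso M N f \<longleftrightarrow> vs_linear M N f \<and> bij_betw f (vs_carrier M) (vs_carrier N)"

definition coset :: "'a::complex_vector set \<Rightarrow> 'a \<Rightarrow> 'a set" where
  "coset U v = (\<lambda>u. v + u) ` U"

text \<open>\<open>quot V U\<close> is the image of the subspace \<open>V\<close> in the quotient by the subspace \<open>U\<close> of the
  ambient space; \<open>U\<close> need not be contained in \<open>V\<close>.  With \<open>V\<close> a homogeneous component it is the
  corresponding homogeneous component of the quotient.\<close>

definition quot :: "'a::complex_vector set \<Rightarrow> 'a set \<Rightarrow> 'a set cspace" where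
  "quot V U =
    \<lparr>vs_carrier = coset U ` V,
     vs_add = (\<lambda>A B. \<Union>a\<in>A. \<Union>b\<in>B. coset U (a + b)),
     vs_zero = U,
     vs_scale = (\<lambda>c A. \<Union>a\<in>A. coset U (c *\<^sub>C a))\<rparr>"

text \<open>The map induced by \<open>f\<close> on cosets, with values in cosets of \<open>U\<close>.  If \<open>f\<close> does not descend to
  the quotients, a value is a union of several cosets of \<open>U\<close>, which \<open>vs_linear\<close> excludes.\<close>

definition descend :: "'b::complex_vector set \<Rightarrow> ('a \<Rightarrow> 'b) \<Rightarrow> 'a set \<Rightarrow> 'b set" where
  "descend U f A = (\<Union>a\<in>A. coset U (f a))"

record 'a bicomplex =
  obj :: "int \<Rightarrow> int \<Rightarrow> 'a cspace"
  hor :: "int \<Rightarrow> int \<Rightarrow> 'a \<Rightarrow> 'a"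
  vert :: "int \<Rightarrow> int \<Rightarrow> 'a \<Rightarrow> 'a"

text \<open>The squares of a bicomplex commute here (they do not anticommute).\<close>

definition is_bicomplex :: "'a bicomplex \<Rightarrow> bool" where
  "is_bicomplex B \<longleftrightarrow> (\<forall>p q.
    is_cspace (obj B p q) \<and>
    vs_linear (obj B p q) (obj B (p + 1) q) (hor B p q) \<and>
    vs_linear (obj B p q) (obj B p (q + 1)) (vert B p q) \<and>
    (\<forall>x\<in>vs_carrier (obj B p q).
      hor B (p + 1) q (hor B p q x) = vs_zero (obj B (p + 2) q) \<and>
      vert B p (q + 1) (vert B p q x) = vs_zero (obj B p (q + 2)) \<and>
      hor B p (q + 1) (vert B p q x) = vert B (p + 1) q (hor B p q x)))"

definition bicomplex_iso :: "'a bicomplex \<Rightarrow> 'b bicomplex \<Rightarrow> bool" where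
  "bicomplex_iso A B \<longleftrightarrow> is_bicomplex A \<and> is_bicomplex B \<and>
    (\<exists>\<Phi>. \<forall>p q.
      vs_iso (obj A p q) (obj B p q) (\<Phi> p q) \<and>
      (\<forall>x\<in>vs_carrier (obj A p q).
        \<Phi> (p + 1) q (hor A p q x) = hor B p q (\<Phi> p q x) \<and>
        \<Phi> p (q + 1) (vert A p q x) = vert B p q (\<Phi> p q x)))"

definition vshift :: "int \<Rightarrow> 'a bicomplex \<Rightarrow> 'a bicomplex" where
  "vshift k B =
    \<lparr>obj = (\<lambda>p q. obj B p (q + k)), hor = (\<lambda>p q. hor B p (q + k)),
     vert = (\<lambda>p q. vert B p (q + k))\<rparr>"

definition koszul :: "int \<Rightarrow> complex" where
  "koszul k = (if even k then 1 else -1)"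


section \<open>The X-complex of an H DG algebra\<close>

text \<open>The data of an H DG algebra with underlying algebra \<open>'r\<close>: the projections
  \<open>hcomp R k\<close> onto the homogeneous components (which encode the grading), the differential and
  the action of \<open>H\<close>.\<close>

record ('h, 'r) hdg_data =
  hcomp :: "int \<Rightarrow> 'r \<Rightarrow> 'r"
  diff :: "'r \<Rightarrow> 'r"
  act :: "'h \<Rightarrow> 'r \<Rightarrow> 'r"

text \<open>\<open>R\<close> with a unit adjoined is \<open>complex \<times> 'r\<close>; \<open>Pair 0\<close> embeds \<open>R\<close>.\<close>

definition umult :: "complex \<times> 'r \<Rightarrow> complex \<times> 'r \<Rightarrow> complex \<times> 'r::complex_algebra" where
  "umult u v = (fst u * fst v, fst u *\<^sub>C snd v + fst v *\<^sub>C snd u + snd u * snd v)"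

definition uhcomp ::
    "('h, 'r::complex_algebra) hdg_data \<Rightarrow> int \<Rightarrow> complex \<times> 'r \<Rightarrow> complex \<times> 'r" where
  "uhcomp R k u = (if k = 0 then fst u else 0, hcomp R k (snd u))"

definition udiff :: "('h, 'r::complex_algebra) hdg_data \<Rightarrow> complex \<times> 'r \<Rightarrow> complex \<times> 'r" where
  "udiff R u = (0, diff R (snd u))"

definition uact ::
    "'h hopf_data \<Rightarrow> ('h, 'r::complex_algebra) hdg_data \<Rightarrow> 'h \<Rightarrow> complex \<times> 'r \<Rightarrow> complex \<times> 'r" where
  "uact H R h u = (counit H h * fst u, act R h (snd u))"

definition usign :: "('h, 'r::complex_algebra) hdg_data \<Rightarrow> complex \<times> 'r \<Rightarrow> complex \<times> 'r" where
  "usign R u = (\<Sum>k | uhcomp R k u \<noteq> 0. koszul k *\<^sub>C uhcomp R k u)"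

definition gcommutator ::
    "('h, 'r::complex_algebra) hdg_data \<Rightarrow> complex \<times> 'r \<Rightarrow> complex \<times> 'r \<Rightarrow> complex \<times> 'r" where
  "gcommutator R u v =
    (\<Sum>i | uhcomp R i u \<noteq> 0. \<Sum>j | uhcomp R j v \<noteq> 0.
      umult (uhcomp R i u) (uhcomp R j v) - koszul (i * j) *\<^sub>C umult (uhcomp R j v) (uhcomp R i u))"

text \<open>In a one-form \<open>x \<otimes>\<^sub>C y\<close> stands for \<open>x dy\<close>.\<close>

type_synonym 'r forms = "(complex \<times> 'r, 'r) tensor"

definition form_lmult :: "'r \<Rightarrow> 'r forms \<Rightarrow> 'r::complex_algebra forms" where
  "form_lmult a = tensor_lift (\<lambda>x y. umult (0, a) x \<otimes>\<^sub>C y)"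

text \<open>The right module structure is dictated by the Leibniz rule: \<open>(x dy) a = x d(ya) - xy da\<close>.\<close>

definition form_rmult :: "'r forms \<Rightarrow> 'r \<Rightarrow> 'r::complex_algebra forms" where
  "form_rmult w a = tensor_lift (\<lambda>x y. x \<otimes>\<^sub>C (y * a) - umult x (0, y) \<otimes>\<^sub>C a) w"

definition form_diff :: "('h, 'r::complex_algebra) hdg_data \<Rightarrow> 'r forms \<Rightarrow> 'r forms" where
  "form_diff R = tensor_lift (\<lambda>x y. udiff R x \<otimes>\<^sub>C y + usign R x \<otimes>\<^sub>C diff R y)"

definition form_act ::
    "'h::complex_vector hopf_data \<Rightarrow> ('h, 'r::complex_algebra) hdg_data \<Rightarrow> 'h \<Rightarrow> 'r forms \<Rightarrow> 'r forms" where
  "form_act H R h =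
    tensor_lift (\<lambda>x y. sweedler H h (\<lambda>h0 h1. uact H R h0 x \<otimes>\<^sub>C act R h1 y))"

definition form_homog :: "('h, 'r::complex_algebra) hdg_data \<Rightarrow> int \<Rightarrow> 'r forms set" where
  "form_homog R k = cspan {uhcomp R i x \<otimes>\<^sub>C hcomp R j y | i j x y. i + j = k}"

definition form_commutators :: "('h, 'r::complex_algebra) hdg_data \<Rightarrow> 'r forms set" where
  "form_commutators R =
    cspan {form_rmult w a - koszul (k * l) *\<^sub>C form_lmult a w
      | w a k l. w \<in> form_homog R k \<and> a \<in> range (hcomp R l)}"

definition form_d :: "'r \<Rightarrow> 'r::complex_algebra forms" where
  "form_d x = (1, 0) \<otimes>\<^sub>C x"

definition form_b :: "('h, 'r::complex_algebra) hdg_data \<Rightarrow> 'r forms \<Rightarrow> 'r" where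
  "form_b R = tensor_lift (\<lambda>x y. snd (gcommutator R x (0, y)))"

text \<open>Powers of an ideal of \<open>R\<close>, as subspaces of \<open>R\<close> with a unit adjoined; the power with exponent
  \<open>0\<close> is all of the latter.\<close>

primrec ideal_power :: "'r::complex_algebra set \<Rightarrow> nat \<Rightarrow> (complex \<times> 'r) set" where
  "ideal_power I 0 = UNIV"
| "ideal_power I (Suc k) = cspan {umult u (0, x) | u x. u \<in> ideal_power I k \<and> x \<in> I}"

definition ideal_power_coinv ::
    "('h \<Rightarrow> complex) \<Rightarrow> ('h, 'r::complex_algebra) hdg_data \<Rightarrow> 'r set \<Rightarrow> nat \<Rightarrow> 'r set" where
  "ideal_power_coinv \<delta> R I k = cspan ({x. (0, x) \<in> ideal_power I k} \<union> coinv \<delta> (act R))"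

text \<open>The iterated quotient of the one-forms by commutators, coinvariants and the image of
  \<open>I\<^sup>n\<^sup>+\<^sup>1 dR + I\<^sup>n dI\<close> is taken in one step, by the sum of these subspaces.\<close>

definition form_relations ::
    "'h::complex_vector hopf_data \<Rightarrow> ('h \<Rightarrow> complex) \<Rightarrow> ('h, 'r::complex_algebra) hdg_data \<Rightarrow> 'r set \<Rightarrow> nat \<Rightarrow> 'r forms set" where
  "form_relations H \<delta> R I n = cspan
    (form_commutators R \<union> coinv \<delta> (form_act H R) \<union>
     {x \<otimes>\<^sub>C y | x y. x \<in> ideal_power I (n + 1)} \<union>
     {x \<otimes>\<^sub>C y | x y. x \<in> ideal_power I n \<and> y \<in> I})"

text \<open>The super-complex lives on quotients of \<open>R \<oplus> \<Omega>\<^sup>1(R)\<close>: the columns with even index are the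
  quotient of \<open>R\<close>, those with odd index the quotient of the one-forms.  The vertical degree is the
  degree inherited from \<open>R\<close>, with \<open>d\<close> of degree zero.\<close>

definition X_relations ::
    "'h::complex_vector hopf_data \<Rightarrow> ('h \<Rightarrow> complex) \<Rightarrow> ('h, 'r::complex_algebra) hdg_data \<Rightarrow> 'r set \<Rightarrow> nat
      \<Rightarrow> int \<Rightarrow> ('r \<times> 'r forms) set" where
  "X_relations H \<delta> R I n p =
    (if even p then ideal_power_coinv \<delta> R I (n + 1) \<times> {0}
     else {0} \<times> form_relations H \<delta> R I n)"

definition X_bicomplex ::
    "'h::complex_vector hopf_data \<Rightarrow> ('h \<Rightarrow> complex) \<Rightarrow> ('h, 'r::complex_algebra) hdg_data \<Rightarrow> 'r set \<Rightarrow> nat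
      \<Rightarrow> ('r \<times> 'r forms) set bicomplex" where
  "X_bicomplex H \<delta> R I n =
    \<lparr>obj = (\<lambda>p q. quot
        (if even p then range (hcomp R q) \<times> {0} else {0} \<times> form_homog R q)
        (X_relations H \<delta> R I n p)),
     hor = (\<lambda>p q. descend (X_relations H \<delta> R I n (p + 1)) (\<lambda>(x, w). (form_b R w, form_d x))),
     vert = (\<lambda>p q. descend (X_relations H \<delta> R I n p) (\<lambda>(x, w). (diff R x, form_diff R w)))\<rparr>"


section \<open>The Weil complex\<close>

datatype 'h weil_gen = Gen 'h | Omega 'h

primrec gen_degree :: "'h weil_gen \<Rightarrow> int" where
  "gen_degree (Gen h) = 1"
| "gen_degree (Omega h) = 2"

definition word_degree :: "'h weil_gen list \<Rightarrow> int" where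
  "word_degree w = sum_list (map gen_degree w)"

definition weil_rel :: "('h::complex_vector weil_gen list \<Rightarrow>\<^sub>0 complex) set" where
  "weil_rel = two_sided_ideal hull
    (let s = (\<lambda>a. Poly_Mapping.single [a] 1) in
      {s (G (h + k)) - s (G h) - s (G k) | G h k. G \<in> {Gen, Omega}} \<union>
      {s (G (c *\<^sub>C h)) - c *\<^sub>C s (G h) | G c h. G \<in> {Gen, Omega}})"

lemma weil_rel_ideal: "two_sided_ideal weil_rel"
  by (simp add: weil_rel_def two_sided_ideal_hull)

lemma weil_rel_subspace: "csubspace weil_rel"
  by (rule weil_rel_ideal[unfolded two_sided_ideal_def, THEN conjunct1])

text \<open>The condition on the empty word restricts to the augmentation ideal of the free unital algebra,
  i.e. to the free non-unital algebra.\<close>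

definition weil_eq ::
    "('h::complex_vector weil_gen list \<Rightarrow>\<^sub>0 complex) \<Rightarrow> ('h weil_gen list \<Rightarrow>\<^sub>0 complex) \<Rightarrow> bool" where
  "weil_eq p q \<longleftrightarrow>
    [] \<notin> Poly_Mapping.keys p \<and> [] \<notin> Poly_Mapping.keys q \<and> p - q \<in> weil_rel"

lemma weil_eq_refl: "weil_eq p p \<longleftrightarrow> [] \<notin> Poly_Mapping.keys p"
  by (auto simp: weil_eq_def complex_vector.subspace_0[OF weil_rel_subspace])

lemma part_equivp_weil_eq: "part_equivp weil_eq"
proof (rule part_equivpI)
  show "\<exists>x. weil_eq x x" by (rule exI[of _ 0]) (simp add: weil_eq_refl)
  show "symp weil_eq"
    using equivp_symp[OF csubspace_equivp[OF weil_rel_subspace]]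
    by (auto simp: symp_def weil_eq_def)
  show "transp weil_eq"
    using equivp_transp[OF csubspace_equivp[OF weil_rel_subspace]]
    unfolding transp_def weil_eq_def by blast
qed

quotient_type (overloaded) 'h weil =
    "'h::complex_vector weil_gen list \<Rightarrow>\<^sub>0 complex" / partial: weil_eq
  by (rule part_equivp_weil_eq)

instantiation weil :: (complex_vector) complex_algebra
begin

lift_definition zero_weil :: "'a weil" is 0
  by (simp add: weil_eq_refl)

lift_definition plus_weil :: "'a weil \<Rightarrow> 'a weil \<Rightarrow> 'a weil" is "(+)"
  using complex_vector.subspace_add[OF weil_rel_subspace] keys_add
  by (fastforce simp: weil_eq_def add_diff_add)

lift_definition uminus_weil :: "'a weil \<Rightarrow> 'a weil" is uminus
  unfolding weil_eq_def minus_diff_minus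
  by (intro conjI complex_vector.subspace_neg[OF weil_rel_subspace]) (auto simp: in_keys_iff)

definition minus_weil :: "'a weil \<Rightarrow> 'a weil \<Rightarrow> 'a weil" where
  "minus_weil x y = x + - y"

lift_definition scaleC_weil :: "complex \<Rightarrow> 'a weil \<Rightarrow> 'a weil" is "(*\<^sub>C)"
  unfolding weil_eq_def complex_vector.scale_right_diff_distrib[symmetric]
  using complex_vector.subspace_scale[OF weil_rel_subspace]
  by (auto simp: in_keys_iff lookup_scaleC)

lift_definition times_weil :: "'a weil \<Rightarrow> 'a weil \<Rightarrow> 'a weil" is "(*)"
proof -
  fix p p' q q' :: "'a weil_gen list \<Rightarrow>\<^sub>0 complex"
  assume *: "weil_eq p p'" "weil_eq q q'"
  have "p * q - p' * q' = (p - p') * q + p' * (q - q')" by (simp add: algebra_simps)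
  moreover have "(p - p') * q \<in> weil_rel" "p' * (q - q') \<in> weil_rel"
    using * weil_rel_ideal by (auto simp: weil_eq_def two_sided_ideal_def)
  ultimately have "p * q - p' * q' \<in> weil_rel"
    by (simp add: complex_vector.subspace_add[OF weil_rel_subspace])
  moreover have "[] \<notin> Poly_Mapping.keys (u * v)"
    if "[] \<notin> Poly_Mapping.keys u" for u v :: "'a weil_gen list \<Rightarrow>\<^sub>0 complex"
    using that keys_mult[of u v] by (auto simp: plus_list_def)
  ultimately show "weil_eq (p * q) (p' * q')"
    using * by (simp add: weil_eq_def)
qed

instance
proof
  have keys: "[] \<notin> Poly_Mapping.keys (p + q)"
    if "[] \<notin> Poly_Mapping.keys p" "[] \<notin> Poly_Mapping.keys q"
    for p q :: "'a weil_gen list \<Rightarrow>\<^sub>0 complex"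
    using that keys_add[of p q] by auto
  have keysm: "[] \<notin> Poly_Mapping.keys (p * q)"
    if "[] \<notin> Poly_Mapping.keys p"
    for p q :: "'a weil_gen list \<Rightarrow>\<^sub>0 complex"
    using that keys_mult[of p q] by (auto simp: plus_list_def)
  have keyss: "[] \<notin> Poly_Mapping.keys (c *\<^sub>C p)"
    if "[] \<notin> Poly_Mapping.keys p" for c and p :: "'a weil_gen list \<Rightarrow>\<^sub>0 complex"
    using that by (simp add: in_keys_iff lookup_scaleC)
  note K = weil_eq_refl keys keysm keyss
  fix r s t :: "'a weil" and a b :: complex
  show "r + s + t = r + (s + t)"
    by transfer (simp add: K add.assoc)
  show "r + s = s + r"
    by transfer (simp add: K add.commute)
  show "0 + r = r"
    by transfer (simp add: K)
  show "- r + r = 0"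
    by transfer (simp add: K)
  show "r - s = r + - s"
    by (rule minus_weil_def)
  show "a *\<^sub>C (r + s) = a *\<^sub>C r + a *\<^sub>C s"
    by transfer (simp add: K scaleC_add_right)
  show "(a + b) *\<^sub>C r = a *\<^sub>C r + b *\<^sub>C r"
    by transfer (simp add: K scaleC_add_left)
  show "a *\<^sub>C (b *\<^sub>C r) = (a * b) *\<^sub>C r"
    by transfer (simp add: K)
  show "1 *\<^sub>C r = r"
    by transfer (simp add: K)
  show "r * s * t = r * (s * t)"
    by transfer (simp add: K mult.assoc)
  show "(r + s) * t = r * t + s * t"
    by transfer (simp add: K distrib_right)
  show "r * (s + t) = r * s + r * t"
    by transfer (simp add: K distrib_left)
  show "(a *\<^sub>C r) * s = a *\<^sub>C (r * s)"
    by transfer (simp add: K)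
  show "r * (a *\<^sub>C s) = a *\<^sub>C (r * s)"
    by transfer (simp add: K)
qed

end

lift_definition weil_word :: "'h::complex_vector weil_gen list \<Rightarrow> 'h weil"
  is "\<lambda>w. if w = [] then 0 else Poly_Mapping.single w 1"
  by (simp add: weil_eq_refl)

text \<open>For \<open>\<phi>\<close> multilinear in the symbols of a word, \<open>weil_lift \<phi>\<close> is the linear map with value
  \<open>\<phi> w\<close> on the product \<open>w\<close> of generators: see \<open>weil_lift_word\<close>.\<close>

definition weil_lift ::
    "('h weil_gen list \<Rightarrow> 'c::complex_vector) \<Rightarrow> 'h::complex_vector weil \<Rightarrow> 'c" where
  "weil_lift \<phi> x = free_lift \<phi> (rep_weil x)"

lemma weil_lift_word:
  fixes \<phi> :: "'h::complex_vector weil_gen list \<Rightarrow> 'c::complex_vector"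
  assumes "\<And>u v h k. \<phi> (u @ Gen (h + k) # v) = \<phi> (u @ Gen h # v) + \<phi> (u @ Gen k # v)"
    and "\<And>u v h k. \<phi> (u @ Omega (h + k) # v) = \<phi> (u @ Omega h # v) + \<phi> (u @ Omega k # v)"
    and "\<And>u v c h. \<phi> (u @ Gen (c *\<^sub>C h) # v) = c *\<^sub>C \<phi> (u @ Gen h # v)"
    and "\<And>u v c h. \<phi> (u @ Omega (c *\<^sub>C h) # v) = c *\<^sub>C \<phi> (u @ Omega h # v)"
    and "w \<noteq> []"
  shows "weil_lift \<phi> (weil_word w) = \<phi> w"
proof -
  let ?s = "\<lambda>w :: 'h weil_gen list. Poly_Mapping.single w (1::complex)"
  define J where "J = {p. \<forall>u v. free_lift \<phi> (?s u * p * ?s v) = 0}"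
  have s_eq: "Poly_Mapping.single w a = a *\<^sub>C ?s w" for w and a :: complex
    by (simp add: scaleC_single)
  have ss: "?s u * ?s v = ?s (u @ v)" for u v
    by (simp add: mult_single plus_list_def)
  have sub: "csubspace J"
    unfolding J_def
    by (rule complex_vector.subspaceI)
      (simp_all add: free_lift_add free_lift_scaleC distrib_left distrib_right)
  have left: "r * p \<in> J" if "p \<in> J" for r p
  proof (induction r rule: poly_mapping_single_induct)
    case zero then show ?case by (simp add: complex_vector.subspace_0[OF sub])
  next
    case (add q k a)
    have "free_lift \<phi> (?s u * (?s k * p) * ?s v) = 0" for u v
      using that ss[of u k] by (simp add: J_def mult.assoc[symmetric])
    then have "?s k * p \<in> J" by (simp add: J_def)
    then show ?case
      using add by (subst s_eq) (simp add: distrib_right complex_vector.subspace_add[OF sub]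
          complex_vector.subspace_scale[OF sub])
  qed
  have right: "p * r \<in> J" if "p \<in> J" for r p
  proof (induction r rule: poly_mapping_single_induct)
    case zero then show ?case by (simp add: complex_vector.subspace_0[OF sub])
  next
    case (add q k a)
    have "free_lift \<phi> (?s u * (p * ?s k) * ?s v) = 0" for u v
      using that ss[of k v] by (simp add: J_def mult.assoc)
    then have "p * ?s k \<in> J" by (simp add: J_def)
    then show ?case
      using add by (subst s_eq) (simp add: distrib_left complex_vector.subspace_add[OF sub]
          complex_vector.subspace_scale[OF sub])
  qed
  have ideal: "two_sided_ideal J"
    using sub left right by (simp add: two_sided_ideal_def)
  have "weil_rel \<subseteq> J"
    unfolding weil_rel_def
  proof (rule hull_minimal[of _ J two_sided_ideal], unfold Let_def, intro Un_least subsetI)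
    fix p :: "'h weil_gen list \<Rightarrow>\<^sub>0 complex"
    assume "p \<in> {?s [G (h + k)] - ?s [G h] - ?s [G k] | G h k. G \<in> {Gen, Omega}}"
    then show "p \<in> J"
      by (auto simp: J_def left_diff_distrib right_diff_distrib ss free_lift_diff assms)
  next
    fix p :: "'h weil_gen list \<Rightarrow>\<^sub>0 complex"
    assume "p \<in> {?s [G (c *\<^sub>C h)] - c *\<^sub>C ?s [G h] | G c h. G \<in> {Gen, Omega}}"
    then show "p \<in> J"
      by (auto simp: J_def left_diff_distrib right_diff_distrib ss free_lift_diff
          free_lift_scaleC assms)
  qed (rule ideal)
  moreover have "weil_eq (rep_weil (weil_word w)) (?s w)"
    unfolding weil_word.abs_eq using \<open>w \<noteq> []\<close>
    by (simp add: Quotient3_rep_abs[OF Quotient3_weil] weil_eq_refl)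
  ultimately have "rep_weil (weil_word w) - ?s w \<in> J"
    by (auto simp: weil_eq_def)
  then have "free_lift \<phi> (?s [] * (rep_weil (weil_word w) - ?s w) * ?s []) = 0"
    unfolding J_def by blast
  moreover have "?s [] = 1"
    by (metis single_one zero_list_def)
  ultimately show ?thesis
    by (simp add: weil_lift_def free_lift_diff)
qed

definition weil_comp :: "int \<Rightarrow> 'h::complex_vector weil \<Rightarrow> 'h weil" where
  "weil_comp k = weil_lift (\<lambda>w. if word_degree w = k then weil_word w else 0)"

text \<open>Since \<open>weil_word []\<close> is zero and not a unit, the empty word needs separate treatment.\<close>

definition mult_word :: "'h::complex_vector weil \<Rightarrow> 'h weil_gen list \<Rightarrow> 'h weil" where
  "mult_word x w = (if w = [] then x else x * weil_word w)"

text \<open>The derivation (of odd degree) with prescribed values on the generators.\<close>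

primrec weil_derivation_word ::
    "('h::complex_vector weil_gen \<Rightarrow> 'h weil) \<Rightarrow> 'h weil_gen list \<Rightarrow> 'h weil" where
  "weil_derivation_word D [] = 0"
| "weil_derivation_word D (a # w) =
    mult_word (D a) w + koszul (gen_degree a) *\<^sub>C (weil_word [a] * weil_derivation_word D w)"

definition weil_derivation ::
    "('h::complex_vector weil_gen \<Rightarrow> 'h weil) \<Rightarrow> 'h weil \<Rightarrow> 'h weil" where
  "weil_derivation D = weil_lift (weil_derivation_word D)"

primrec weil_diff_gen :: "'h::complex_vector hopf_data \<Rightarrow> 'h weil_gen \<Rightarrow> 'h weil" where
  "weil_diff_gen H (Gen h) =
    weil_word [Omega h] - sweedler H h (\<lambda>h0 h1. weil_word [Gen h0, Gen h1])"
| "weil_diff_gen H (Omega h) =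
    sweedler H h (\<lambda>h0 h1. weil_word [Omega h0, Gen h1])
    - sweedler H h (\<lambda>h0 h1. weil_word [Gen h0, Omega h1])"

primrec weil_diff0_gen :: "'h::complex_vector hopf_data \<Rightarrow> 'h weil_gen \<Rightarrow> 'h weil" where
  "weil_diff0_gen H (Gen h) = - sweedler H h (\<lambda>h0 h1. weil_word [Gen h0, Gen h1])"
| "weil_diff0_gen H (Omega h) = weil_diff_gen H (Omega h)"

definition weil_diff :: "'h::complex_vector hopf_data \<Rightarrow> 'h weil \<Rightarrow> 'h weil" where
  "weil_diff H = weil_derivation (weil_diff_gen H)"

definition weil_diff0 :: "'h::complex_vector hopf_data \<Rightarrow> 'h weil \<Rightarrow> 'h weil" where
  "weil_diff0 H = weil_derivation (weil_diff0_gen H)"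

primrec gen_act :: "'h::times \<Rightarrow> 'h weil_gen \<Rightarrow> 'h weil_gen" where
  "gen_act g (Gen h) = Gen (g * h)"
| "gen_act g (Omega h) = Omega (g * h)"

fun weil_act_word ::
    "'h::complex_algebra_1 hopf_data \<Rightarrow> 'h weil_gen list \<Rightarrow> 'h \<Rightarrow> 'h weil" where
  "weil_act_word H [] g = 0"
| "weil_act_word H [a] g = weil_word [gen_act g a]"
| "weil_act_word H (a # b # w) g =
    sweedler H g (\<lambda>g0 g1. weil_word [gen_act g0 a] * weil_act_word H (b # w) g1)"

definition weil_act :: "'h::complex_algebra_1 hopf_data \<Rightarrow> 'h \<Rightarrow> 'h weil \<Rightarrow> 'h weil" where
  "weil_act H g = weil_lift (\<lambda>w. weil_act_word H w g)"

definition weil_algebra ::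
    "'h::complex_algebra_1 hopf_data \<Rightarrow> ('h, 'h weil) hdg_data" where
  "weil_algebra H = \<lparr>hcomp = weil_comp, diff = weil_diff H, act = weil_act H\<rparr>"

definition weil_ideal :: "'h::complex_vector weil set" where
  "weil_ideal = two_sided_ideal hull {weil_word [Omega h] | h. True}"

definition weil_t :: "'h::complex_vector weil \<Rightarrow> 'h weil" where
  "weil_t = weil_lift (\<lambda>w. case w of [] \<Rightarrow> 0
    | a # x \<Rightarrow> koszul (gen_degree a * word_degree x) *\<^sub>C weil_word (x @ [a]))"

definition weil_b_t :: "'h::complex_vector hopf_data \<Rightarrow> 'h weil \<Rightarrow> 'h weil" where
  "weil_b_t H = weil_lift (\<lambda>w. case w of [] \<Rightarrow> 0
    | a # x \<Rightarrow> weil_t (mult_word (weil_diff0 H (weil_word [a])) x))"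

definition weil_b :: "'h::complex_vector hopf_data \<Rightarrow> 'h weil \<Rightarrow> 'h weil" where
  "weil_b H x = weil_diff H x + weil_b_t H x"

definition weil_N :: "'h::complex_vector weil \<Rightarrow> 'h weil" where
  "weil_N = weil_lift (\<lambda>w. \<Sum>i<length w. (weil_t ^^ i) (weil_word w))"

text \<open>\<open>weil_CC H \<delta> n\<close> is the bicomplex on the coinvariants of \<open>W(H) / I(H)\<^sup>n\<^sup>+\<^sup>1\<close>, with the
  columns of even index carrying \<open>\<partial>\<close> and those of odd index carrying \<open>b\<close>;
  \<open>hopf_CC H \<delta> n\<close> is its shift, whose degree \<open>m\<close> is the degree \<open>m + 1\<close> of the former.\<close>

definition weil_CC ::
    "'h::complex_algebra_1 hopf_data \<Rightarrow> ('h \<Rightarrow> complex) \<Rightarrow> nat \<Rightarrow> 'h weil set bicomplex" where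
  "weil_CC H \<delta> n =
    (let U = ideal_power_coinv \<delta> (weil_algebra H) weil_ideal (n + 1) in
      \<lparr>obj = (\<lambda>p q. quot (range (weil_comp q)) U),
       hor = (\<lambda>p q. descend U (if even p then weil_N else (\<lambda>x. weil_t x - x))),
       vert = (\<lambda>p q. descend U (if even p then weil_diff H else weil_b H))\<rparr>)"

definition hopf_CC ::
    "'h::complex_algebra_1 hopf_data \<Rightarrow> ('h \<Rightarrow> complex) \<Rightarrow> nat \<Rightarrow> 'h weil set bicomplex" where
  "hopf_CC H \<delta> n = vshift 1 (weil_CC H \<delta> n)"

end

theory Submission
  imports Defs
begin

text \<open>Modulo commutators every one-form on \<open>W(H)\<close> is a combination of forms \<open>x da\<close> with \<open>a\<close> a single
  generator, so the one-forms modulo commutators are a copy of \<open>W(H)\<close>: up to the Koszul sign the word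
  \<open>a x\<close> corresponds to \<open>x da\<close>, and conversely \<open>x dw\<close> corresponds to the sum of those cyclic rotations
  of \<open>x w\<close> that start at a letter of \<open>w\<close>.  Under this correspondence \<open>d\<close> becomes \<open>N\<close>, the commutator map becomes
  \<open>t - 1\<close>, and the differential of one-forms becomes \<open>b\<close>; in particular \<open>b\<^sup>2 = 0\<close> and the compatibility
  of \<open>b\<close> with \<open>N\<close> and \<open>t - 1\<close> come for free.

  The correspondence moves a letter from the front of a word to its end, whereas \<open>H\<close> acts through an
  in general not cocommutative coproduct.  It respects coinvariants because modulo coinvariants
  \<open>g x \<otimes> y\<close> equals \<open>x \<otimes> S\<^sub>\<delta>(g) y\<close>, so that exchanging the two factors preserves the coinvariants as soon
  as \<open>S\<^sub>\<delta>\<close> is an involution.\<close>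

section \<open>Linear and bilinear maps\<close>

text \<open>The comparison maps live on W(H) and its one-forms before any quotient is taken. There
  \<open>form_to_weil\<close> kills commutators and is an exact left inverse of
  \<open>weil_to_form\<close>; only the other composite is the identity merely modulo commutators.
  Congruences between forms thus become equations in W(H), which is what makes the identities for
  \<open>b\<close> exact. The relations do not all travel in the same direction. For
  \<open>t\<close> the coinvariants need the detour through forms, since rotation is not visibly
  equivariant; \<open>b\<close> inherits the property from \<open>t\<close>, \<open>N\<close>
  inherits it from \<open>d\<close>, and the differential of forms inherits it from
  \<open>b\<close>. Rotation keeps the number of letters \<open>Omega\<close>. If a word
  \<open>a x\<close> has n + 1 of them, then \<open>x da\<close> lies in I^n dI or in I^(n+1) dR
  according to whether \<open>a\<close> is one of them, so the two families of relations on forms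
  are exactly what the filtration of W(H) requires. The term b_t involves \<partial>_0 rather than
  \<partial> because only the quadratic part of \<partial> a gives two one-letter forms; the linear
  part \<omega>_h gives a single one, already accounted for by \<partial>.\<close>

lemma clinear_0: "clinear f \<Longrightarrow> f 0 = 0"
  using clinear_add[of f 0 0] by simp

lemma clinear_minus: "clinear f \<Longrightarrow> f (- x) = - f x"
  using clinear_add[of f x "- x"] clinear_0[of f] by (simp add: eq_neg_iff_add_eq_0 add.commute)

lemma clinear_diff: "clinear f \<Longrightarrow> f (x - y) = f x - f y"
  using clinear_add[of f x "- y"] clinear_minus[of f y] by simp

lemma clinear_setsum: "clinear f \<Longrightarrow> f (sum g A) = (\<Sum>i\<in>A. f (g i))"
  by (induction A rule: infinite_finite_induct) (simp_all add: clinear_0 clinear_add)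

lemma clinear_comp: "clinear f \<Longrightarrow> clinear g \<Longrightarrow> clinear (\<lambda>x. f (g x))"
  by (rule clinearI) (simp_all add: clinear_add clinear_scaleC)

lemma clinear_ident: "clinear (\<lambda>x. x)"
  and clinear_const0: "clinear (\<lambda>x. 0)"
  by (rule clinearI; simp)+

lemma clinear_plus: "clinear f \<Longrightarrow> clinear g \<Longrightarrow> clinear (\<lambda>x. f x + g x)"
  and clinear_sub: "clinear f \<Longrightarrow> clinear g \<Longrightarrow> clinear (\<lambda>x. f x - g x)"
  and clinear_uminus: "clinear f \<Longrightarrow> clinear (\<lambda>x. - f x)"
  by (rule clinearI; simp add: clinear_add clinear_scaleC scaleC_add_right
      complex_vector.scale_right_diff_distrib)+

lemma clinear_scale: "clinear f \<Longrightarrow> clinear (\<lambda>x. c *\<^sub>C f x)"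
  by (rule clinearI) (simp_all add: clinear_add clinear_scaleC scaleC_add_right mult.commute)

lemma clinear_scale_left: "clinear f \<Longrightarrow> clinear (\<lambda>x. f x *\<^sub>C v)"
  by (rule clinearI) (simp_all add: clinear_add clinear_scaleC scaleC_add_left)

lemma clinear_sum: "(\<And>i. i \<in> A \<Longrightarrow> clinear (f i)) \<Longrightarrow> clinear (\<lambda>x. \<Sum>i\<in>A. f i x)"
  by (rule clinearI)
    (simp_all add: clinear_add clinear_scaleC sum.distrib complex_vector.scale_sum_right)

lemma clinear_If: "clinear f \<Longrightarrow> clinear g \<Longrightarrow> clinear (\<lambda>x. if P then f x else g x)"
  by (cases P) simp_all

lemma clinear_fst: "clinear f \<Longrightarrow> clinear (\<lambda>x. fst (f x))"
  and clinear_snd: "clinear f \<Longrightarrow> clinear (\<lambda>x. snd (f x))"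
  by (rule clinearI; simp add: clinear_add clinear_scaleC scaleC_prod_def)+

lemma clinear_Pair: "clinear f \<Longrightarrow> clinear g \<Longrightarrow> clinear (\<lambda>x. (f x, g x))"
  by (rule clinearI) (simp_all add: clinear_add clinear_scaleC scaleC_prod_def)

lemma clinear_mult_left: "clinear f \<Longrightarrow> clinear (\<lambda>x. f x * (y::'a::complex_algebra))"
  and clinear_mult_right: "clinear f \<Longrightarrow> clinear (\<lambda>x. (y::'a::complex_algebra) * f x)"
  by (rule clinearI; simp add: clinear_add clinear_scaleC distrib_left distrib_right)+

lemmas clinear_intros = clinear_ident clinear_const0 clinear_plus clinear_sub clinear_uminus
  clinear_scale clinear_scale_left clinear_sum clinear_If clinear_fst clinear_snd clinear_Pair
  clinear_mult_left clinear_mult_right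

lemma clinear_funpow: "clinear f \<Longrightarrow> clinear (f ^^ n)" for f :: "'a::complex_vector \<Rightarrow> 'a"
proof (induction n)
  case 0 show ?case unfolding funpow.simps id_def by (rule clinear_ident)
next
  case (Suc n) from clinear_comp[OF Suc.prems Suc.IH[OF Suc.prems]] show ?case by (simp add: comp_def)
qed

lemma cbilinearI: "(\<And>y. clinear (\<lambda>x. f x y)) \<Longrightarrow> (\<And>x. clinear (f x)) \<Longrightarrow> cbilinear f"
  by (simp add: cbilinear_def)

lemma cbilinear_left: "cbilinear B \<Longrightarrow> clinear f \<Longrightarrow> clinear (\<lambda>x. B (f x) y)"
  using clinear_comp[of "\<lambda>x. B x y" f] by (simp only: cbilinear_def)

lemma cbilinear_right: "cbilinear B \<Longrightarrow> clinear f \<Longrightarrow> clinear (\<lambda>x. B y (f x))"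
  using clinear_comp[of "B y" f] by (simp only: cbilinear_def)

lemma clinear_vimage: "clinear f \<Longrightarrow> csubspace S \<Longrightarrow> csubspace {x. f x \<in> S}"
  by (rule complex_vector.subspaceI)
    (simp_all add: clinear_0 clinear_add clinear_scaleC complex_vector.subspace_0
      complex_vector.subspace_add complex_vector.subspace_scale)

lemma csubspace_cspan: "csubspace (cspan S)"
  by (rule complex_vector.subspace_span)

lemma clinear_cspan:
  assumes "clinear f" "csubspace T" "\<And>s. s \<in> S \<Longrightarrow> f s \<in> T" "x \<in> cspan S"
  shows "f x \<in> T"
proof -
  have "cspan S \<subseteq> {x. f x \<in> T}"
    using assms(1-3) by (intro complex_vector.span_minimal clinear_vimage) auto
  then show ?thesis using assms(4) by blast
qed

lemma cspan_subset: "csubspace T \<Longrightarrow> S \<subseteq> T \<Longrightarrow> cspan S \<subseteq> T"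
  by (rule complex_vector.span_minimal)

lemma cbilinear_cspan:
  assumes "cbilinear f" "csubspace U" "\<And>s t. s \<in> S \<Longrightarrow> t \<in> T \<Longrightarrow> f s t \<in> U"
    and "x \<in> cspan S" "y \<in> cspan T"
  shows "f x y \<in> U"
proof -
  have 1: "clinear (\<lambda>x. f x y)" and 2: "clinear (f x)" for x y
    using assms(1) by (auto simp: cbilinear_def)
  show ?thesis
    by (rule clinear_cspan[OF 1 assms(2) _ assms(4)], rule clinear_cspan[OF 2 assms(2) _ assms(5)])
      (rule assms(3))
qed

lemma clinear_eq_cspan:
  assumes "clinear f" "clinear g" "\<And>s. s \<in> S \<Longrightarrow> f s = g s" "x \<in> cspan S"
  shows "f x = g x"
proof -
  have "f x - g x \<in> {0}"
    by (rule clinear_cspan[OF _ _ _ assms(4), of "\<lambda>x. f x - g x"])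
      (use assms in \<open>auto intro: clinear_intros simp: complex_vector.subspace_single_0\<close>)
  then show ?thesis by simp
qed

lemma free_lift_commute: "clinear L \<Longrightarrow> L (free_lift \<phi> p) = free_lift (\<lambda>k. L (\<phi> k)) p"
  by (simp add: free_lift_def clinear_setsum clinear_scaleC)

lemma free_lift_id: "free_lift (\<lambda>k. Poly_Mapping.single k 1) p = p"
  by (induction p rule: poly_mapping_single_induct)
    (simp_all add: free_lift_add scaleC_single)

lemma free_lift_in: "csubspace S \<Longrightarrow> (\<And>k. k \<in> Poly_Mapping.keys p \<Longrightarrow> \<phi> k \<in> S) \<Longrightarrow> free_lift \<phi> p \<in> S"
  unfolding free_lift_def
  by (intro complex_vector.subspace_sum complex_vector.subspace_scale)

section \<open>Tensors\<close>

text \<open>\<open>tensor_lift\<close> is a finite sum over a chosen representative, so linear maps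
  pass through it for any \<open>f\<close>; bilinearity enters when it is evaluated on a pure tensor
  or varied in the tensor.\<close>

lemma tensor_lift_commute:
  "clinear L \<Longrightarrow> L (tensor_lift f t) = tensor_lift (\<lambda>x y. L (f x y)) t"
  by (simp add: tensor_lift_def free_lift_commute case_prod_unfold)

lemma tensor_lift_in: "csubspace S \<Longrightarrow> (\<And>x y. f x y \<in> S) \<Longrightarrow> tensor_lift f t \<in> S"
  unfolding tensor_lift_def by (rule free_lift_in) auto

lemma tensor_lift_plus: "tensor_lift (\<lambda>x y. f x y + g x y) t = tensor_lift f t + tensor_lift g t"
  and tensor_lift_sub: "tensor_lift (\<lambda>x y. f x y - g x y) t = tensor_lift f t - tensor_lift g t"
  by (simp_all add: tensor_lift_def free_lift_def case_prod_unfold scaleC_add_right sum.distrib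
      complex_vector.scale_right_diff_distrib sum_subtractf)

lemma tensor_lift_scale: "tensor_lift (\<lambda>x y. c *\<^sub>C f x y) t = c *\<^sub>C tensor_lift f t"
  by (rule tensor_lift_commute[of "\<lambda>x. c *\<^sub>C x", symmetric]) (intro clinear_intros)

lemma tensor_lift_uminus: "tensor_lift (\<lambda>x y. - f x y) t = - tensor_lift f t"
  by (rule tensor_lift_commute[of "\<lambda>x. - x", symmetric]) (intro clinear_intros)

text \<open>Interchange of two finite sums. In Sweedler notation: the coproducts of two elements may
  be expanded in either order.\<close>

lemma tensor_lift_swap:
  "tensor_lift (\<lambda>a b. tensor_lift (\<lambda>c d. f a b c d) t) s =
   tensor_lift (\<lambda>c d. tensor_lift (\<lambda>a b. f a b c d) s) t"
  unfolding tensor_lift_def free_lift_def case_prod_unfold complex_vector.scale_sum_right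
  by (subst sum.swap) (simp add: mult.commute)

lemma clinear_tensor_lift_param:
  "(\<And>a b. clinear (\<lambda>x. f x a b)) \<Longrightarrow> clinear (\<lambda>x. tensor_lift (f x) t)"
  unfolding tensor_lift_def free_lift_def case_prod_unfold
  by (intro clinear_intros)

lemma cbilinear_pure: "cbilinear (\<otimes>\<^sub>C)"
proof (rule cbilinearI; rule clinearI)
  fix x x' :: 'a and y y' :: 'b and c
  note d = bilinear_rel_def Let_def pure_tensor.abs_eq plus_tensor.abs_eq scaleC_tensor.abs_eq
    tensor.abs_eq_iff tensor_eq_def diff_diff_eq[symmetric]
  show "(x + x') \<otimes>\<^sub>C y = x \<otimes>\<^sub>C y + x' \<otimes>\<^sub>C y" "x \<otimes>\<^sub>C (y + y') = x \<otimes>\<^sub>C y + x \<otimes>\<^sub>C y'"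
    "(c *\<^sub>C x) \<otimes>\<^sub>C y = c *\<^sub>C (x \<otimes>\<^sub>C y)" "x \<otimes>\<^sub>C (c *\<^sub>C y) = c *\<^sub>C (x \<otimes>\<^sub>C y)"
    unfolding d by (rule complex_vector.span_base; blast)+
qed

lemma clinear_pure_left: "clinear f \<Longrightarrow> clinear (\<lambda>x. f x \<otimes>\<^sub>C y)"
  and clinear_pure_right: "clinear f \<Longrightarrow> clinear (\<lambda>x. y \<otimes>\<^sub>C f x)"
  using cbilinear_pure[unfolded cbilinear_def]
  by (auto intro: clinear_comp[of "\<lambda>x. x \<otimes>\<^sub>C y"] clinear_comp[of "\<lambda>x. y \<otimes>\<^sub>C x"])

lemmas pure_add_left = clinear_add[OF clinear_pure_left[OF clinear_ident]]
  and pure_diff_left = clinear_diff[OF clinear_pure_left[OF clinear_ident]]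
  and pure_scale_left = clinear_scaleC[OF clinear_pure_left[OF clinear_ident]]
  and pure_zero_left = clinear_0[OF clinear_pure_left[OF clinear_ident]]
  and pure_add_right = clinear_add[OF clinear_pure_right[OF clinear_ident]]
  and pure_diff_right = clinear_diff[OF clinear_pure_right[OF clinear_ident]]
  and pure_scale_right = clinear_scaleC[OF clinear_pure_right[OF clinear_ident]]
  and pure_zero_right = clinear_0[OF clinear_pure_right[OF clinear_ident]]

lemmas pure_simps = pure_add_left pure_diff_left pure_scale_left pure_zero_left
  pure_add_right pure_diff_right pure_scale_right pure_zero_right

lemma clinear_abs_tensor: "clinear abs_tensor"
  by (rule clinearI) (simp_all add: plus_tensor.abs_eq scaleC_tensor.abs_eq)

text \<open>Every tensor is a combination of pure ones, in a form usable by rewriting: linear maps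
  on tensors are compared by pulling them through this expansion.\<close>

lemma tensor_lift_pure_id: "tensor_lift (\<otimes>\<^sub>C) t = t"
proof (induction t)
  case (1 p)
  have "abs_tensor p = abs_tensor (free_lift (\<lambda>k. Poly_Mapping.single k 1) p)"
    by (simp add: free_lift_id)
  also have "\<dots> = free_lift (\<lambda>k. abs_tensor (Poly_Mapping.single k 1)) p"
    by (rule free_lift_commute[OF clinear_abs_tensor])
  also have "\<dots> = tensor_lift (\<otimes>\<^sub>C) (abs_tensor p)"
    by (simp add: tensor_lift_abs[OF cbilinear_pure] pure_tensor.abs_eq case_prod_unfold)
  finally show ?case by simp
qed

lemma tensor_eqI:
  assumes "clinear f" "clinear g" "\<And>x y. f (x \<otimes>\<^sub>C y) = g (x \<otimes>\<^sub>C y)"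
  shows "f t = g t"
  using tensor_lift_commute[OF assms(1), of "(\<otimes>\<^sub>C)" t] tensor_lift_commute[OF assms(2), of "(\<otimes>\<^sub>C)" t]
  by (simp add: tensor_lift_pure_id assms(3))

lemma tensor_in_cspan:
  assumes "x \<in> cspan S" "y \<in> cspan T"
  shows "x \<otimes>\<^sub>C y \<in> cspan {s \<otimes>\<^sub>C t | s t. s \<in> S \<and> t \<in> T}"
  by (rule cbilinear_cspan[OF cbilinear_pure csubspace_cspan _ assms])
    (rule complex_vector.span_base, blast)

lemma tensor_UNIV:
  assumes "cspan S = UNIV" "cspan T = UNIV"
  shows "cspan {s \<otimes>\<^sub>C t | s t. s \<in> S \<and> t \<in> T} = UNIV"
proof -
  have "t \<in> cspan {s \<otimes>\<^sub>C t | s t. s \<in> S \<and> t \<in> T}" for t :: "('a, 'b) tensor"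
    using tensor_lift_in[OF csubspace_cspan, of "(\<otimes>\<^sub>C)" _ t] tensor_in_cspan[of _ S _ T] assms
    by (simp add: tensor_lift_pure_id)
  then show ?thesis by blast
qed

section \<open>Words in the Weil algebra\<close>

text \<open>The constructor \<open>G\<close> is fixed while its argument varies. Degrees, lengths
  and numbers of letters \<open>Omega\<close> are constant along each such linear family, so signs
  and rotation counts depending on them are harmless.\<close>

definition word_linear :: "('h::complex_vector weil_gen list \<Rightarrow> 'c::complex_vector) \<Rightarrow> bool" where
  "word_linear \<phi> \<longleftrightarrow> (\<forall>u v. \<forall>G\<in>{Gen, Omega}. clinear (\<lambda>h. \<phi> (u @ G h # v)))"

lemma word_linearI:
  "(\<And>u v G. G \<in> {Gen, Omega} \<Longrightarrow> clinear (\<lambda>h. \<phi> (u @ G h # v))) \<Longrightarrow> word_linear \<phi>"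
  by (simp add: word_linear_def)

lemma word_linearD: "word_linear \<phi> \<Longrightarrow> G \<in> {Gen, Omega} \<Longrightarrow> clinear (\<lambda>h. \<phi> (u @ G h # v))"
  unfolding word_linear_def by blast

lemma word_linear_eqs:
  assumes "word_linear \<phi>"
  shows "\<phi> (u @ Gen (h + k) # v) = \<phi> (u @ Gen h # v) + \<phi> (u @ Gen k # v)"
    and "\<phi> (u @ Omega (h + k) # v) = \<phi> (u @ Omega h # v) + \<phi> (u @ Omega k # v)"
    and "\<phi> (u @ Gen (c *\<^sub>C h) # v) = c *\<^sub>C \<phi> (u @ Gen h # v)"
    and "\<phi> (u @ Omega (c *\<^sub>C h) # v) = c *\<^sub>C \<phi> (u @ Omega h # v)"
  using clinear_add[OF word_linearD[OF assms, of _ u v]]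
    clinear_scaleC[OF word_linearD[OF assms, of _ u v]] by auto

lemma weil_lift_word': "word_linear \<phi> \<Longrightarrow> w \<noteq> [] \<Longrightarrow> weil_lift \<phi> (weil_word w) = \<phi> w"
  by (rule weil_lift_word) (simp_all add: word_linear_eqs)

lemma single_append: "Poly_Mapping.single u (1::complex) * Poly_Mapping.single v 1 = Poly_Mapping.single (u @ v) 1"
  by (simp add: mult_single plus_list_def)

text \<open>The elements annihilated in every context \<open>u * p * v\<close> form a two-sided
  ideal, although the kernel of \<open>free_lift \<phi>\<close> itself need not be one.
  Multilinearity of \<phi> puts the generators of \<open>weil_rel\<close> into this ideal.\<close>

lemma free_lift_weil_rel:
  fixes \<phi> :: "'h::complex_vector weil_gen list \<Rightarrow> 'c::complex_vector"
  assumes "word_linear \<phi>" "p \<in> weil_rel"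
  shows "free_lift \<phi> p = 0"
proof -
  let ?s = "\<lambda>w :: 'h weil_gen list. Poly_Mapping.single w (1::complex)"
  define J where "J = {p. \<forall>u v. free_lift \<phi> (?s u * p * ?s v) = 0}"
  have sub: "csubspace J"
    unfolding J_def
    by (rule complex_vector.subspaceI)
      (simp_all add: free_lift_add free_lift_scaleC distrib_left distrib_right)
  have s_eq: "Poly_Mapping.single w a = a *\<^sub>C ?s w" for w and a :: complex
    by (simp add: scaleC_single)
  have "r * p \<in> J \<and> p * r \<in> J" if "p \<in> J" for r p
  proof (induction r rule: poly_mapping_single_induct)
    case zero then show ?case by (simp add: complex_vector.subspace_0[OF sub])
  next
    case (add q k a)
    have "free_lift \<phi> (?s u * (?s k * p) * ?s v) = 0" "free_lift \<phi> (?s u * (p * ?s k) * ?s v) = 0"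
      for u v
      using that single_append[of u k] single_append[of k v]
      by (simp_all add: J_def mult.assoc) (simp add: J_def mult.assoc[symmetric])
    then have "?s k * p \<in> J" "p * ?s k \<in> J" by (simp_all add: J_def)
    then show ?case
      using add by (subst (1 2) s_eq) (simp add: distrib_left distrib_right
          complex_vector.subspace_add[OF sub] complex_vector.subspace_scale[OF sub])
  qed
  then have ideal: "two_sided_ideal J"
    using sub by (simp add: two_sided_ideal_def)
  have "weil_rel \<subseteq> J"
    unfolding weil_rel_def
    by (rule hull_minimal[of _ J two_sided_ideal, OF _ ideal], unfold Let_def, intro Un_least subsetI)
      (auto simp: J_def left_diff_distrib right_diff_distrib single_append free_lift_diff
        free_lift_scaleC word_linear_eqs[OF assms(1)])
  then have "free_lift \<phi> (?s [] * p * ?s []) = 0"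
    using assms(2) unfolding J_def by blast
  then show ?thesis by (metis mult_1 mult_1_right single_one zero_list_def)
qed

lemma weil_lift_abs:
  assumes "word_linear \<phi>" "[] \<notin> Poly_Mapping.keys p"
  shows "weil_lift \<phi> (abs_weil p) = free_lift \<phi> p"
proof -
  have "weil_eq (rep_weil (abs_weil p)) p"
    by (rule Quotient3_rep_abs[OF Quotient3_weil]) (simp add: weil_eq_refl assms)
  then have "rep_weil (abs_weil p) - p \<in> weil_rel"
    by (simp add: weil_eq_def)
  from free_lift_weil_rel[OF assms(1) this] show ?thesis
    by (simp add: weil_lift_def free_lift_diff)
qed

lemma weil_cases: obtains p where "[] \<notin> Poly_Mapping.keys p" "x = abs_weil p"
  using Quotient3_abs_rep[OF Quotient3_weil, of x] Quotient3_rep_reflp[OF Quotient3_weil, of x]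
  by (metis weil_eq_refl)

lemma clinear_weil_lift: 
  assumes "word_linear \<phi>"
  shows "clinear (weil_lift \<phi>)"
proof (rule clinearI)
  fix x y :: "'a weil" and c
  obtain p q where p: "[] \<notin> Poly_Mapping.keys p" "x = abs_weil p"
    and q: "[] \<notin> Poly_Mapping.keys q" "y = abs_weil q"
    using weil_cases by metis
  have k: "[] \<notin> Poly_Mapping.keys (p + q)" "[] \<notin> Poly_Mapping.keys (c *\<^sub>C p)"
    using p q keys_add[of p q] by (auto simp: in_keys_iff lookup_scaleC)
  have "x + y = abs_weil (p + q)" "c *\<^sub>C x = abs_weil (c *\<^sub>C p)"
    using p q by (simp_all add: plus_weil.abs_eq scaleC_weil.abs_eq weil_eq_refl)
  then show "weil_lift \<phi> (x + y) = weil_lift \<phi> x + weil_lift \<phi> y"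
    "weil_lift \<phi> (c *\<^sub>C x) = c *\<^sub>C weil_lift \<phi> x"
    using p q k by (simp_all add: weil_lift_abs[OF assms] free_lift_add free_lift_scaleC)
qed

lemma abs_weil_eq:
  assumes "[] \<notin> Poly_Mapping.keys p"
  shows "abs_weil p = free_lift weil_word p"
proof -
  \<comment> \<open>Sending the empty word to 0 keeps every partial sum free of it, hence inside the
    domain of the partial quotient.\<close>
  define f :: "'a weil_gen list \<Rightarrow> ('a weil_gen list \<Rightarrow>\<^sub>0 complex)"
    where "f w = (if w = [] then 0 else Poly_Mapping.single w 1)" for w
  have fk: "[] \<notin> Poly_Mapping.keys (f w)" for w by (simp add: f_def)
  have ck: "[] \<notin> Poly_Mapping.keys (c *\<^sub>C f w)" for c w by (simp add: f_def scaleC_single)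
  have 1: "[] \<notin> Poly_Mapping.keys (\<Sum>w\<in>A. c w *\<^sub>C f w) \<and>
      abs_weil (\<Sum>w\<in>A. c w *\<^sub>C f w) = (\<Sum>w\<in>A. c w *\<^sub>C weil_word w)" if "finite A" for A c
    using that
  proof (induction A rule: finite_induct)
    case empty show ?case by (simp add: zero_weil.abs_eq)
  next
    case (insert w A)
    have "[] \<notin> Poly_Mapping.keys (c w *\<^sub>C f w + (\<Sum>w\<in>A. c w *\<^sub>C f w))"
      using insert ck[of "c w" w] keys_add[of "c w *\<^sub>C f w" "\<Sum>w\<in>A. c w *\<^sub>C f w"] by blast
    moreover have "abs_weil (c w *\<^sub>C f w) = c w *\<^sub>C weil_word w"
      by (simp add: weil_word.abs_eq scaleC_weil.abs_eq weil_eq_refl fk flip: f_def)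
    ultimately show ?case
      using insert by (simp add: plus_weil.abs_eq[symmetric] weil_eq_refl ck)
  qed
  have "p = free_lift (\<lambda>k. Poly_Mapping.single k 1) p" by (simp add: free_lift_id)
  also have "\<dots> = free_lift f p"
    unfolding free_lift_def f_def using assms by (intro sum.cong) auto
  finally show ?thesis
    using 1[of "Poly_Mapping.keys p" "Poly_Mapping.lookup p"] by (simp add: free_lift_def)
qed

lemma weil_words_span: "cspan {weil_word w | w. w \<noteq> []} = UNIV"
proof -
  have "x \<in> cspan {weil_word w | w. w \<noteq> []}" for x :: "'a weil"
  proof -
    obtain p where p: "[] \<notin> Poly_Mapping.keys p" "x = abs_weil p" using weil_cases by metis
    have "free_lift weil_word p \<in> cspan {weil_word w | w. w \<noteq> []}"
      by (rule free_lift_in[OF csubspace_cspan], rule complex_vector.span_base) (use p(1) in blast)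
    then show ?thesis by (simp only: p(2) abs_weil_eq[OF p(1)])
  qed
  then show ?thesis by blast
qed

lemma weil_eqI:
  assumes "clinear f" "clinear g" "\<And>w. w \<noteq> [] \<Longrightarrow> f (weil_word w) = g (weil_word w)"
  shows "f x = g x"
  by (rule clinear_eq_cspan[OF assms(1,2), of "{weil_word w | w. w \<noteq> []}"])
    (auto simp: weil_words_span assms(3))

lemma weil_word_Nil [simp]: "weil_word [] = 0"
  by (simp add: weil_word.abs_eq zero_weil.abs_eq)

lemma weil_word_mult: "u \<noteq> [] \<Longrightarrow> v \<noteq> [] \<Longrightarrow> weil_word u * weil_word v = weil_word (u @ v)"
  by transfer (simp add: single_append weil_eq_refl)

lemma word_linear_weil_word: "word_linear weil_word"
proof (rule word_linearI)
  fix u v :: "'a weil_gen list" and G :: "'a \<Rightarrow> 'a weil_gen" assume G: "G \<in> {Gen, Omega}"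
  let ?s = "\<lambda>a. Poly_Mapping.single [a] (1::complex)"
  have e: "Poly_Mapping.single (u @ a # v) 1 = Poly_Mapping.single u 1 * ?s a * Poly_Mapping.single v (1::complex)"
    for a by (simp add: single_append)
  have ideal: "Poly_Mapping.single u 1 * p * Poly_Mapping.single v (1::complex) \<in> weil_rel" if "p \<in> weil_rel" for p
    using that weil_rel_ideal by (auto simp: two_sided_ideal_def)
  have b: "?s (G (h + k)) - ?s (G h) - ?s (G k) \<in> weil_rel"
    "?s (G (c *\<^sub>C h)) - c *\<^sub>C ?s (G h) \<in> weil_rel" for h k c
    unfolding weil_rel_def Let_def by (rule hull_inc; use G in blast)+
  show "clinear (\<lambda>h. weil_word (u @ G h # v))"
  proof (rule clinearI)
    fix h k c
    let ?S = "\<lambda>a. Poly_Mapping.single (u @ a # v) (1::complex)"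
    have W: "weil_word (u @ a # v) = abs_weil (?S a)" for a by (simp add: weil_word.abs_eq)
    have "?S (G (h + k)) - (?S (G h) + ?S (G k)) \<in> weil_rel"
      using ideal[OF b(1)[of h k]] by (simp only: left_diff_distrib right_diff_distrib distrib_left distrib_right e diff_diff_eq)
    then show "weil_word (u @ G (h + k) # v) = weil_word (u @ G h # v) + weil_word (u @ G k # v)"
      using keys_add[of "?S (G h)" "?S (G k)"]
      by (simp add: W plus_weil.abs_eq weil_eq_refl)
        (rule Quotient3_rel_abs[OF Quotient3_weil], auto simp: weil_eq_def)
    have "?S (G (c *\<^sub>C h)) - c *\<^sub>C ?S (G h) \<in> weil_rel"
      using ideal[OF b(2)[of c h]]
      by (simp only: left_diff_distrib right_diff_distrib e mult_scaleC_left mult_scaleC_right)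
    then show "weil_word (u @ G (c *\<^sub>C h) # v) = c *\<^sub>C weil_word (u @ G h # v)"
      by (simp add: W scaleC_weil.abs_eq weil_eq_refl)
        (rule Quotient3_rel_abs[OF Quotient3_weil],
          auto simp: weil_eq_def in_keys_iff lookup_scaleC lookup_single when_def)
  qed
qed

section \<open>Closure properties of multilinear functions on words\<close>

lemma word_linear_comp: "clinear L \<Longrightarrow> word_linear \<phi> \<Longrightarrow> word_linear (\<lambda>w. L (\<phi> w))"
  unfolding word_linear_def by (auto intro: clinear_comp)

lemma word_linear_append_left: "word_linear \<phi> \<Longrightarrow> word_linear (\<lambda>w. \<phi> (p @ w))"
  by (rule word_linearI, subst append_assoc[symmetric], rule word_linearD)

lemma word_linear_append_right: "word_linear \<phi> \<Longrightarrow> word_linear (\<lambda>w. \<phi> (w @ q))"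
  by (rule word_linearI, subst append_assoc, subst append_Cons, rule word_linearD)

lemma word_linear_shape_scale:
  assumes "word_linear \<phi>" "\<And>u v G h k. G \<in> {Gen, Omega} \<Longrightarrow> c (u @ G h # v) = c (u @ G k # v)"
  shows "word_linear (\<lambda>w. c w *\<^sub>C \<phi> w)"
proof (rule word_linearI)
  fix u v and G :: "'a \<Rightarrow> 'a weil_gen" assume G: "G \<in> {Gen, Omega}"
  have "clinear (\<lambda>h. c (u @ G 0 # v) *\<^sub>C \<phi> (u @ G h # v))"
    by (intro clinear_intros word_linearD[OF assms(1) G])
  moreover have "(\<lambda>h. c (u @ G 0 # v) *\<^sub>C \<phi> (u @ G h # v)) = (\<lambda>h. c (u @ G h # v) *\<^sub>C \<phi> (u @ G h # v))"
    by (rule ext, rule arg_cong[of _ _ "\<lambda>c. c *\<^sub>C _"], rule assms(2)[OF G])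
  ultimately show "clinear (\<lambda>h. c (u @ G h # v) *\<^sub>C \<phi> (u @ G h # v))" by simp
qed

lemma word_linear_Cons:
  assumes "\<And>G x. G \<in> {Gen, Omega} \<Longrightarrow> clinear (\<lambda>h. f (G h) x)" "\<And>a. word_linear (f a)"
  shows "word_linear (\<lambda>w. case w of [] \<Rightarrow> 0 | a # x \<Rightarrow> f a x)"
proof (rule word_linearI)
  fix u v and G :: "'a \<Rightarrow> 'a weil_gen" assume G: "G \<in> {Gen, Omega}"
  show "clinear (\<lambda>h. case u @ G h # v of [] \<Rightarrow> 0 | a # x \<Rightarrow> f a x)"
    using assms(1)[OF G] word_linearD[OF assms(2) G] by (cases u) simp_all
qed

section \<open>The unitization of the Weil algebra\<close>

lemma umult_assoc: "umult (umult u v) w = umult u (umult v w)"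
  by (simp add: umult_def algebra_simps scaleC_add_right)

lemma umult_one [simp]: "umult (1, 0) u = u" "umult u (1, 0) = u"
  by (simp_all add: umult_def)

lemma clinear_umult_left: "clinear f \<Longrightarrow> clinear (\<lambda>x. umult (f x) v)"
  and clinear_umult_right: "clinear f \<Longrightarrow> clinear (\<lambda>x. umult v (f x))"
  unfolding umult_def
  by (auto intro!: clinearI simp: clinear_add clinear_scaleC scaleC_prod_def scaleC_add_right
      scaleC_add_left algebra_simps)

lemmas umult_add_left = clinear_add[OF clinear_umult_left[OF clinear_ident]]
  and umult_diff_left = clinear_diff[OF clinear_umult_left[OF clinear_ident]]
  and umult_scale_left = clinear_scaleC[OF clinear_umult_left[OF clinear_ident]]
  and umult_zero_left = clinear_0[OF clinear_umult_left[OF clinear_ident]]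
  and umult_add_right = clinear_add[OF clinear_umult_right[OF clinear_ident]]
  and umult_diff_right = clinear_diff[OF clinear_umult_right[OF clinear_ident]]
  and umult_scale_right = clinear_scaleC[OF clinear_umult_right[OF clinear_ident]]
  and umult_zero_right = clinear_0[OF clinear_umult_right[OF clinear_ident]]

lemmas umult_simps = umult_add_left umult_diff_left umult_scale_left umult_zero_left
  umult_add_right umult_diff_right umult_scale_right umult_zero_right

lemma umult_Pair0: "umult (0, x) (0, y) = (0, x * y)"
  by (simp add: umult_def)

text \<open>The empty word becomes the adjoined unit, whereas \<open>weil_word []\<close> is 0.
  Concatenation is then multiplication without exception (\<open>umult_uword\<close>), and forms
  \<open>x da\<close> with empty \<open>x\<close> need no separate treatment.\<close>

definition uword :: "'h::complex_vector weil_gen list \<Rightarrow> complex \<times> 'h weil" where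
  "uword w = (if w = [] then (1, 0) else (0, weil_word w))"

lemma uword_Nil [simp]: "uword [] = (1, 0)"
  by (simp add: uword_def)

lemma snd_uword [simp]: "snd (uword w) = weil_word w"
  by (simp add: uword_def)

lemma Pair_weil_word: "w \<noteq> [] \<Longrightarrow> (0, weil_word w) = uword w"
  by (simp add: uword_def)

lemma umult_uword: "umult (uword u) (uword v) = uword (u @ v)"
  by (simp add: uword_def umult_Pair0 weil_word_mult)

lemma clinear_word_Gen: "clinear (\<lambda>h. weil_word (u @ Gen h # v))"
  and clinear_word_Omega: "clinear (\<lambda>h. weil_word (u @ Omega h # v))"
  by (rule word_linearD[OF word_linear_weil_word]; simp)+

lemma word_linear_uword: "word_linear uword"
  by (rule word_linearI)
    (auto intro!: clinear_intros clinear_word_Gen clinear_word_Omega simp: uword_def)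

lemma uwords_span: "cspan (range uword) = UNIV"
proof -
  have "(c, x) \<in> cspan (range uword)" for c and x :: "'a weil"
  proof -
    have "(0, x) \<in> cspan (range uword)"
      by (rule clinear_cspan[of "\<lambda>x. (0, x)" _ "{weil_word w | w. w \<noteq> []}"])
        (auto intro!: clinear_intros csubspace_cspan complex_vector.span_base
          simp: weil_words_span Pair_weil_word)
    moreover have "c *\<^sub>C (1, 0 :: 'a weil) \<in> cspan (range uword)"
      by (intro complex_vector.span_scale complex_vector.span_base)
        (metis uword_Nil rangeI)
    ultimately have "c *\<^sub>C (1, 0) + (0, x) \<in> cspan (range uword)"
      by (intro complex_vector.span_add)
    then show ?thesis by (simp add: scaleC_prod_def)
  qed
  then show ?thesis by auto
qed

lemma uword_eqI:
  assumes "clinear f" "clinear g" "\<And>w. f (uword w) = g (uword w)"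
  shows "f x = g x"
  by (rule clinear_eq_cspan[OF assms(1,2), of "range uword"]) (auto simp: uwords_span assms(3))

definition ulift ::
    "('h weil_gen list \<Rightarrow> 'c::complex_vector) \<Rightarrow> complex \<times> 'h::complex_vector weil \<Rightarrow> 'c" where
  "ulift \<phi> u = fst u *\<^sub>C \<phi> [] + weil_lift \<phi> (snd u)"

lemma clinear_ulift: "word_linear \<phi> \<Longrightarrow> clinear (ulift \<phi>)"
  unfolding ulift_def[abs_def]
  by (intro clinear_intros clinear_comp[OF clinear_weil_lift])

lemma ulift_uword: "word_linear \<phi> \<Longrightarrow> ulift \<phi> (uword w) = \<phi> w"
  using clinear_0[OF clinear_weil_lift, of \<phi>]
  by (cases "w = []") (simp_all add: ulift_def uword_def weil_lift_word')

lemma clinear_weil_lift_param: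
  "(\<And>w. clinear (\<lambda>x. \<phi> x w)) \<Longrightarrow> clinear (\<lambda>x. weil_lift (\<phi> x) y)"
  unfolding weil_lift_def free_lift_def by (intro clinear_intros)

lemma clinear_ulift_param: "(\<And>w. clinear (\<lambda>x. \<phi> x w)) \<Longrightarrow> clinear (\<lambda>x. ulift (\<phi> x) u)"
  unfolding ulift_def by (intro clinear_intros clinear_weil_lift_param)

lemma mult_word_eq: "mult_word x w = snd (umult (0, x) (uword w))"
  by (simp add: mult_word_def uword_def umult_def)

lemma forms_span: "cspan {uword u \<otimes>\<^sub>C weil_word v | u v. v \<noteq> []} = UNIV"
  using tensor_UNIV[OF uwords_span weil_words_span]
  by (rule back_subst[of "\<lambda>S. cspan S = UNIV"]) blast

lemma forms_eqI:
  assumes "clinear f" "clinear g" "\<And>u v. v \<noteq> [] \<Longrightarrow> f (uword u \<otimes>\<^sub>C weil_word v) = g (uword u \<otimes>\<^sub>C weil_word v)"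
  shows "f x = g x"
  by (rule clinear_eq_cspan[OF assms(1,2), of "{uword u \<otimes>\<^sub>C weil_word v | u v. v \<noteq> []}"])
    (auto simp: forms_span assms(3))

section \<open>Degrees and signs\<close>

lemma koszul_mult: "koszul a * koszul b = koszul (a + b)"
  by (simp add: koszul_def)

lemma koszul_cong: "even a = even b \<Longrightarrow> koszul a = koszul b"
  by (simp add: koszul_def)

lemma koszul_square [simp]: "koszul a * koszul a = 1" "koszul a * (koszul a * z) = z"
  by (simp_all add: koszul_def)

lemma word_degree_simps [simp]:
  "word_degree [] = 0" "word_degree (a # w) = gen_degree a + word_degree w"
  "word_degree (u @ v) = word_degree u + word_degree v"
  by (simp_all add: word_degree_def)

lemma
  fixes w :: "'a::complex_vector weil_gen list"
  shows weil_comp_word: "weil_comp k (weil_word w) = (if word_degree w = k then weil_word w else 0)"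
    and clinear_weil_comp: "clinear (weil_comp k :: 'a weil \<Rightarrow> 'a weil)"
proof -
  have "word_linear (\<lambda>w. if word_degree w = k then weil_word w else 0 :: 'a weil)"
    by (rule word_linearI)
      (auto intro!: clinear_intros clinear_word_Gen clinear_word_Omega)
  note * = this weil_lift_word'[OF this] clinear_weil_lift[OF this] clinear_0[OF clinear_weil_lift[OF this]]
  show "weil_comp k (weil_word w) = (if word_degree w = k then weil_word w else 0)"
    using * by (cases "w = []") (simp_all add: weil_comp_def)
  show "clinear (weil_comp k :: 'a weil \<Rightarrow> 'a weil)" unfolding weil_comp_def by (rule *(3))
qed

lemma weil_algebra_simps [simp]:
  "hcomp (weil_algebra H) = weil_comp" "diff (weil_algebra H) = weil_diff H"
  "act (weil_algebra H) = weil_act H"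
  by (simp_all add: weil_algebra_def)

lemma clinear_uhcomp: "clinear (uhcomp (weil_algebra H) k)"
  unfolding uhcomp_def[abs_def] weil_algebra_simps
  by (intro clinear_intros clinear_comp[OF clinear_weil_comp])

lemma uhcomp_uword: "uhcomp (weil_algebra H) k (uword w) = (if word_degree w = k then uword w else 0)"
  by (auto simp: uhcomp_def uword_def weil_comp_word clinear_0[OF clinear_weil_comp] zero_prod_def)

text \<open>Applied to the degree projections, which fix the words of one degree and kill all
  others; their ranges thereby get spanning sets of words.\<close>

lemma range_projection:
  assumes P: "clinear P" and S: "cspan S = UNIV"
    and 1: "\<And>s. s \<in> S \<Longrightarrow> P s = s \<and> s \<in> T \<or> P s = 0" and 2: "\<And>t. t \<in> T \<Longrightarrow> P t = t"
  shows "range P = cspan T"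
proof
  have "P x \<in> cspan T" for x
    by (rule clinear_cspan[OF P csubspace_cspan, of S])
      (use 1 S in \<open>auto simp: complex_vector.span_base complex_vector.span_zero dest!: 1\<close>)
  then show "range P \<subseteq> cspan T" by blast
  have "P x = x" if "x \<in> cspan T" for x
    by (rule clinear_eq_cspan[OF P clinear_ident 2 that])
  then show "cspan T \<subseteq> range P" by (metis rangeI subsetI)
qed

lemma range_weil_comp: "range (weil_comp k) = cspan {weil_word w | w. w \<noteq> [] \<and> word_degree w = k}"
proof (rule range_projection[OF clinear_weil_comp weil_words_span])
  fix s :: "'a weil" assume "s \<in> {weil_word w | w. w \<noteq> []}"
  then obtain w where "s = weil_word w" "w \<noteq> []" by blast
  then show "weil_comp k s = s \<and> s \<in> {weil_word w | w. w \<noteq> [] \<and> word_degree w = k} \<or> weil_comp k s = 0"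
    using weil_comp_word[of k w] by (cases "word_degree w = k") auto
qed (auto simp: weil_comp_word)

lemma range_uhcomp: "range (uhcomp (weil_algebra H) k) = cspan {uword w | w. word_degree w = k}"
proof (rule range_projection[OF clinear_uhcomp uwords_span])
  fix s :: "complex \<times> 'a weil" assume "s \<in> range uword"
  then obtain w where "s = uword w" by blast
  then show "uhcomp (weil_algebra H) k s = s \<and> s \<in> {uword w | w. word_degree w = k} \<or> uhcomp (weil_algebra H) k s = 0"
    using uhcomp_uword[of H k w] by (cases "word_degree w = k") auto
qed (auto simp: uhcomp_uword)

lemma form_homog_weil:
  "form_homog (weil_algebra H) k =
    cspan {uword u \<otimes>\<^sub>C weil_word v | u v. v \<noteq> [] \<and> word_degree u + word_degree v = k}"
  (is "_ = cspan ?S")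
proof
  have "uhcomp (weil_algebra H) i x \<otimes>\<^sub>C weil_comp j y \<in> cspan ?S" if ij: "i + j = k" for i j x y
  proof (rule cbilinear_cspan[OF cbilinear_pure csubspace_cspan])
    show "uhcomp (weil_algebra H) i x \<in> cspan {uword w | w. word_degree w = i}"
      by (simp flip: range_uhcomp[of H])
    show "weil_comp j y \<in> cspan {weil_word w | w. w \<noteq> [] \<and> word_degree w = j}"
      by (simp flip: range_weil_comp)
    fix s :: "complex \<times> 'a weil" and t :: "'a weil"
    assume "s \<in> {uword w | w. word_degree w = i}" "t \<in> {weil_word w | w. w \<noteq> [] \<and> word_degree w = j}"
    then have "s \<otimes>\<^sub>C t \<in> ?S" using ij by blast
    then show "s \<otimes>\<^sub>C t \<in> cspan ?S" by (rule complex_vector.span_base)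
  qed
  then show "form_homog (weil_algebra H) k \<subseteq> cspan ?S"
    unfolding form_homog_def weil_algebra_simps by (intro cspan_subset csubspace_cspan) auto
  show "cspan ?S \<subseteq> form_homog (weil_algebra H) k"
    unfolding form_homog_def weil_algebra_simps
  proof (rule complex_vector.span_mono, safe)
    fix u v :: "'a weil_gen list"
    assume "v \<noteq> []" "k = word_degree u + word_degree v"
    moreover have "uword u = uhcomp (weil_algebra H) (word_degree u) (uword u)"
      "weil_word v = weil_comp (word_degree v) (weil_word v)"
      by (simp_all add: uhcomp_uword weil_comp_word)
    ultimately show "\<exists>i j x y. uword u \<otimes>\<^sub>C weil_word v = uhcomp (weil_algebra H) i x \<otimes>\<^sub>C weil_comp j y \<and>
        i + j = word_degree u + word_degree v" by metis
  qed
qed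

text \<open>\<open>usign\<close> and \<open>gcommutator\<close> sum over the nonzero homogeneous
  components; over an infinite index set \<open>sum\<close> would return 0.\<close>

lemma finite_uhcomp: "finite {k. uhcomp (weil_algebra H) k u \<noteq> 0}"
proof -
  let ?P = "{u. finite {k. uhcomp (weil_algebra H) k u \<noteq> 0}}"
  have "u \<in> cspan (range uword)" by (simp add: uwords_span)
  moreover have "csubspace ?P"
  proof (rule complex_vector.subspaceI)
    show "0 \<in> ?P" by (simp add: clinear_0[OF clinear_uhcomp])
    fix x y and c assume *: "x \<in> ?P" "y \<in> ?P"
    have "{k. uhcomp (weil_algebra H) k (x + y) \<noteq> 0} \<subseteq>
        {k. uhcomp (weil_algebra H) k x \<noteq> 0} \<union> {k. uhcomp (weil_algebra H) k y \<noteq> 0}"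
      by (auto simp: clinear_add[OF clinear_uhcomp])
    then show "x + y \<in> ?P"
      using * by (auto intro: finite_subset)
    have "{k. uhcomp (weil_algebra H) k (c *\<^sub>C x) \<noteq> 0} \<subseteq> {k. uhcomp (weil_algebra H) k x \<noteq> 0}"
      by (auto simp: clinear_scaleC[OF clinear_uhcomp])
    then show "c *\<^sub>C x \<in> ?P"
      using * by (auto intro: finite_subset)
  qed
  moreover have "range uword \<subseteq> ?P"
    by (auto simp: uhcomp_uword)
  ultimately show ?thesis using cspan_subset by blast
qed

text \<open>The index set in the definition of \<open>usign\<close> depends on the argument, which
  hides linearity; a common finite index set for all arguments involved restores it.\<close>

lemma usign_superset:
  assumes "finite F" "{k. uhcomp (weil_algebra H) k u \<noteq> 0} \<subseteq> F"
  shows "usign (weil_algebra H) u = (\<Sum>k\<in>F. koszul k *\<^sub>C uhcomp (weil_algebra H) k u)"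
  unfolding usign_def by (rule sum.mono_neutral_left) (use assms in auto)

lemma clinear_usign: "clinear (usign (weil_algebra H))"
proof (rule clinearI)
  fix x y and c
  let ?F = "{k. uhcomp (weil_algebra H) k x \<noteq> 0} \<union> {k. uhcomp (weil_algebra H) k y \<noteq> 0}"
  have F: "finite ?F" by (simp add: finite_uhcomp)
  have e: "usign (weil_algebra H) z = (\<Sum>k\<in>?F. koszul k *\<^sub>C uhcomp (weil_algebra H) k z)"
    if "z \<in> {x, y, x + y, c *\<^sub>C x}" for z
    by (rule usign_superset[OF F])
      (use that in \<open>auto simp: clinear_add[OF clinear_uhcomp] clinear_scaleC[OF clinear_uhcomp]\<close>)
  show "usign (weil_algebra H) (x + y) = usign (weil_algebra H) x + usign (weil_algebra H) y"
    by (simp add: e clinear_add[OF clinear_uhcomp] scaleC_add_right sum.distrib)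
  show "usign (weil_algebra H) (c *\<^sub>C x) = c *\<^sub>C usign (weil_algebra H) x"
    by (simp add: e clinear_scaleC[OF clinear_uhcomp] complex_vector.scale_sum_right mult.commute)
qed

lemma usign_uword: "usign (weil_algebra H) (uword w) = koszul (word_degree w) *\<^sub>C uword w"
  by (subst usign_superset[of "{word_degree w}"]) (auto simp: uhcomp_uword)

lemma gcommutator_superset:
  assumes "finite F" "{k. uhcomp (weil_algebra H) k u \<noteq> 0} \<subseteq> F"
    and "finite G" "{k. uhcomp (weil_algebra H) k v \<noteq> 0} \<subseteq> G"
  shows "gcommutator (weil_algebra H) u v = (\<Sum>i\<in>F. \<Sum>j\<in>G.
      umult (uhcomp (weil_algebra H) i u) (uhcomp (weil_algebra H) j v)
      - koszul (i * j) *\<^sub>C umult (uhcomp (weil_algebra H) j v) (uhcomp (weil_algebra H) i u))"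
proof -
  let ?c = "\<lambda>i j. umult (uhcomp (weil_algebra H) i u) (uhcomp (weil_algebra H) j v)
      - koszul (i * j) *\<^sub>C umult (uhcomp (weil_algebra H) j v) (uhcomp (weil_algebra H) i u)"
  have "gcommutator (weil_algebra H) u v = (\<Sum>i | uhcomp (weil_algebra H) i u \<noteq> 0. \<Sum>j\<in>G. ?c i j)"
    unfolding gcommutator_def using assms(3,4)
    by (intro sum.cong refl sum.mono_neutral_left) (auto simp: umult_simps)
  also have "\<dots> = (\<Sum>i\<in>F. \<Sum>j\<in>G. ?c i j)"
    using assms(1,2) by (intro sum.mono_neutral_left) (auto simp: umult_simps)
  finally show ?thesis .
qed

lemma cbilinear_gcommutator: "cbilinear (gcommutator (weil_algebra H))"
proof (rule cbilinearI; rule clinearI)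
  fix x y v and c
  let ?S = "\<lambda>x. {k. uhcomp (weil_algebra H) k x \<noteq> 0}"
  note l = clinear_add[OF clinear_uhcomp] clinear_scaleC[OF clinear_uhcomp]
  have S: "?S (x + y) \<subseteq> ?S x \<union> ?S y" "?S (c *\<^sub>C x) \<subseteq> ?S x \<union> ?S y" by (auto simp: l)
  have F: "finite (?S x \<union> ?S y)" "finite (?S v)" by (simp_all add: finite_uhcomp)
  note g = gcommutator_superset[of "?S x \<union> ?S y" H _ "?S v" v]
    gcommutator_superset[of "?S v" H v "?S x \<union> ?S y"]
  note s = l umult_simps scaleC_add_right sum.distrib[symmetric] complex_vector.scale_sum_right
    algebra_simps complex_vector.scale_right_diff_distrib
  show "gcommutator (weil_algebra H) (x + y) v = gcommutator (weil_algebra H) x v + gcommutator (weil_algebra H) y v"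
    using F S by (simp add: g(1)) (simp add: s)
  show "gcommutator (weil_algebra H) (c *\<^sub>C x) v = c *\<^sub>C gcommutator (weil_algebra H) x v"
    using F S by (simp add: g(1)) (simp add: s)
  show "gcommutator (weil_algebra H) v (x + y) = gcommutator (weil_algebra H) v x + gcommutator (weil_algebra H) v y"
    using F S by (simp add: g(2)) (simp add: s)
  show "gcommutator (weil_algebra H) v (c *\<^sub>C x) = c *\<^sub>C gcommutator (weil_algebra H) v x"
    using F S by (simp add: g(2)) (simp add: s)
qed

lemma gcommutator_uword:
  "gcommutator (weil_algebra H) (uword u) (uword v) =
    uword (u @ v) - koszul (word_degree u * word_degree v) *\<^sub>C uword (v @ u)"
  by (subst gcommutator_superset[of "{word_degree u}" H _ "{word_degree v}"])
    (auto simp: uhcomp_uword umult_uword)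

lemmas clinear_gcommutator = cbilinear_left[OF cbilinear_gcommutator] cbilinear_right[OF cbilinear_gcommutator]

lemma form_b_pure: "form_b (weil_algebra H) (x \<otimes>\<^sub>C y) = snd (gcommutator (weil_algebra H) x (0, y))"
  and clinear_form_b: "clinear (form_b (weil_algebra H))"
proof -
  have "cbilinear (\<lambda>x y. snd (gcommutator (weil_algebra H) x (0, y)))"
    by (intro cbilinearI clinear_intros clinear_gcommutator)
  from tensor_lift_pure[OF this] clinear_tensor_lift[OF this]
  show "form_b (weil_algebra H) (x \<otimes>\<^sub>C y) = snd (gcommutator (weil_algebra H) x (0, y))"
    "clinear (form_b (weil_algebra H))"
    by (simp_all add: form_b_def[abs_def])
qed

lemma form_b_uword:
  "v \<noteq> [] \<Longrightarrow> form_b (weil_algebra H) (uword u \<otimes>\<^sub>C weil_word v) =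
    weil_word (u @ v) - koszul (word_degree u * word_degree v) *\<^sub>C weil_word (v @ u)"
  by (simp add: form_b_pure Pair_weil_word gcommutator_uword scaleC_prod_def)

section \<open>Cyclic rotation\<close>

lemma word_linear_single: "G \<in> {Gen, Omega} \<Longrightarrow> clinear (\<lambda>h. weil_word [G h])"
  using word_linearD[OF word_linear_weil_word, of G "[]" "[]"] by simp

lemma word_linear_degree_scale:
  assumes "word_linear \<phi>"
  shows "word_linear (\<lambda>w. koszul (f (word_degree w)) *\<^sub>C \<phi> w)"
  by (rule word_linear_shape_scale[OF assms]) auto

lemma word_linear_rotate:
  "word_linear (\<lambda>w. case w of [] \<Rightarrow> 0 | a # x \<Rightarrow>
    koszul (gen_degree a * word_degree x) *\<^sub>C weil_word (x @ [a]))"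
proof (rule word_linear_Cons)
  fix G :: "'a \<Rightarrow> 'a weil_gen" and x assume G: "G \<in> {Gen, Omega}"
  show "clinear (\<lambda>h. koszul (gen_degree (G h) * word_degree x) *\<^sub>C weil_word (x @ [G h]))"
    using clinear_scale[OF word_linearD[OF word_linear_weil_word G, of x "[]"]] G by auto
qed (intro word_linear_degree_scale word_linear_append_right word_linear_weil_word)

lemma clinear_weil_t: "clinear weil_t"
  unfolding weil_t_def by (rule clinear_weil_lift[OF word_linear_rotate])

lemma weil_t_word:
  "weil_t (weil_word (a # x)) = koszul (gen_degree a * word_degree x) *\<^sub>C weil_word (x @ [a])"
  unfolding weil_t_def by (simp add: weil_lift_word'[OF word_linear_rotate])

lemma clinear_weil_t_pow: "clinear (weil_t ^^ n)"
  by (rule clinear_funpow[OF clinear_weil_t])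

lemma weil_t_pow_word:
  "(weil_t ^^ length u) (weil_word (u @ v)) = koszul (word_degree u * word_degree v) *\<^sub>C weil_word (v @ u)"
proof (induction u arbitrary: v)
  case Nil show ?case by (simp add: koszul_def)
next
  case (Cons a u)
  have "(weil_t ^^ length (a # u)) (weil_word ((a # u) @ v)) =
      koszul (gen_degree a * word_degree (u @ v)) *\<^sub>C (weil_t ^^ length u) (weil_word (u @ (v @ [a])))"
    by (simp add: funpow_Suc_right weil_t_word clinear_scaleC[OF clinear_weil_t_pow] del: funpow.simps)
  also have "\<dots> = koszul (word_degree (a # u) * word_degree v) *\<^sub>C weil_word (v @ a # u)"
    \<comment> \<open>Moving \<open>a\<close> and then \<open>u\<close> costs |a|(|u| + |v|) +
      |u|(|v| + |a|), which differs from (|a| + |u|)|v| by the even number 2|a||u|.\<close>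
    unfolding Cons.IH by (simp add: koszul_mult algebra_simps koszul_cong)
  finally show ?case by simp
qed

lemma weil_t_pow_add: "(weil_t ^^ m) ((weil_t ^^ n) x) = (weil_t ^^ (m + n)) x"
  by (simp add: funpow_add)

text \<open>A full rotation leaves no residual sign. This closes up the telescoping sums over
  rotations below.\<close>

lemma weil_t_pow_length: "(weil_t ^^ length w) (weil_word w) = weil_word w"
  using weil_t_pow_word[of w "[]"] by (simp add: koszul_def)

lemma word_linear_sum_length:
  assumes "\<And>i. word_linear (\<phi> i)"
  shows "word_linear (\<lambda>w. \<Sum>i<length w. \<phi> i w)"
  by (rule word_linearI, simp only: length_append length_Cons)
    (intro clinear_sum word_linearD[OF assms])

lemma word_linear_N: "word_linear (\<lambda>w. \<Sum>i<length w. (weil_t ^^ i) (weil_word w))"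
  by (intro word_linear_sum_length word_linear_comp[OF clinear_weil_t_pow] word_linear_weil_word)

lemma clinear_weil_N: "clinear weil_N"
  unfolding weil_N_def by (rule clinear_weil_lift[OF word_linear_N])

lemma weil_N_word: "w \<noteq> [] \<Longrightarrow> weil_N (weil_word w) = (\<Sum>i<length w. (weil_t ^^ i) (weil_word w))"
  unfolding weil_N_def by (rule weil_lift_word'[OF word_linear_N])

section \<open>Comparison of the Weil algebra with its one-forms\<close>

text \<open>No quotient is taken: the value on \<open>a x\<close> is one specific form, with the
  sign of moving \<open>a\<close> behind \<open>x\<close>.\<close>

definition weil_to_form :: "'h::complex_vector weil \<Rightarrow> 'h weil forms" where
  "weil_to_form = weil_lift (\<lambda>w. case w of [] \<Rightarrow> 0 | a # x \<Rightarrow>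
    koszul (gen_degree a * word_degree x) *\<^sub>C (uword x \<otimes>\<^sub>C weil_word [a]))"

lemma word_linear_to_form:
  "word_linear (\<lambda>w. case w of [] \<Rightarrow> 0 | a # x \<Rightarrow>
    koszul (gen_degree a * word_degree x) *\<^sub>C (uword x \<otimes>\<^sub>C weil_word [a]))"
proof (rule word_linear_Cons)
  fix G :: "'a \<Rightarrow> 'a weil_gen" and x assume G: "G \<in> {Gen, Omega}"
  show "clinear (\<lambda>h. koszul (gen_degree (G h) * word_degree x) *\<^sub>C (uword x \<otimes>\<^sub>C weil_word [G h]))"
    using clinear_scale[OF clinear_pure_right[OF word_linear_single[OF G]]] G by auto
qed (intro word_linear_degree_scale word_linear_comp[OF clinear_pure_left[OF clinear_ident]] word_linear_uword)

lemma clinear_weil_to_form: "clinear weil_to_form"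
  unfolding weil_to_form_def by (rule clinear_weil_lift[OF word_linear_to_form])

lemma weil_to_form_word: "weil_to_form (weil_word (a # x)) =
    koszul (gen_degree a * word_degree x) *\<^sub>C (uword x \<otimes>\<^sub>C weil_word [a])"
  unfolding weil_to_form_def by (simp add: weil_lift_word'[OF word_linear_to_form])

text \<open>Leibniz expansion of \<open>dw\<close> gives one term for each letter of
  \<open>w\<close>; bringing that letter to the front modulo commutators is the rotation by
  \<open>length x + i\<close>. The formula makes sense on all one-forms, so that its vanishing on
  commutators can be stated and proved.\<close>

definition form_to_weil :: "'h::complex_vector weil forms \<Rightarrow> 'h weil" where
  "form_to_weil = tensor_lift (\<lambda>u y. ulift (\<lambda>x. weil_lift
     (\<lambda>w. \<Sum>i<length w. (weil_t ^^ (length x + i)) (weil_word (x @ w))) y) u)"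

lemma
  fixes x w :: "'a::complex_vector weil_gen list"
  shows clinear_form_to_weil: "clinear (form_to_weil :: 'a weil forms \<Rightarrow> 'a weil)"
    and form_to_weil_pure: "w \<noteq> [] \<Longrightarrow> form_to_weil (uword x \<otimes>\<^sub>C weil_word w) =
    (\<Sum>i<length w. (weil_t ^^ (length x + i)) (weil_word (x @ w)))"
proof -
  let ?f = "\<lambda>x w. \<Sum>i<length w. (weil_t ^^ (length x + i)) (weil_word (x @ w)) :: 'a weil"
  have 1: "word_linear (?f x)" for x
    by (intro word_linear_sum_length word_linear_comp[OF clinear_weil_t_pow]
      word_linear_append_left[OF word_linear_weil_word])
  have fw: "word_linear (\<lambda>x. ?f x w)" for w
    by (rule word_linearI, simp only: length_append length_Cons append_assoc append_Cons)
      (intro clinear_sum clinear_comp[OF clinear_weil_t_pow] word_linearD[OF word_linear_weil_word])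
  have 2: "word_linear (\<lambda>x. weil_lift (?f x) y)" for y
    by (rule word_linearI, rule clinear_weil_lift_param, rule word_linearD[OF fw])
  have 3: "clinear (\<lambda>y. ulift (\<lambda>x. weil_lift (?f x) y) u)" for u
    by (intro clinear_ulift_param clinear_weil_lift 1)
  have cb: "cbilinear (\<lambda>u y. ulift (\<lambda>x. weil_lift (?f x) y) u)"
    by (intro cbilinearI clinear_ulift 2 3)
  show "clinear (form_to_weil :: 'a weil forms \<Rightarrow> 'a weil)" unfolding form_to_weil_def by (rule clinear_tensor_lift[OF cb])
  show "form_to_weil (uword x \<otimes>\<^sub>C weil_word w) = ?f x w" if "w \<noteq> []"
    unfolding form_to_weil_def tensor_lift_pure[OF cb] ulift_uword[OF 2] using that by (rule weil_lift_word'[OF 1])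
qed

lemma form_to_weil_to_form: "form_to_weil (weil_to_form x) = x"
proof (rule weil_eqI[of "\<lambda>x. form_to_weil (weil_to_form x)"])
  fix w :: "'a weil_gen list" assume "w \<noteq> []"
  then obtain a x where "w = a # x" by (cases w) auto
  moreover have "form_to_weil (uword x \<otimes>\<^sub>C weil_word [a]) = koszul (gen_degree a * word_degree x) *\<^sub>C weil_word (a # x)"
    using weil_t_pow_word[of x "[a]"] by (simp add: form_to_weil_pure mult.commute)
  ultimately show "form_to_weil (weil_to_form (weil_word w)) = weil_word w"
    by (simp add: weil_to_form_word clinear_scaleC[OF clinear_form_to_weil])
qed (intro clinear_comp[OF clinear_form_to_weil clinear_weil_to_form] clinear_ident)+

text \<open>The rotations in \<open>form_to_weil\<close> are consecutive, so \<open>t - 1\<close>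
  telescopes. The identity is exact, not just modulo commutators.\<close>

lemma form_b_eq: "form_b (weil_algebra H) v = weil_t (form_to_weil v) - form_to_weil v"
proof (rule forms_eqI[of "form_b (weil_algebra H)"])
  fix u v :: "'a weil_gen list" assume v: "v \<noteq> []"
  let ?f = "\<lambda>i. (weil_t ^^ (length u + i)) (weil_word (u @ v))"
  have "weil_t (form_to_weil (uword u \<otimes>\<^sub>C weil_word v)) - form_to_weil (uword u \<otimes>\<^sub>C weil_word v) =
      (\<Sum>i<length v. ?f (Suc i)) - (\<Sum>i<length v. ?f i)"
    by (simp add: form_to_weil_pure v clinear_setsum[OF clinear_weil_t])
  also have "\<dots> = ?f (length v) - ?f 0"
    unfolding sum_subtractf[symmetric] by (rule sum_lessThan_telescope)
  also have "\<dots> = form_b (weil_algebra H) (uword u \<otimes>\<^sub>C weil_word v)"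
    \<comment> \<open>The exponent \<open>length u + length v\<close> is a full rotation; the
      exponent \<open>length u\<close> exchanges the two factors.\<close>
    using weil_t_pow_length[of "u @ v"] by (simp add: form_b_uword v weil_t_pow_word)
  finally show "form_b (weil_algebra H) (uword u \<otimes>\<^sub>C weil_word v) =
      weil_t (form_to_weil (uword u \<otimes>\<^sub>C weil_word v)) - form_to_weil (uword u \<otimes>\<^sub>C weil_word v)" ..
qed (intro clinear_sub clinear_form_b clinear_form_to_weil clinear_comp[OF clinear_weil_t])+

lemma clinear_form_d: "clinear form_d"
  unfolding form_d_def[abs_def] by (intro clinear_pure_right clinear_ident)

lemma form_to_weil_d: "form_to_weil (form_d x) = weil_N x"
proof (rule weil_eqI[of "\<lambda>x. form_to_weil (form_d x)"])
  fix w :: "'a weil_gen list" assume "w \<noteq> []"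
  then show "form_to_weil (form_d (weil_word w)) = weil_N (weil_word w)"
    using form_to_weil_pure[of w "[]"] by (simp add: form_d_def weil_N_word)
qed (intro clinear_comp[OF clinear_form_to_weil clinear_form_d] clinear_weil_N)+

text \<open>Applying \<open>t\<close> shifts the summation range by one, and a full rotation is the
  identity.\<close>

lemma weil_N_t: "weil_N (weil_t x) = weil_N x"
proof (rule weil_eqI[of "\<lambda>x. weil_N (weil_t x)"])
  fix w :: "'a weil_gen list" assume w: "w \<noteq> []"
  then obtain a x where ax: "w = a # x" by (cases w) auto
  let ?f = "\<lambda>i. (weil_t ^^ i) (weil_word w)"
  have "weil_N (weil_t (weil_word w)) = (\<Sum>i<length w. (weil_t ^^ i) (weil_t (weil_word w)))"
    by (simp add: ax weil_t_word clinear_scaleC[OF clinear_weil_N] weil_N_word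
        clinear_scaleC[OF clinear_weil_t_pow] complex_vector.scale_sum_right del: sum.lessThan_Suc)
  also have "\<dots> = (\<Sum>i<length w. ?f (Suc i))"
    by (simp add: funpow_swap1)
  also have "\<dots> = (\<Sum>i<length w. ?f i)"
    using sum_lessThan_telescope[of ?f "length w"] weil_t_pow_length[of w]
    by (simp add: sum_subtractf)
  finally show "weil_N (weil_t (weil_word w)) = weil_N (weil_word w)"
    by (simp add: weil_N_word w)
qed (intro clinear_comp[OF clinear_weil_N clinear_weil_t] clinear_weil_N)+

section \<open>Commutators of one-forms\<close>

lemma cbilinear_form_lmult_aux: "cbilinear (\<lambda>x y. umult (0, a) x \<otimes>\<^sub>C y)"
  by (intro cbilinearI clinear_pure_left clinear_pure_right clinear_umult_right clinear_ident)

lemma cbilinear_form_rmult_aux: "cbilinear (\<lambda>x y. x \<otimes>\<^sub>C (y * a) - umult x (0, y) \<otimes>\<^sub>C a)"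
  by (intro cbilinearI clinear_pure_left clinear_pure_right clinear_umult_right clinear_umult_left
      clinear_intros)

lemma form_lmult_pure: "form_lmult a (x \<otimes>\<^sub>C y) = umult (0, a) x \<otimes>\<^sub>C y"
  unfolding form_lmult_def by (rule tensor_lift_pure[OF cbilinear_form_lmult_aux])

lemma form_rmult_pure: "form_rmult (x \<otimes>\<^sub>C y) a = x \<otimes>\<^sub>C (y * a) - umult x (0, y) \<otimes>\<^sub>C a"
  unfolding form_rmult_def by (rule tensor_lift_pure[OF cbilinear_form_rmult_aux])

lemma cbilinear_form_lmult: "cbilinear form_lmult"
  unfolding cbilinear_def form_lmult_def
  by (intro conjI allI clinear_tensor_lift_param clinear_tensor_lift cbilinear_form_lmult_aux
      clinear_pure_left clinear_umult_left clinear_intros)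

lemma cbilinear_form_rmult: "cbilinear form_rmult"
  unfolding cbilinear_def form_rmult_def[abs_def]
  by (intro conjI allI clinear_tensor_lift_param clinear_tensor_lift cbilinear_form_rmult_aux
      clinear_sub clinear_pure_left clinear_pure_right clinear_umult_left clinear_intros)

lemmas clinear_form_lmult = cbilinear_left[OF cbilinear_form_lmult] cbilinear_right[OF cbilinear_form_lmult]
  and clinear_form_rmult = cbilinear_left[OF cbilinear_form_rmult] cbilinear_right[OF cbilinear_form_rmult]

text \<open>The graded commutator of \<open>u dv\<close> with \<open>w\<close>, expanded by the
  right action \<open>(u dv) w = u d(vw) - uv dw\<close>.\<close>

definition word_commutator :: "'h weil_gen list \<Rightarrow> 'h weil_gen list \<Rightarrow> 'h weil_gen list \<Rightarrow> 'h::complex_vector weil forms" where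
  "word_commutator u v w = uword u \<otimes>\<^sub>C weil_word (v @ w) - uword (u @ v) \<otimes>\<^sub>C weil_word w
    - koszul ((word_degree u + word_degree v) * word_degree w) *\<^sub>C (uword (w @ u) \<otimes>\<^sub>C weil_word v)"

lemma word_commutator_eq:
  assumes "v \<noteq> []" "w \<noteq> []"
  shows "form_rmult (uword u \<otimes>\<^sub>C weil_word v) (weil_word w)
      - koszul ((word_degree u + word_degree v) * word_degree w) *\<^sub>C form_lmult (weil_word w) (uword u \<otimes>\<^sub>C weil_word v)
    = word_commutator u v w"
  using assms
  by (simp add: word_commutator_def form_rmult_pure form_lmult_pure Pair_weil_word umult_uword weil_word_mult)

lemma form_commutators_weil:
  "form_commutators (weil_algebra H) = cspan {word_commutator u v w | u v w. v \<noteq> [] \<and> w \<noteq> []}"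
  (is "_ = cspan ?C")
proof
  have "form_rmult z a - koszul (k * l) *\<^sub>C form_lmult a z \<in> cspan ?C"
    if z: "z \<in> form_homog (weil_algebra H) k" and a: "a \<in> range (weil_comp l)" for k l a and z :: "'a weil forms"
  proof (rule cbilinear_cspan[OF _ csubspace_cspan _ z[unfolded form_homog_weil] a[unfolded range_weil_comp]])
    show "cbilinear (\<lambda>z a :: 'a weil. form_rmult z a - koszul (k * l) *\<^sub>C form_lmult a z)"
      by (intro cbilinearI clinear_sub clinear_scale clinear_form_lmult clinear_form_rmult clinear_ident)
    fix s :: "'a weil forms" and t :: "'a weil"
    assume "s \<in> {uword u \<otimes>\<^sub>C weil_word v |u v. v \<noteq> [] \<and> word_degree u + word_degree v = k}"
      and "t \<in> {weil_word w |w. w \<noteq> [] \<and> word_degree w = l}"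
    then obtain u v w where "s = uword u \<otimes>\<^sub>C weil_word v" "t = weil_word w" "v \<noteq> []" "w \<noteq> []"
      "k = word_degree u + word_degree v" "l = word_degree w" by blast
    then have "form_rmult s t - koszul (k * l) *\<^sub>C form_lmult t s \<in> ?C"
      using word_commutator_eq[of v w u] by blast
    then show "form_rmult s t - koszul (k * l) *\<^sub>C form_lmult t s \<in> cspan ?C"
      by (rule complex_vector.span_base)
  qed
  then show "form_commutators (weil_algebra H) \<subseteq> cspan ?C"
    unfolding form_commutators_def by (intro cspan_subset csubspace_cspan) auto
  show "cspan ?C \<subseteq> form_commutators (weil_algebra H)"
    unfolding form_commutators_def
  proof (rule complex_vector.span_mono, rule subsetI)
    fix c :: "'a weil forms" assume "c \<in> ?C"
    then obtain u v w where c: "c = word_commutator u v w" "v \<noteq> []" "w \<noteq> []" by blast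
    have "uword u \<otimes>\<^sub>C weil_word v \<in> form_homog (weil_algebra H) (word_degree u + word_degree v)"
      unfolding form_homog_weil using c by (intro complex_vector.span_base) blast
    moreover have "weil_word w \<in> range (weil_comp (word_degree w))"
      by (metis weil_comp_word rangeI)
    ultimately show "c \<in> {form_rmult w a - koszul (k * l) *\<^sub>C form_lmult a w |w a k l.
         w \<in> form_homog (weil_algebra H) k \<and> a \<in> range (hcomp (weil_algebra H) l)}"
      unfolding c(1) word_commutator_eq[OF c(2,3), symmetric] weil_algebra_simps by blast
  qed
qed

lemma csubspace_form_commutators: "csubspace (form_commutators R)"
  unfolding form_commutators_def by (rule csubspace_cspan)

lemma sum_lessThan_split: "(\<Sum>i<m + n. f i) = (\<Sum>i<m. f i) + (\<Sum>i<n. f (m + i))" for f :: "nat \<Rightarrow> 'b::comm_monoid_add"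
  by (induction n) (simp_all add: add.assoc)

text \<open>All three terms consist of rotations of one cyclic word u v w: those starting in v or w,
  minus those starting in w, minus those starting in v. The sign of the last term is the one
  relating w u v to u v w.\<close>

lemma form_to_weil_word_commutator:
  assumes "v \<noteq> []" "w \<noteq> []"
  shows "form_to_weil (word_commutator u v w) = 0"
proof -
  let ?x = "weil_word (u @ v @ w)"
  have "(weil_t ^^ (length w + length u + i)) (weil_word (w @ u @ v)) =
      koszul ((word_degree u + word_degree v) * word_degree w) *\<^sub>C (weil_t ^^ (length u + i)) ?x" for i
  proof -
    have "(weil_t ^^ (length w + length u + i)) (weil_word (w @ u @ v)) =
        (weil_t ^^ (length u + i)) ((weil_t ^^ length w) (weil_word (w @ u @ v)))"
      unfolding weil_t_pow_add by (simp add: algebra_simps)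
    then show ?thesis by (simp add: weil_t_pow_word clinear_scaleC[OF clinear_weil_t_pow] mult.commute)
  qed
  then show ?thesis
    using assms sum_lessThan_split[of "\<lambda>i. (weil_t ^^ (length u + i)) ?x" "length v" "length w"]
    by (simp add: word_commutator_def clinear_diff[OF clinear_form_to_weil] clinear_scaleC[OF clinear_form_to_weil]
      form_to_weil_pure complex_vector.scale_sum_right add.assoc)
qed

lemma form_to_weil_commutators: "z \<in> form_commutators (weil_algebra H) \<Longrightarrow> form_to_weil z = 0"
  unfolding form_commutators_weil
  by (erule clinear_eq_cspan[OF clinear_form_to_weil clinear_const0, rotated])
    (auto simp: form_to_weil_word_commutator)

lemma weil_to_form_to_weil_single:
  "weil_to_form (form_to_weil (uword x \<otimes>\<^sub>C weil_word [a])) = uword x \<otimes>\<^sub>C weil_word [a]"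
  using weil_t_pow_word[of x "[a]"]
  by (simp add: form_to_weil_pure weil_to_form_word clinear_scaleC[OF clinear_weil_to_form] mult.commute)

text \<open>Modulo the commutator of \<open>x da\<close> with \<open>y\<close>, the form
  \<open>x d(a y)\<close> equals \<open>xa dy\<close> plus a signed \<open>yx da\<close>. The latter
  is a one-letter form, which the composite fixes exactly, and the former has a shorter word under
  \<open>d\<close>.\<close>

lemma weil_to_form_to_weil_word:
  "w \<noteq> [] \<Longrightarrow> weil_to_form (form_to_weil (uword x \<otimes>\<^sub>C weil_word w)) - uword x \<otimes>\<^sub>C weil_word w
    \<in> form_commutators (weil_algebra H)"
proof (induction w arbitrary: x)
  case (Cons a y)
  note sub = csubspace_form_commutators[of "weil_algebra H"]
  show ?case
  proof (cases "y = []")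
    case True
    then show ?thesis by (simp add: weil_to_form_to_weil_single complex_vector.subspace_0[OF sub])
  next
    case False
    define E where "E = uword x \<otimes>\<^sub>C weil_word (a # y)"
    define A where "A = uword (x @ [a]) \<otimes>\<^sub>C weil_word y"
    define B where "B = koszul ((word_degree x + gen_degree a) * word_degree y) *\<^sub>C (uword (y @ x) \<otimes>\<^sub>C weil_word [a])"
    define c where "c = word_commutator x [a] y"
    have E: "E = c + A + B"
      by (simp add: E_def A_def B_def c_def word_commutator_def)
    have c: "c \<in> form_commutators (weil_algebra H)"
      unfolding form_commutators_weil c_def using False by (intro complex_vector.span_base) blast
    have A: "weil_to_form (form_to_weil A) - A \<in> form_commutators (weil_algebra H)"
      unfolding A_def by (rule Cons.IH[OF False])
    have B: "weil_to_form (form_to_weil B) = B"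
      by (simp add: B_def clinear_scaleC[OF clinear_form_to_weil] clinear_scaleC[OF clinear_weil_to_form]
        weil_to_form_to_weil_single)
    have "weil_to_form (form_to_weil E) - E = (weil_to_form (form_to_weil A) - A) - c"
      unfolding E using form_to_weil_commutators[OF c] B
      by (simp add: clinear_add[OF clinear_form_to_weil] clinear_add[OF clinear_weil_to_form])
    then show ?thesis
      using complex_vector.subspace_diff[OF sub A c] by (simp add: E_def)
  qed
qed simp

lemma weil_to_form_to_weil:
  "weil_to_form (form_to_weil z) - z \<in> form_commutators (weil_algebra H)"
  by (rule clinear_cspan[OF _ csubspace_form_commutators, of "\<lambda>z. weil_to_form (form_to_weil z) - z"
        "{uword u \<otimes>\<^sub>C weil_word v | u v. v \<noteq> []}"])
    (auto simp: forms_span weil_to_form_to_weil_word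
      intro!: clinear_intros clinear_comp[OF clinear_weil_to_form clinear_form_to_weil])

section \<open>The filtration by powers of the ideal\<close>

definition omega_count :: "'h weil_gen list \<Rightarrow> nat" where
  "omega_count w = length (filter (\<lambda>a. a \<in> range Omega) w)"

lemma omega_count_simps [simp]:
  "omega_count [] = 0" "omega_count (u @ v) = omega_count u + omega_count v"
  "omega_count (Gen h # u) = omega_count u" "omega_count (Omega h # u) = Suc (omega_count u)"
  by (auto simp: omega_count_def)

lemma omega_count_Cons: "omega_count (a # w) = omega_count [a] + omega_count w"
  by (simp add: omega_count_def)

text \<open>For positive \<open>k\<close> this is the k-th power of \<open>weil_ideal\<close> (see
  \<open>ideal_power_weil_0\<close>); described by words, it is visibly stable under
  rotation.\<close>

definition weil_filt :: "nat \<Rightarrow> 'h::complex_vector weil set" where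
  "weil_filt k = cspan {weil_word w | w. w \<noteq> [] \<and> k \<le> omega_count w}"

lemma csubspace_weil_filt: "csubspace (weil_filt k)"
  unfolding weil_filt_def by (rule csubspace_cspan)

lemma weil_filt_word: "k \<le> omega_count w \<Longrightarrow> weil_word w \<in> weil_filt k"
  unfolding weil_filt_def
  by (cases "w = []") (auto simp: complex_vector.span_zero intro: complex_vector.span_base)

lemma weil_filt_induct:
  assumes "x \<in> weil_filt k" "clinear f" "csubspace T"
    and "\<And>w. w \<noteq> [] \<Longrightarrow> k \<le> omega_count w \<Longrightarrow> f (weil_word w) \<in> T"
  shows "f x \<in> T"
  by (rule clinear_cspan[OF assms(2,3) _ assms(1)[unfolded weil_filt_def]]) (use assms(4) in blast)

text \<open>The suffix plays the part of the last factor in the recursion of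
  \<open>ideal_power\<close>, which multiplies by an element of the ideal on the right.\<close>

lemma omega_split:
  "Suc k \<le> omega_count w \<Longrightarrow> \<exists>u v. w = u @ v \<and> v \<noteq> [] \<and> k \<le> omega_count u \<and> 1 \<le> omega_count v"
proof (induction w rule: rev_induct)
  case (snoc a w)
  show ?case
  proof (cases a)
    case (Gen h)
    with snoc obtain u v where "w = u @ v" "v \<noteq> []" "k \<le> omega_count u" "1 \<le> omega_count v" by auto
    with Gen show ?thesis by (intro exI[of _ u] exI[of _ "v @ [a]"]) simp
  next
    case (Omega h)
    with snoc show ?thesis by (intro exI[of _ w] exI[of _ "[a]"]) simp
  qed
qed simp

lemma weil_ideal_eq: "weil_ideal = weil_filt 1"
proof
  have "two_sided_ideal (weil_filt 1 :: 'a weil set)"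
    unfolding two_sided_ideal_def
  proof (intro conjI ballI allI csubspace_weil_filt)
    fix x r :: "'a weil" assume x: "x \<in> weil_filt 1"
    have r: "r \<in> cspan {weil_word w | w. w \<noteq> []}" by (simp add: weil_words_span)
    have b: "cbilinear (\<lambda>x y :: 'a weil. x * y)" "cbilinear (\<lambda>x y :: 'a weil. y * x)"
      by (intro cbilinearI clinear_intros)+
    have "u * v \<in> weil_filt 1 \<and> v * u \<in> weil_filt 1"
      if "u \<in> {weil_word w | w. w \<noteq> []}" "v \<in> {weil_word w | w. w \<noteq> [] \<and> 1 \<le> omega_count w}" for u v :: "'a weil"
      using that by (auto simp: weil_word_mult intro!: weil_filt_word)
    then show "r * x \<in> weil_filt 1" "x * r \<in> weil_filt 1"
      using cbilinear_cspan[OF b(1) csubspace_weil_filt _ r x[unfolded weil_filt_def]]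
        cbilinear_cspan[OF b(2) csubspace_weil_filt _ r x[unfolded weil_filt_def]] by blast+
  qed
  then show "weil_ideal \<subseteq> (weil_filt 1 :: 'a weil set)"
    unfolding weil_ideal_def by (intro hull_minimal) (auto intro: weil_filt_word)
  have I: "two_sided_ideal (weil_ideal :: 'a weil set)"
    unfolding weil_ideal_def by (rule two_sided_ideal_hull)
  have "weil_word w \<in> weil_ideal" if "1 \<le> omega_count w" for w :: "'a weil_gen list"
  proof -
    have "filter (\<lambda>a. a \<in> range Omega) w \<noteq> []" using that by (auto simp: omega_count_def)
    then obtain h where "Omega h \<in> set w" by (auto simp: filter_empty_conv)
    then obtain u v where w: "w = u @ Omega h # v" by (meson split_list)
    have O: "weil_word [Omega h] \<in> weil_ideal"
      unfolding weil_ideal_def by (rule hull_inc) blast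
    have mem: "r * x \<in> weil_ideal" "x * r \<in> weil_ideal" if "x \<in> weil_ideal" for r x :: "'a weil"
      using I that by (auto simp: two_sided_ideal_def)
    have "weil_word (Omega h # v) \<in> weil_ideal"
      using O mem(2)[OF O, of "weil_word v"] by (cases "v = []") (simp_all add: weil_word_mult)
    from this mem(1)[OF this, of "weil_word u"] show ?thesis
      by (cases "u = []") (simp_all add: w weil_word_mult)
  qed
  then show "weil_filt 1 \<subseteq> (weil_ideal :: 'a weil set)"
    using I unfolding weil_filt_def two_sided_ideal_def by (intro cspan_subset) auto
qed

lemma cbilinear_umult: "cbilinear umult"
  by (intro cbilinearI clinear_umult_left clinear_umult_right clinear_ident)

text \<open>Exponent 0 includes the empty word, in agreement with the convention that the zeroth
  power is the whole unitization. In the inductive step \<open>omega_split\<close> factors a word,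
  and counting letters handles products.\<close>

lemma ideal_power_weil: "ideal_power weil_ideal k = cspan {uword w | w. k \<le> omega_count w}"
proof (induction k)
  case 0 show ?case by (simp add: full_SetCompr_eq uwords_span)
next
  case (Suc k)
  let ?S = "{uword w | w. Suc k \<le> omega_count w} :: (complex \<times> 'a weil) set"
  show ?case
  proof
    have "umult u (0, x) \<in> cspan ?S" if u: "u \<in> ideal_power weil_ideal k" and x: "x \<in> weil_ideal"
      for u and x :: "'a weil"
    proof (rule cbilinear_cspan[OF _ csubspace_cspan _ u[unfolded Suc] x[unfolded weil_ideal_eq weil_filt_def]])
      show "cbilinear (\<lambda>u x :: 'a weil. umult u (0, x))"
        by (intro cbilinearI clinear_umult_left clinear_umult_right clinear_intros)
      fix s :: "complex \<times> 'a weil" and t :: "'a weil"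
      assume "s \<in> {uword w |w. k \<le> omega_count w}" "t \<in> {weil_word w |w. w \<noteq> [] \<and> 1 \<le> omega_count w}"
      then obtain u v where "s = uword u" "k \<le> omega_count u" "t = weil_word v" "v \<noteq> []" "1 \<le> omega_count v" by blast
      then have "umult s (0, t) = uword (u @ v)" "Suc k \<le> omega_count (u @ v)"
        by (simp_all add: Pair_weil_word umult_uword)
      then show "umult s (0, t) \<in> cspan ?S" by (intro complex_vector.span_base) blast
    qed
    then show "ideal_power weil_ideal (Suc k) \<subseteq> cspan ?S"
      unfolding ideal_power.simps by (intro cspan_subset csubspace_cspan) blast
    have "uword w \<in> {umult u (0, x) |u x. u \<in> ideal_power weil_ideal k \<and> x \<in> weil_ideal}"
      if w: "Suc k \<le> omega_count w" for w :: "'a weil_gen list"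
    proof -
      obtain u v where uv: "w = u @ v" "v \<noteq> []" "k \<le> omega_count u" "1 \<le> omega_count v"
        using omega_split[OF w] by blast
      then have "uword w = umult (uword u) (0, weil_word v)"
        by (simp add: Pair_weil_word umult_uword)
      moreover have "uword u \<in> ideal_power weil_ideal k"
        unfolding Suc using uv by (intro complex_vector.span_base) blast
      moreover have "weil_word v \<in> weil_ideal"
        using uv by (simp add: weil_ideal_eq weil_filt_word)
      ultimately show ?thesis by blast
    qed
    then show "cspan ?S \<subseteq> ideal_power weil_ideal (Suc k)"
      unfolding ideal_power.simps by (intro complex_vector.span_mono) blast
  qed
qed

lemma ideal_power_weil_0: "{x. (0, x) \<in> ideal_power weil_ideal (Suc k)} = weil_filt (Suc k)"
proof
  have "snd u \<in> weil_filt (Suc k)" if "u \<in> ideal_power weil_ideal (Suc k)" for u :: "complex \<times> 'a weil"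
    by (rule clinear_cspan[OF clinear_snd[OF clinear_ident] csubspace_weil_filt _ that[unfolded ideal_power_weil]])
      (auto intro: weil_filt_word)
  then show "{x. (0, x) \<in> ideal_power weil_ideal (Suc k)} \<subseteq> (weil_filt (Suc k) :: 'a weil set)" by force
  have "(0, x) \<in> ideal_power weil_ideal (Suc k)" if x: "x \<in> weil_filt (Suc k)" for x :: "'a weil"
    by (rule weil_filt_induct[OF x], unfold ideal_power_weil)
      (auto simp: Pair_weil_word intro!: clinear_intros csubspace_cspan complex_vector.span_base)
  then show "weil_filt (Suc k) \<subseteq> {x :: 'a weil. (0, x) \<in> ideal_power weil_ideal (Suc k)}" by blast
qed

lemma weil_t_filt: "x \<in> weil_filt k \<Longrightarrow> weil_t x \<in> weil_filt k"
proof (erule weil_filt_induct[OF _ clinear_weil_t csubspace_weil_filt])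
  fix w :: "'a weil_gen list" assume w: "w \<noteq> []" "k \<le> omega_count w"
  then obtain a x where ax: "w = a # x" by (cases w) auto
  then have "k \<le> omega_count (x @ [a])" using w omega_count_Cons[of a x] by simp
  then show "weil_t (weil_word w) \<in> weil_filt k"
    unfolding ax weil_t_word by (intro complex_vector.subspace_scale[OF csubspace_weil_filt] weil_filt_word)
qed

lemma weil_t_pow_filt: "x \<in> weil_filt k \<Longrightarrow> (weil_t ^^ i) x \<in> weil_filt k"
  by (induction i) (simp_all add: weil_t_filt)

lemma form_to_weil_filt:
  "k \<le> omega_count u + omega_count v \<Longrightarrow> v \<noteq> [] \<Longrightarrow> form_to_weil (uword u \<otimes>\<^sub>C weil_word v) \<in> weil_filt k"
  by (simp add: form_to_weil_pure complex_vector.subspace_sum[OF csubspace_weil_filt] weil_t_pow_filt weil_filt_word)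

section \<open>The action of the Hopf algebra\<close>

lemma clinear_Pair0: "clinear f \<Longrightarrow> clinear (\<lambda>x. (0::complex, f x))"
  by (intro clinear_intros)

text \<open>As \<open>gen_degree\<close> separates \<open>Gen\<close> from \<open>Omega\<close>, the
  list of degrees is the pattern of constructors of a word. The action of \<open>H\<close> changes
  only the labels, so formulas whose signs and rotation counts depend on the pattern alone extend
  from words to their translates.\<close>

definition shape_span :: "'h::complex_vector weil_gen list \<Rightarrow> (complex \<times> 'h weil) set" where
  "shape_span x = cspan {uword w | w. map gen_degree w = map gen_degree x}"

lemma csubspace_shape_span: "csubspace (shape_span x)"
  unfolding shape_span_def by (rule csubspace_cspan)

lemma uword_shape_span: "map gen_degree w = map gen_degree x \<Longrightarrow> uword w \<in> shape_span x"
  unfolding shape_span_def by (rule complex_vector.span_base) blast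

lemma shape_span_eqI:
  assumes "X \<in> shape_span x" "clinear f" "clinear g"
    "\<And>w. map gen_degree w = map gen_degree x \<Longrightarrow> f (uword w) = g (uword w)"
  shows "f X = g X"
  by (rule clinear_eq_cspan[OF assms(2,3) _ assms(1)[unfolded shape_span_def]]) (use assms(4) in blast)

lemma shape_word_degree: "map gen_degree w = map gen_degree x \<Longrightarrow> word_degree w = word_degree x"
  by (simp add: word_degree_def)

lemma shape_length: "map gen_degree w = map gen_degree x \<Longrightarrow> length w = length x"
  by (metis length_map)

lemma gen_degree_act [simp]: "gen_degree (gen_act g a) = gen_degree a"
  by (cases a) simp_all

lemma gen_act_mult: "gen_act g (gen_act h a) = gen_act (g * h) a" for g h :: "'h::complex_algebra_1"
  by (cases a) (simp_all add: mult.assoc)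

lemma gen_act_one: "gen_act 1 a = a" for a :: "'h::complex_algebra_1 weil_gen"
  by (cases a) simp_all

lemma clinear_gen_act_uword:
  "clinear f \<Longrightarrow> clinear (\<lambda>x. uword (u @ gen_act (f x) a # v))"
  for f :: "_ \<Rightarrow> 'h::complex_algebra_1"
  using clinear_comp[OF word_linearD[OF word_linear_uword, of Gen u v] clinear_mult_left]
    clinear_comp[OF word_linearD[OF word_linear_uword, of Omega u v] clinear_mult_left]
  by (cases a) simp_all

lemmas clinear_gen_act = clinear_gen_act_uword[of _ "[]" _ "[]", simplified]

context hopf_algebra
begin

lemma clinear_sweedler: "cbilinear f \<Longrightarrow> clinear g \<Longrightarrow> clinear (\<lambda>x. sweedler H (g x) f)"
  by (rule clinear_comp[OF clinear_comp[OF clinear_tensor_lift comult_linear]])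

text \<open>The axiom lives in the triple tensor product; a trilinear \<open>f\<close> induces a
  linear map there, and applying it to both sides gives the form used in computations.\<close>

lemma sweedler_coassoc:
  assumes "\<And>b c. clinear (\<lambda>a. f a b c)" "\<And>a c. clinear (\<lambda>b. f a b c)" "\<And>a b. clinear (\<lambda>c. f a b c)"
  shows "sweedler H h (\<lambda>a b. sweedler H a (\<lambda>a0 a1. f a0 a1 b)) =
    sweedler H h (\<lambda>a b. sweedler H b (\<lambda>b0 b1. f a b0 b1))"
proof -
  let ?L = "tensor_lift (\<lambda>a s. tensor_lift (\<lambda>b c. f a b c) s)"
  have b: "cbilinear (\<lambda>b c. f a b c)" for a by (intro cbilinearI assms)
  have c: "cbilinear (\<lambda>a s. tensor_lift (\<lambda>b c. f a b c) s)"
    by (intro cbilinearI clinear_tensor_lift_param clinear_tensor_lift b assms)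
  note L = clinear_tensor_lift[OF c]
  show ?thesis
    using arg_cong[OF coassoc[of h], of ?L]
    by (simp add: tensor_lift_commute[OF L] tensor_lift_pure[OF c] tensor_lift_pure[OF b])
qed

section \<open>The action on words and the module algebra structure\<close>

lemma clinear_weil_act_word: "clinear (weil_act_word H w)"
proof (induction w rule: induct_list012)
  case 1 show ?case by (simp add: clinear_const0 fun_eq_iff[symmetric])
next
  case (2 a)
  show ?case using clinear_snd[OF clinear_gen_act[OF clinear_ident], of a] by simp
next
  case (3 a b w)
  have "cbilinear (\<lambda>g0 g1. weil_word [gen_act g0 a] * weil_act_word H (b # w) g1)"
    using clinear_snd[OF clinear_gen_act[OF clinear_ident], of a] 3
    by (intro cbilinearI clinear_mult_left clinear_mult_right) simp_all
  from clinear_sweedler[OF this clinear_ident] show ?case by simp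
qed

lemma word_linear_weil_act_word: "word_linear (\<lambda>w. weil_act_word H w g)"
proof (rule word_linearI)
  fix u v and G :: "'h \<Rightarrow> 'h weil_gen" assume G: "G \<in> {Gen, Omega}"
  have 1: "clinear (\<lambda>h. weil_word [gen_act g (G h)])" for g
    using G clinear_comp[OF word_linear_single[of G], of "\<lambda>h. g * h"] clinear_mult_right[OF clinear_ident, of g]
    by auto
  show "clinear (\<lambda>h. weil_act_word H (u @ G h # v) g)"
  proof (induction u arbitrary: g)
    case Nil
    show ?case
      using 1 by (cases v) (auto intro!: clinear_tensor_lift_param clinear_mult_left)
  next
    case (Cons a u)
    then show ?case
      by (cases u) (auto intro!: clinear_tensor_lift_param clinear_mult_right)
  qed
qed

lemma clinear_weil_act: "clinear (weil_act H g)"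
  unfolding weil_act_def by (rule clinear_weil_lift[OF word_linear_weil_act_word])

lemma weil_act_word: "weil_act H g (weil_word w) = weil_act_word H w g"
  unfolding weil_act_def
  using weil_lift_word'[OF word_linear_weil_act_word] clinear_0[OF clinear_weil_lift[OF word_linear_weil_act_word]]
  by (cases "w = []") simp_all

abbreviation uw_act :: "'h \<Rightarrow> complex \<times> 'h weil \<Rightarrow> complex \<times> 'h weil" where
  "uw_act \<equiv> uact H (weil_algebra H)"

lemma uw_act_Pair0: "uw_act g (0, x) = (0, weil_act H g x)"
  by (simp add: uact_def)

lemma cbilinear_weil_act: "cbilinear (weil_act H)"
proof (rule cbilinearI[OF _ clinear_weil_act])
  show "clinear (\<lambda>g. weil_act H g x)" for x
    unfolding weil_act_def by (rule clinear_weil_lift_param[OF clinear_weil_act_word])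
qed

lemma cbilinear_uw_act: "cbilinear uw_act"
  unfolding uact_def weil_algebra_simps
  by (rule cbilinearI; rule clinear_Pair)
    (auto intro!: clinear_intros cbilinear_left[OF cbilinear_weil_act] cbilinear_right[OF cbilinear_weil_act]
     clinear_mult_left clinear_mult_right counit_linear)

lemmas clinear_act = cbilinear_left[OF cbilinear_weil_act] cbilinear_right[OF cbilinear_weil_act]
  cbilinear_left[OF cbilinear_uw_act] cbilinear_right[OF cbilinear_uw_act]

lemma uw_act_one: "uw_act g (1, 0) = (counit H g, 0)"
  by (simp add: uact_def clinear_0[OF clinear_weil_act])

text \<open>On the unitization one recursion serves all nonempty words: for an empty tail the unit
  contributes \<open>counit H g1\<close>, and the counit axiom gives back the action on a single
  letter.\<close>

lemma uw_act_Cons: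
  "uw_act g (uword (a # w)) = sweedler H g (\<lambda>g0 g1. umult (uword [gen_act g0 a]) (uw_act g1 (uword w)))"
proof (cases w)
  case Nil
  have c: "umult x (c, 0) = c *\<^sub>C x" for x :: "complex \<times> 'h weil" and c
    by (simp add: umult_def scaleC_prod_def)
  have "uword [gen_act g a] = uword [gen_act (sweedler H g (\<lambda>g0 g1. counit H g1 *\<^sub>C g0)) a]"
    by (simp add: counit_right)
  also have "\<dots> = sweedler H g (\<lambda>g0 g1. uword [gen_act (counit H g1 *\<^sub>C g0) a])"
    by (rule tensor_lift_commute[OF clinear_gen_act[OF clinear_ident]])
  also have "\<dots> = sweedler H g (\<lambda>g0 g1. umult (uword [gen_act g0 a]) (uw_act g1 (uword w)))"
    by (simp add: Nil uw_act_one c clinear_scaleC[OF clinear_gen_act[OF clinear_ident]])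
  finally show ?thesis
    by (simp add: Nil uword_def uw_act_Pair0 weil_act_word)
next
  case (Cons b v)
  then show ?thesis
    using tensor_lift_commute[OF clinear_Pair0[OF clinear_ident],
        of "\<lambda>g0 g1. weil_word [gen_act g0 a] * weil_act_word H (b # v) g1" "comult H g"]
    by (simp add: uword_def uw_act_Pair0 weil_act_word umult_Pair0)
qed

text \<open>By induction on the first factor; passing from the bracketing \<open>a (x Y)\<close> to
  \<open>(a x) Y\<close> is exactly coassociativity.\<close>

lemma uw_act_umult: "uw_act g (umult X Y) = sweedler H g (\<lambda>g0 g1. umult (uw_act g0 X) (uw_act g1 Y))"
proof (rule uword_eqI[of "\<lambda>X. uw_act g (umult X Y)"])
  fix x
  show "uw_act g (umult (uword x) Y) = sweedler H g (\<lambda>g0 g1. umult (uw_act g0 (uword x)) (uw_act g1 Y))"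
  proof (induction x arbitrary: g Y)
    case Nil
    have c: "umult (c, 0) x = c *\<^sub>C x" for x :: "complex \<times> 'h weil" and c
      by (simp add: umult_def scaleC_prod_def)
    have "uw_act g Y = uw_act (sweedler H g (\<lambda>g0 g1. counit H g0 *\<^sub>C g1)) Y"
      by (simp add: counit_left)
    also have "\<dots> = sweedler H g (\<lambda>g0 g1. uw_act (counit H g0 *\<^sub>C g1) Y)"
      by (rule tensor_lift_commute) (intro clinear_act clinear_ident)
    finally show ?case
      by (simp add: uw_act_one c clinear_scaleC[OF clinear_act(3)[OF clinear_ident]])
  next
    case (Cons a x)
    have L: "clinear (\<lambda>Z. umult (uword [gen_act g0 a]) Z)" "clinear (\<lambda>Z. umult Z (uw_act g0 Y))" for g0 Y
      by (intro clinear_umult_right clinear_umult_left clinear_ident)+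
    have "uw_act g (umult (uword (a # x)) Y) =
        sweedler H g (\<lambda>g0 g1. umult (uword [gen_act g0 a]) (uw_act g1 (umult (uword x) Y)))"
    proof (rule uword_eqI[of "\<lambda>Y. uw_act g (umult (uword (a # x)) Y)"])
      show "uw_act g (umult (uword (a # x)) (uword y)) =
        sweedler H g (\<lambda>g0 g1. umult (uword [gen_act g0 a]) (uw_act g1 (umult (uword x) (uword y))))" for y
        by (simp add: umult_uword uw_act_Cons)
    qed (intro clinear_tensor_lift_param clinear_act clinear_umult_right clinear_ident)+
    also have "\<dots> = sweedler H g (\<lambda>g0 g1. sweedler H g1 (\<lambda>h0 h1.
        umult (umult (uword [gen_act g0 a]) (uw_act h0 (uword x))) (uw_act h1 Y)))"
      by (simp add: Cons.IH tensor_lift_commute[OF L(1)] umult_assoc)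
    also have "\<dots> = sweedler H g (\<lambda>g0 g1. sweedler H g0 (\<lambda>h0 h1.
        umult (umult (uword [gen_act h0 a]) (uw_act h1 (uword x))) (uw_act g1 Y)))"
      by (rule sweedler_coassoc[symmetric])
        (intro clinear_umult_left clinear_umult_right clinear_act clinear_gen_act clinear_ident)+
    also have "\<dots> = sweedler H g (\<lambda>g0 g1. umult (uw_act g0 (uword (a # x))) (uw_act g1 Y))"
      by (simp add: uw_act_Cons tensor_lift_commute[OF L(2)])
    finally show ?case .
  qed
qed (intro clinear_tensor_lift_param clinear_act clinear_umult_left clinear_ident)+

lemma uw_act_single: "uw_act g (uword [a]) = uword [gen_act g a]"
  by (simp add: uword_def uw_act_Pair0 weil_act_word)

text \<open>Multiplicativity of the coproduct makes the recursion over letters compatible with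
  products in \<open>H\<close>; on the unit it is multiplicativity of the counit.\<close>

lemma uw_act_act: "uw_act g (uw_act h X) = uw_act (g * h) X"
proof (rule uword_eqI[of "\<lambda>X. uw_act g (uw_act h X)"])
  fix x
  show "uw_act g (uw_act h (uword x)) = uw_act (g * h) (uword x)"
  proof (induction x arbitrary: g h)
    case Nil
    have "uw_act g (counit H h, 0) = counit H h *\<^sub>C uw_act g (1, 0)"
      using clinear_scaleC[OF clinear_act(4)[OF clinear_ident], of g "counit H h" "(1, 0)"]
      by (simp add: scaleC_prod_def)
    then show ?case by (simp add: uw_act_one counit_mult scaleC_prod_def)
  next
    case (Cons a x)
    let ?f = "\<lambda>g h. umult (uword [gen_act g a]) (uw_act h (uword x))"
    have f: "cbilinear ?f"
      by (intro cbilinearI clinear_umult_left clinear_umult_right clinear_act clinear_gen_act clinear_ident)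
    have "uw_act g (uw_act h (uword (a # x))) =
       sweedler H h (\<lambda>h0 h1. sweedler H g (\<lambda>g0 g1. ?f (g0 * h0) (g1 * h1)))"
      by (simp add: uw_act_Cons[of _ a x] tensor_lift_commute[OF clinear_act(4)[OF clinear_ident]] uw_act_umult
          Cons.IH uw_act_single gen_act_mult)
    also have "\<dots> = sweedler H g (\<lambda>g0 g1. sweedler H h (\<lambda>h0 h1. ?f (g0 * h0) (g1 * h1)))"
      by (rule tensor_lift_swap)
    also have "\<dots> = sweedler H (g * h) ?f"
      by (simp add: comult_mult tensor_lift_commute[OF clinear_tensor_lift[OF f]] tensor_lift_pure[OF f])
    also have "\<dots> = uw_act (g * h) (uword (a # x))"
      by (simp add: uw_act_Cons)
    finally show ?case .
  qed
qed (intro clinear_act clinear_ident)+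

lemma uw_act_1: "uw_act 1 X = X"
proof (rule uword_eqI[of "uw_act 1"])
  show "uw_act 1 (uword x) = uword x" for x
  proof (induction x)
    case Nil show ?case by (simp add: uw_act_one counit_one)
  next
    case (Cons a x)
    have f: "cbilinear (\<lambda>g h. umult (uword [gen_act g a]) (uw_act h (uword x)))"
      by (intro cbilinearI clinear_umult_left clinear_umult_right clinear_act clinear_gen_act clinear_ident)
    show ?case by (simp add: uw_act_Cons comult_one tensor_lift_pure[OF f] gen_act_one Cons umult_uword)
  qed
qed (intro clinear_act clinear_ident)+

lemma weil_act_act: "weil_act H g (weil_act H h x) = weil_act H (g * h) x"
  using uw_act_act[of g h "(0, x)"] by (simp add: uw_act_Pair0)

lemma weil_act_1: "weil_act H 1 x = x"
  using uw_act_1[of "(0, x)"] by (simp add: uw_act_Pair0)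

lemma uw_act_shape: "uw_act g (uword x) \<in> shape_span x"
proof (induction x arbitrary: g)
  case Nil
  have "uw_act g (uword []) = counit H g *\<^sub>C uword []"
    by (simp add: uw_act_one scaleC_prod_def)
  then show ?case
    by (simp only:) (intro complex_vector.subspace_scale[OF csubspace_shape_span] uword_shape_span refl)
next
  case (Cons a x)
  have "umult (uword [gen_act g0 a]) X \<in> shape_span (a # x)" if X: "X \<in> shape_span x" for g0 X
    by (rule clinear_cspan[OF clinear_umult_right[OF clinear_ident] csubspace_shape_span _ X[unfolded shape_span_def]])
      (auto simp: umult_uword intro!: uword_shape_span)
  then show ?case
    unfolding uw_act_Cons using Cons.IH by (intro tensor_lift_in csubspace_shape_span) blast
qed

lemma cbilinear_form_act_aux: "cbilinear (\<lambda>x y. sweedler H h (\<lambda>h0 h1. uw_act h0 x \<otimes>\<^sub>C weil_act H h1 y))"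
  by (intro cbilinearI clinear_tensor_lift_param clinear_pure_left clinear_pure_right clinear_act clinear_ident)

lemma form_act_pure: "form_act H (weil_algebra H) h (x \<otimes>\<^sub>C y) = sweedler H h (\<lambda>h0 h1. uw_act h0 x \<otimes>\<^sub>C weil_act H h1 y)"
  unfolding form_act_def weil_algebra_simps by (rule tensor_lift_pure[OF cbilinear_form_act_aux])

lemma clinear_form_act: "clinear (form_act H (weil_algebra H) h)"
  unfolding form_act_def weil_algebra_simps by (rule clinear_tensor_lift[OF cbilinear_form_act_aux])

end

section \<open>Coinvariants\<close>

lemma csubspace_coinv: "csubspace (coinv \<delta> \<rho>)"
  unfolding coinv_def by (rule csubspace_cspan)

lemma coinv_base: "\<rho> h v - \<delta> h *\<^sub>C v \<in> coinv \<delta> \<rho>"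
  unfolding coinv_def by (rule complex_vector.span_base) blast

lemma clinear_coinv:
  assumes "clinear f" "csubspace T" "\<And>h v. f (\<rho> h v - \<delta> h *\<^sub>C v) \<in> T" "x \<in> coinv \<delta> \<rho>"
  shows "f x \<in> T"
  by (rule clinear_cspan[OF assms(1,2) _ assms(4)[unfolded coinv_def]]) (use assms(3) in blast)

text \<open>\<open>x dy\<close> goes to \<open>x y\<close>. The map is equivariant for the diagonal
  action but does not kill commutators; it serves to transport coinvariants.\<close>

definition form_mult :: "'h::complex_vector weil forms \<Rightarrow> 'h weil" where
  "form_mult = tensor_lift (\<lambda>x y. snd (umult x (0, y)))"

lemma cbilinear_form_mult_aux: "cbilinear (\<lambda>x y. snd (umult x (0, y)))"
  by (intro cbilinearI clinear_snd clinear_umult_left clinear_umult_right clinear_Pair0 clinear_ident)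

lemma clinear_form_mult: "clinear form_mult"
  unfolding form_mult_def by (rule clinear_tensor_lift[OF cbilinear_form_mult_aux])

lemma form_mult_pure: "form_mult (x \<otimes>\<^sub>C y) = snd (umult x (0, y))"
  unfolding form_mult_def by (rule tensor_lift_pure[OF cbilinear_form_mult_aux])

text \<open>Passing through one-forms, where the flip of the tensor factors can be analysed, is what shows
  that \<open>t\<close> preserves the coinvariants.\<close>

lemma weil_t_eq: "weil_t x = form_mult (weil_to_form x)"
proof (rule weil_eqI[OF clinear_weil_t])
  fix w :: "'a weil_gen list" assume "w \<noteq> []"
  then obtain a x where "w = a # x" by (cases w) auto
  then show "weil_t (weil_word w) = form_mult (weil_to_form (weil_word w))"
    by (simp add: weil_t_word weil_to_form_word clinear_scaleC[OF clinear_form_mult] form_mult_pure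
      Pair_weil_word umult_uword)
qed (rule clinear_comp[OF clinear_form_mult clinear_weil_to_form])

locale twisted_involutive = hopf_algebra H for H :: "'h::complex_algebra_1 hopf_data" +
  fixes \<delta> :: "'h \<Rightarrow> complex"
  assumes \<delta>_linear: "clinear \<delta>"
    and involution: "twisted_antipode H \<delta> \<circ> twisted_antipode H \<delta> = id"
begin

lemma twisted_involution: "twisted_antipode H \<delta> (twisted_antipode H \<delta> h) = h"
  using involution by (simp add: fun_eq_iff)

text \<open>By coassociativity the left side is the sum of \<delta>(h_0) S(h_1) h_2, and the
  antipode axiom collapses the last two factors.\<close>

lemma twisted_antipode_left: "sweedler H h (\<lambda>h0 h1. twisted_antipode H \<delta> h0 * h1) = \<delta> h *\<^sub>C 1"
proof -
  have L: "clinear (\<lambda>x. x * b)" "clinear (\<lambda>x. c *\<^sub>C x)" "clinear (\<lambda>x. \<delta> x *\<^sub>C (1 :: 'h))" for b :: 'h and c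
    by (intro clinear_intros \<delta>_linear)+
  have "sweedler H h (\<lambda>h0 h1. twisted_antipode H \<delta> h0 * h1) =
     sweedler H h (\<lambda>h0 h1. sweedler H h0 (\<lambda>a b. \<delta> a *\<^sub>C (antipode H b * h1)))"
    by (simp add: twisted_antipode_def tensor_lift_commute[OF L(1)])
  also have "\<dots> = sweedler H h (\<lambda>h0 h1. sweedler H h1 (\<lambda>a b. \<delta> h0 *\<^sub>C (antipode H a * b)))"
    by (rule sweedler_coassoc) (intro clinear_intros \<delta>_linear clinear_mult_left antipode_linear)+
  also have "\<dots> = sweedler H h (\<lambda>h0 h1. \<delta> (counit H h1 *\<^sub>C h0) *\<^sub>C 1)"
    by (simp add: tensor_lift_scale antipode_left clinear_scaleC[OF \<delta>_linear] mult.commute)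
  also have "\<dots> = \<delta> h *\<^sub>C 1"
    using tensor_lift_commute[OF L(3), of "\<lambda>h0 h1. counit H h1 *\<^sub>C h0" "comult H h"] by (simp add: counit_right)
  finally show ?thesis .
qed

abbreviation form_coinv where "form_coinv \<equiv> coinv \<delta> (form_act H (weil_algebra H))"

text \<open>Sum the coinvariants obtained by letting g_0 act on X \<otimes> S(g_1) Y and subtracting
  \<delta>(g_0) times this tensor. The first part is g_0 X \<otimes> g_1 S(g_2) Y, which is g X
  \<otimes> Y by the antipode axiom; the second is the twisted antipode by definition.\<close>

lemma act_left_to_right:
  "uw_act g X \<otimes>\<^sub>C Y - X \<otimes>\<^sub>C weil_act H (twisted_antipode H \<delta> g) Y \<in> form_coinv"
proof -
  let ?S = "antipode H"
  have 1: "sweedler H g (\<lambda>g0 g1. form_act H (weil_algebra H) g0 (X \<otimes>\<^sub>C weil_act H (?S g1) Y)) = uw_act g X \<otimes>\<^sub>C Y"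
  proof -
    have L: "clinear (\<lambda>g. uw_act g0 X \<otimes>\<^sub>C weil_act H g Y)" "clinear (\<lambda>g. uw_act g X \<otimes>\<^sub>C Y)" for g0
      by (intro clinear_pure_right clinear_pure_left clinear_act clinear_ident)+
    have "sweedler H g (\<lambda>g0 g1. form_act H (weil_algebra H) g0 (X \<otimes>\<^sub>C weil_act H (?S g1) Y)) =
      sweedler H g (\<lambda>g0 g1. sweedler H g0 (\<lambda>a b. uw_act a X \<otimes>\<^sub>C weil_act H (b * ?S g1) Y))"
      by (simp add: form_act_pure weil_act_act)
    also have "\<dots> = sweedler H g (\<lambda>g0 g1. sweedler H g1 (\<lambda>a b. uw_act g0 X \<otimes>\<^sub>C weil_act H (a * ?S b) Y))"
      by (rule sweedler_coassoc)
        (intro clinear_pure_right clinear_pure_left clinear_act clinear_intros antipode_linear)+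
    also have "\<dots> = sweedler H g (\<lambda>g0 g1. uw_act (counit H g1 *\<^sub>C g0) X \<otimes>\<^sub>C Y)"
      using tensor_lift_commute[OF L(1), of _ "\<lambda>a b. a * ?S b" "comult H _", symmetric]
      by (simp add: antipode_right clinear_scaleC[OF clinear_act(1)[OF clinear_ident]] weil_act_1
        clinear_scaleC[OF clinear_act(3)[OF clinear_ident]] pure_simps)
    also have "\<dots> = uw_act g X \<otimes>\<^sub>C Y"
      using tensor_lift_commute[OF L(2), of "\<lambda>h0 h1. counit H h1 *\<^sub>C h0" "comult H g"] by (simp add: counit_right)
    finally show ?thesis .
  qed
  have L: "clinear (\<lambda>g. X \<otimes>\<^sub>C weil_act H g Y)"
    by (intro clinear_pure_right clinear_act clinear_ident)
  have 2: "sweedler H g (\<lambda>g0 g1. \<delta> g0 *\<^sub>C (X \<otimes>\<^sub>C weil_act H (?S g1) Y)) = X \<otimes>\<^sub>C weil_act H (twisted_antipode H \<delta> g) Y"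
    by (simp add: twisted_antipode_def tensor_lift_commute[OF L] clinear_scaleC[OF L])
  have "sweedler H g (\<lambda>g0 g1. form_act H (weil_algebra H) g0 (X \<otimes>\<^sub>C weil_act H (?S g1) Y)
      - \<delta> g0 *\<^sub>C (X \<otimes>\<^sub>C weil_act H (?S g1) Y)) \<in> form_coinv"
    by (intro tensor_lift_in csubspace_coinv coinv_base)
  then show ?thesis by (simp add: tensor_lift_sub 1 2)
qed

text \<open>Substituting \<open>\<delta>(h) = S\<^sub>\<delta>(h\<^sub>0) h\<^sub>1\<close> in the second term, the difference becomes a sum of instances of
  \<open>act_left_to_right\<close> with \<open>g = S\<^sub>\<delta>(h\<^sub>0)\<close>; this is where the involutivity of \<open>S\<^sub>\<delta>\<close> enters.\<close>

lemma coinv_flip: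
  "sweedler H h (\<lambda>h0 h1. uw_act h1 X \<otimes>\<^sub>C weil_act H h0 Y) - \<delta> h *\<^sub>C (X \<otimes>\<^sub>C Y) \<in> form_coinv"
proof -
  let ?S = "twisted_antipode H \<delta>"
  have "- (uw_act (?S h0) (uw_act h1 X) \<otimes>\<^sub>C Y - uw_act h1 X \<otimes>\<^sub>C weil_act H h0 Y) \<in> form_coinv" for h0 h1
    using act_left_to_right[of "?S h0" "uw_act h1 X" Y]
    by (simp add: twisted_involution complex_vector.subspace_neg[OF csubspace_coinv] del: minus_diff_eq)
  then have "sweedler H h (\<lambda>h0 h1. uw_act h1 X \<otimes>\<^sub>C weil_act H h0 Y - uw_act (?S h0 * h1) X \<otimes>\<^sub>C Y) \<in> form_coinv"
    by (intro tensor_lift_in csubspace_coinv) (simp add: uw_act_act)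
  moreover have "sweedler H h (\<lambda>h0 h1. uw_act (?S h0 * h1) X \<otimes>\<^sub>C Y) = \<delta> h *\<^sub>C (X \<otimes>\<^sub>C Y)"
  proof -
    have L: "clinear (\<lambda>g. uw_act g X \<otimes>\<^sub>C Y)"
      by (intro clinear_pure_left clinear_act clinear_ident)
    show ?thesis
      using tensor_lift_commute[OF L, of "\<lambda>h0 h1. ?S h0 * h1" "comult H h"]
      by (simp add: twisted_antipode_left clinear_scaleC[OF L] uw_act_1)
  qed
  ultimately show ?thesis by (simp add: tensor_lift_sub)
qed

text \<open>The action on \<open>a x\<close> puts h_0 on \<open>a\<close> and h_1 on
  \<open>x\<close>; once \<open>a\<close> has moved to the back, the factors are in the wrong order
  for the diagonal action on forms. \<open>coinv_flip\<close> shows that the flipped action still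
  yields coinvariants.\<close>

lemma weil_to_form_coinv: "x \<in> coinv \<delta> (weil_act H) \<Longrightarrow> weil_to_form x \<in> form_coinv"
proof (erule clinear_coinv[OF clinear_weil_to_form csubspace_coinv, rotated])
  fix h and v :: "'h weil"
  show "weil_to_form (weil_act H h v - \<delta> h *\<^sub>C v) \<in> form_coinv"
  proof (rule clinear_cspan[of "\<lambda>v. weil_to_form (weil_act H h v - \<delta> h *\<^sub>C v)", OF _ csubspace_coinv])
    show "clinear (\<lambda>v. weil_to_form (weil_act H h v - \<delta> h *\<^sub>C v))"
      by (intro clinear_comp[OF clinear_weil_to_form] clinear_intros clinear_act)
    show "v \<in> cspan {weil_word w | w. w \<noteq> []}" by (simp add: weil_words_span)
    fix s :: "'h weil" assume "s \<in> {weil_word w | w. w \<noteq> []}"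
    then obtain a x where s: "s = weil_word (a # x)" by (auto simp: neq_Nil_conv)
    let ?k = "koszul (gen_degree a * word_degree x)"
    have L: "clinear (\<lambda>z. weil_to_form (snd z))"
      by (intro clinear_comp[OF clinear_weil_to_form] clinear_intros)
    \<comment> \<open>The sign involves only degrees, which the action on \<open>x\<close>
      preserves, so it is constant on the whole shape span.\<close>
    have e: "weil_to_form (snd (umult (uword [gen_act h0 a]) (uw_act h1 (uword x)))) =
        ?k *\<^sub>C (uw_act h1 (uword x) \<otimes>\<^sub>C weil_act H h0 (weil_word [a]))" for h0 h1
    proof (rule shape_span_eqI[OF uw_act_shape])
      show "clinear (\<lambda>X. weil_to_form (snd (umult (uword [gen_act h0 a]) X)))"
        by (rule clinear_comp[OF L clinear_umult_right[OF clinear_ident]])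
      show "clinear (\<lambda>X. ?k *\<^sub>C (X \<otimes>\<^sub>C weil_act H h0 (weil_word [a])))"
        by (intro clinear_scale clinear_pure_left clinear_ident)
      fix w :: "'h weil_gen list" assume "map gen_degree w = map gen_degree x"
      then have "word_degree w = word_degree x" by (rule shape_word_degree)
      then show "weil_to_form (snd (umult (uword [gen_act h0 a]) (uword w))) =
          ?k *\<^sub>C (uword w \<otimes>\<^sub>C weil_act H h0 (weil_word [a]))"
        by (simp add: umult_uword weil_to_form_word weil_act_word)
    qed
    have "weil_to_form (weil_act H h s) = weil_to_form (snd (uw_act h (uword (a # x))))"
      by (simp add: s uword_def uw_act_Pair0)
    also have "\<dots> = ?k *\<^sub>C sweedler H h (\<lambda>h0 h1. uw_act h1 (uword x) \<otimes>\<^sub>C weil_act H h0 (weil_word [a]))"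
      by (simp add: uw_act_Cons tensor_lift_commute[OF L] e tensor_lift_scale)
    finally have "weil_to_form (weil_act H h s - \<delta> h *\<^sub>C s) =
        ?k *\<^sub>C (sweedler H h (\<lambda>h0 h1. uw_act h1 (uword x) \<otimes>\<^sub>C weil_act H h0 (weil_word [a]))
          - \<delta> h *\<^sub>C (uword x \<otimes>\<^sub>C weil_word [a]))"
      by (simp add: s clinear_diff[OF clinear_weil_to_form] clinear_scaleC[OF clinear_weil_to_form]
        weil_to_form_word complex_vector.scale_right_diff_distrib mult.commute)
    then show "weil_to_form (weil_act H h s - \<delta> h *\<^sub>C s) \<in> form_coinv"
      by (simp only:) (intro complex_vector.subspace_scale[OF csubspace_coinv] coinv_flip)
  qed
qed

lemma form_mult_act: "form_mult (form_act H (weil_algebra H) h z) = weil_act H h (form_mult z)"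
proof (rule tensor_eqI[of "\<lambda>z. form_mult (form_act H (weil_algebra H) h z)"])
  fix x :: "complex \<times> 'h weil" and y :: "'h weil"
  have e: "umult u (0, v) = (0, snd (umult u (0, v)))" for u and v :: "'h weil" by (simp add: umult_def)
  have "form_mult (form_act H (weil_algebra H) h (x \<otimes>\<^sub>C y)) = snd (uw_act h (umult x (0, y)))"
    by (simp add: form_act_pure tensor_lift_commute[OF clinear_form_mult] form_mult_pure uw_act_umult
        tensor_lift_commute[OF clinear_snd[OF clinear_ident]] uw_act_Pair0)
  then show "form_mult (form_act H (weil_algebra H) h (x \<otimes>\<^sub>C y)) = weil_act H h (form_mult (x \<otimes>\<^sub>C y))"
    by (subst (asm) e) (simp add: uw_act_Pair0 form_mult_pure)
qed (intro clinear_comp[OF clinear_form_mult] clinear_comp[OF clinear_weil_act] clinear_form_act clinear_form_mult)+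

lemma form_mult_coinv: "z \<in> form_coinv \<Longrightarrow> form_mult z \<in> coinv \<delta> (weil_act H)"
proof (erule clinear_coinv[OF clinear_form_mult csubspace_coinv, rotated])
  show "form_mult (form_act H (weil_algebra H) h v - \<delta> h *\<^sub>C v) \<in> coinv \<delta> (weil_act H)" for h v
    using coinv_base[of "weil_act H"]
    by (simp add: clinear_diff[OF clinear_form_mult] clinear_scaleC[OF clinear_form_mult] form_mult_act)
qed

lemma weil_t_coinv: "x \<in> coinv \<delta> (weil_act H) \<Longrightarrow> weil_t x \<in> coinv \<delta> (weil_act H)"
  unfolding weil_t_eq by (intro form_mult_coinv weil_to_form_coinv)

lemma weil_t_pow_coinv: "x \<in> coinv \<delta> (weil_act H) \<Longrightarrow> (weil_t ^^ i) x \<in> coinv \<delta> (weil_act H)"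
  by (induction i) (simp_all add: weil_t_coinv)

text \<open>On forms of a fixed shape \<open>form_to_weil\<close> is multiplication followed by a
  fixed combination of powers of \<open>t\<close>. Multiplication is equivariant, so the action
  reaches the word itself.\<close>

lemma form_to_weil_act_word:
  assumes "w \<noteq> []"
  shows "form_to_weil (form_act H (weil_algebra H) h (uword x \<otimes>\<^sub>C weil_word w)) =
    (\<Sum>i<length w. (weil_t ^^ (length x + i)) (weil_act H h (weil_word (x @ w))))"
proof -
  let ?P = "\<lambda>z. \<Sum>i<length w. (weil_t ^^ (length x + i)) (form_mult z)"
  have P: "clinear ?P"
    by (intro clinear_sum clinear_comp[OF clinear_weil_t_pow] clinear_form_mult)
  have "form_to_weil (X \<otimes>\<^sub>C snd Y) = ?P (X \<otimes>\<^sub>C snd Y)" if X: "X \<in> shape_span x" and Y: "Y \<in> shape_span w" for X Y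
  proof (rule shape_span_eqI[OF X, of "\<lambda>X. form_to_weil (X \<otimes>\<^sub>C snd Y)"])
    fix u :: "'h weil_gen list" assume u: "map gen_degree u = map gen_degree x"
    show "form_to_weil (uword u \<otimes>\<^sub>C snd Y) = ?P (uword u \<otimes>\<^sub>C snd Y)"
    proof (rule shape_span_eqI[OF Y, of "\<lambda>Y. form_to_weil (uword u \<otimes>\<^sub>C snd Y)"])
      fix v :: "'h weil_gen list" assume v: "map gen_degree v = map gen_degree w"
      then have "v \<noteq> []" using assms by auto
      then show "form_to_weil (uword u \<otimes>\<^sub>C snd (uword v)) = ?P (uword u \<otimes>\<^sub>C snd (uword v))"
        using shape_length[OF u] shape_length[OF v]
        by (simp add: form_to_weil_pure form_mult_pure Pair_weil_word umult_uword)
    qed (intro clinear_comp[OF clinear_form_to_weil] clinear_comp[OF P] clinear_pure_right clinear_snd clinear_ident)+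
  qed (intro clinear_comp[OF clinear_form_to_weil] clinear_comp[OF P] clinear_pure_left clinear_ident)+
  from this[OF uw_act_shape uw_act_shape]
  have "form_to_weil (uw_act h0 (uword x) \<otimes>\<^sub>C weil_act H h1 (weil_word w)) =
      ?P (uw_act h0 (uword x) \<otimes>\<^sub>C weil_act H h1 (weil_word w))" for h0 h1
    by (simp add: uact_def)
  then have "form_to_weil (form_act H (weil_algebra H) h (uword x \<otimes>\<^sub>C weil_word w)) =
      ?P (form_act H (weil_algebra H) h (uword x \<otimes>\<^sub>C weil_word w))"
    by (simp add: form_act_pure tensor_lift_commute[OF clinear_form_to_weil] tensor_lift_commute[OF P])
  then show ?thesis
    using assms by (simp add: form_mult_act form_mult_pure Pair_weil_word umult_uword)
qed

text \<open>Here multiplication keeps the factors in order, and all rearranging is done by powers of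
  \<open>t\<close>, already known to preserve coinvariants.\<close>

lemma form_to_weil_coinv: "z \<in> form_coinv \<Longrightarrow> form_to_weil z \<in> coinv \<delta> (weil_act H)"
proof (erule clinear_coinv[OF clinear_form_to_weil csubspace_coinv, rotated])
  fix h and v :: "'h weil forms"
  show "form_to_weil (form_act H (weil_algebra H) h v - \<delta> h *\<^sub>C v) \<in> coinv \<delta> (weil_act H)"
  proof (rule clinear_cspan[of "\<lambda>v. form_to_weil (form_act H (weil_algebra H) h v - \<delta> h *\<^sub>C v)", OF _ csubspace_coinv])
    show "clinear (\<lambda>v. form_to_weil (form_act H (weil_algebra H) h v - \<delta> h *\<^sub>C v))"
      by (intro clinear_comp[OF clinear_form_to_weil] clinear_sub clinear_scale clinear_form_act clinear_ident)
    show "v \<in> cspan {uword u \<otimes>\<^sub>C weil_word v | u v. v \<noteq> []}" by (simp add: forms_span)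
    fix s :: "'h weil forms" assume "s \<in> {uword u \<otimes>\<^sub>C weil_word v | u v. v \<noteq> []}"
    then obtain x w where s: "s = uword x \<otimes>\<^sub>C weil_word w" and w: "w \<noteq> []" by blast
    have "form_to_weil (form_act H (weil_algebra H) h s - \<delta> h *\<^sub>C s) =
      (\<Sum>i<length w. (weil_t ^^ (length x + i)) (weil_act H h (weil_word (x @ w)) - \<delta> h *\<^sub>C weil_word (x @ w)))"
      using w by (simp add: s clinear_diff[OF clinear_form_to_weil] clinear_scaleC[OF clinear_form_to_weil]
          form_to_weil_act_word form_to_weil_pure clinear_diff[OF clinear_weil_t_pow]
          clinear_scaleC[OF clinear_weil_t_pow] sum_subtractf complex_vector.scale_sum_right)
    then show "form_to_weil (form_act H (weil_algebra H) h s - \<delta> h *\<^sub>C s) \<in> coinv \<delta> (weil_act H)"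
      by (simp only:) (intro complex_vector.subspace_sum[OF csubspace_coinv] weil_t_pow_coinv coinv_base)
  qed
qed

end

section \<open>Graded pieces\<close>

lemma snd_scaleC: "snd (c *\<^sub>C x) = c *\<^sub>C snd x"
  by (simp add: scaleC_prod_def)

text \<open>The homogeneous component of the unitization (compare \<open>range_uhcomp\<close>).
  Differentials of words are combinations of words, so sign rules are needed on the whole
  span.\<close>

definition degree_span :: "int \<Rightarrow> (complex \<times> 'h::complex_vector weil) set" where
  "degree_span k = cspan {uword w | w. word_degree w = k}"

lemma csubspace_degree_span: "csubspace (degree_span k)"
  unfolding degree_span_def by (rule csubspace_cspan)

lemma uword_degree_span: "word_degree w = k \<Longrightarrow> uword w \<in> degree_span k"
  unfolding degree_span_def by (rule complex_vector.span_base) blast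

lemma umult_degree_span: "X \<in> degree_span k \<Longrightarrow> Y \<in> degree_span l \<Longrightarrow> umult X Y \<in> degree_span (k + l)"
  unfolding degree_span_def[of k] degree_span_def[of l]
  by (erule (1) cbilinear_cspan[OF cbilinear_umult csubspace_degree_span, rotated])
    (auto simp: umult_uword intro!: uword_degree_span)

lemma degree_span_eqI:
  assumes "X \<in> degree_span k" "clinear f" "clinear g"
    "\<And>w. word_degree w = k \<Longrightarrow> f (uword w) = g (uword w)"
  shows "f X = g X"
  by (rule clinear_eq_cspan[OF assms(2,3) _ assms(1)[unfolded degree_span_def]]) (use assms(4) in blast)

lemma usign_degree_span: "X \<in> degree_span k \<Longrightarrow> usign (weil_algebra H) X = koszul k *\<^sub>C X"
  by (erule degree_span_eqI[OF _ clinear_usign]) (auto simp: usign_uword intro!: clinear_intros)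

lemma usign_umult: "usign (weil_algebra H) (umult X Y) = umult (usign (weil_algebra H) X) (usign (weil_algebra H) Y)"
proof (rule uword_eqI[of "\<lambda>X. usign (weil_algebra H) (umult X Y)"])
  show "usign (weil_algebra H) (umult (uword x) Y) = umult (usign (weil_algebra H) (uword x)) (usign (weil_algebra H) Y)" for x
  proof (rule uword_eqI[of "\<lambda>Y. usign (weil_algebra H) (umult (uword x) Y)"])
    show "usign (weil_algebra H) (umult (uword x) (uword y)) = umult (usign (weil_algebra H) (uword x)) (usign (weil_algebra H) (uword y))" for y
      by (simp add: umult_uword usign_uword umult_simps flip: koszul_mult)
  qed (intro clinear_comp[OF clinear_usign] clinear_umult_right clinear_usign clinear_ident)+
qed (intro clinear_comp[OF clinear_usign] clinear_umult_left clinear_usign clinear_ident)+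

lemma usign_one: "usign (weil_algebra H) (1, 0) = (1, 0)"
  using usign_uword[of H "[]"] by (simp add: koszul_def)

lemma gcommutator_degree_span:
  fixes H :: "'h::complex_algebra_1 hopf_data"
  assumes "X \<in> degree_span k" "Y \<in> degree_span l"
  shows "gcommutator (weil_algebra H) X Y = umult X Y - koszul (k * l) *\<^sub>C umult Y X"
proof (rule degree_span_eqI[OF assms(1), of "\<lambda>X. gcommutator (weil_algebra H) X Y"])
  fix u :: "'h weil_gen list" assume "word_degree u = k"
  then show "gcommutator (weil_algebra H) (uword u) Y = umult (uword u) Y - koszul (k * l) *\<^sub>C umult Y (uword u)"
    by (intro degree_span_eqI[OF assms(2), of "gcommutator (weil_algebra H) (uword u)"])
      (auto simp: gcommutator_uword umult_uword intro!: clinear_sub clinear_scale clinear_umult_left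
        clinear_umult_right clinear_gcommutator clinear_ident)
qed (intro clinear_gcommutator clinear_sub clinear_scale clinear_umult_left clinear_umult_right clinear_ident)+

lemma weil_comp_range_word: "word_degree w = k \<Longrightarrow> weil_word w \<in> range (weil_comp k)"
  by (metis rangeI weil_comp_word)

lemma csubspace_weil_comp: "csubspace (range (weil_comp k))"
  unfolding range_weil_comp by (rule csubspace_cspan)

lemma weil_comp_range_iff: "x \<in> range (weil_comp k) \<longleftrightarrow> (0, x) \<in> degree_span k"
proof
  show "(0, x) \<in> degree_span k" if "x \<in> range (weil_comp k)"
    by (rule clinear_cspan[OF clinear_Pair0[OF clinear_ident] csubspace_degree_span _ that[unfolded range_weil_comp]])
      (auto simp: Pair_weil_word intro: uword_degree_span)
  have "snd X \<in> range (weil_comp k)" if "X \<in> degree_span k" for X :: "complex \<times> 'a weil"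
    by (rule clinear_cspan[OF clinear_snd[OF clinear_ident] csubspace_weil_comp _ that[unfolded degree_span_def]])
      (auto simp: weil_comp_range_word)
  then show "x \<in> range (weil_comp k)" if "(0, x) \<in> degree_span k" using that by force
qed

lemma weil_comp_range_induct:
  assumes "x \<in> range (weil_comp k)" "clinear f" "csubspace T"
    "\<And>w. w \<noteq> [] \<Longrightarrow> word_degree w = k \<Longrightarrow> f (weil_word w) \<in> T"
  shows "f x \<in> T"
  by (rule clinear_cspan[OF assms(2,3) _ assms(1)[unfolded range_weil_comp]]) (use assms(4) in blast)

lemma csubspace_form_homog: "csubspace (form_homog R k)"
  unfolding form_homog_def by (rule csubspace_cspan)

lemma form_homog_word: "v \<noteq> [] \<Longrightarrow> word_degree u + word_degree v = k \<Longrightarrow>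
    uword u \<otimes>\<^sub>C weil_word v \<in> form_homog (weil_algebra H) k"
  unfolding form_homog_weil by (rule complex_vector.span_base) blast

lemma form_homog_pure:
  assumes "X \<in> degree_span k" "y \<in> range (weil_comp l)"
  shows "X \<otimes>\<^sub>C y \<in> form_homog (weil_algebra H) (k + l)"
  by (rule cbilinear_cspan[OF cbilinear_pure csubspace_form_homog _ assms[unfolded degree_span_def range_weil_comp]])
    (auto intro!: form_homog_word)

lemma form_homog_induct:
  assumes "z \<in> form_homog (weil_algebra H) k" "clinear f" "csubspace T"
    "\<And>u v. v \<noteq> [] \<Longrightarrow> word_degree u + word_degree v = k \<Longrightarrow> f (uword u \<otimes>\<^sub>C weil_word v) \<in> T"
  shows "f z \<in> T"
  by (rule clinear_cspan[OF assms(2,3) _ assms(1)[unfolded form_homog_weil]]) (use assms(4) in blast)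

lemma weil_t_degree: "x \<in> range (weil_comp k) \<Longrightarrow> weil_t x \<in> range (weil_comp k)"
proof (erule weil_comp_range_induct[OF _ clinear_weil_t csubspace_weil_comp])
  fix w :: "'a weil_gen list" assume "w \<noteq> []" "word_degree w = k"
  then show "weil_t (weil_word w) \<in> range (weil_comp k)"
    by (cases w) (auto simp: weil_t_word intro!: complex_vector.subspace_scale[OF csubspace_weil_comp] weil_comp_range_word)
qed

lemma weil_t_pow_degree: "x \<in> range (weil_comp k) \<Longrightarrow> (weil_t ^^ i) x \<in> range (weil_comp k)"
  by (induction i) (simp_all add: weil_t_degree)

lemma weil_to_form_degree: "x \<in> range (weil_comp k) \<Longrightarrow> weil_to_form x \<in> form_homog (weil_algebra H) k"
proof (erule weil_comp_range_induct[OF _ clinear_weil_to_form csubspace_form_homog])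
  fix w :: "'a weil_gen list" assume "w \<noteq> []" "word_degree w = k"
  then show "weil_to_form (weil_word w) \<in> form_homog (weil_algebra H) k"
    by (cases w) (auto simp: weil_to_form_word intro!: complex_vector.subspace_scale[OF csubspace_form_homog] form_homog_word)
qed

lemma form_to_weil_degree: "z \<in> form_homog (weil_algebra H) k \<Longrightarrow> form_to_weil z \<in> range (weil_comp k)"
  by (erule form_homog_induct[OF _ clinear_form_to_weil csubspace_weil_comp])
    (auto simp: form_to_weil_pure intro!: complex_vector.subspace_sum[OF csubspace_weil_comp] weil_t_pow_degree weil_comp_range_word)

lemma form_d_degree: "x \<in> range (weil_comp k) \<Longrightarrow> form_d x \<in> form_homog (weil_algebra H) k"
  using form_homog_pure[of "uword []" 0 x k H] uword_degree_span[of "[]" 0] by (simp add: form_d_def)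

lemma form_b_degree: "z \<in> form_homog (weil_algebra H) k \<Longrightarrow> form_b (weil_algebra H) z \<in> range (weil_comp k)"
  unfolding form_b_eq by (intro complex_vector.subspace_diff[OF csubspace_weil_comp] weil_t_degree form_to_weil_degree)

section \<open>The differentials\<close>

definition gen_linear :: "('h::complex_vector weil_gen \<Rightarrow> 'c::complex_vector) \<Rightarrow> bool" where
  "gen_linear D \<longleftrightarrow> clinear (\<lambda>h. D (Gen h)) \<and> clinear (\<lambda>h. D (Omega h))"

lemma gen_linearD: "gen_linear D \<Longrightarrow> G \<in> {Gen, Omega} \<Longrightarrow> clinear (\<lambda>h. D (G h))"
  by (auto simp: gen_linear_def)

lemma clinear_mult_word: "clinear f \<Longrightarrow> clinear (\<lambda>x. mult_word (f x) w)"
  unfolding mult_word_eq by (intro clinear_snd clinear_umult_left clinear_Pair0)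

lemma word_linear_mult_word: "word_linear (mult_word x)"
  unfolding mult_word_eq[abs_def]
  by (intro word_linear_comp[OF clinear_snd[OF clinear_umult_right[OF clinear_ident]]] word_linear_uword)

lemma word_linear_derivation:
  assumes "gen_linear D"
  shows "word_linear (weil_derivation_word D)"
proof (rule word_linearI)
  fix u v and G :: "'a \<Rightarrow> 'a weil_gen" assume G: "G \<in> {Gen, Omega}"
  show "clinear (\<lambda>h. weil_derivation_word D (u @ G h # v))"
  proof (induction u)
    case Nil
    have "clinear (\<lambda>h. koszul (gen_degree (G h)) *\<^sub>C (weil_word [G h] * weil_derivation_word D v))"
      using G clinear_scale[OF clinear_mult_left[OF word_linear_single[OF G]]] by auto
    then show ?case
      unfolding append_Nil weil_derivation_word.simps
      by (intro clinear_plus clinear_mult_word gen_linearD[OF assms G])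
  next
    case (Cons a u)
    then show ?case
      by (auto intro!: clinear_plus clinear_scale clinear_mult_right word_linearD[OF word_linear_mult_word G])
  qed
qed

lemma clinear_weil_derivation: "gen_linear D \<Longrightarrow> clinear (weil_derivation D)"
  unfolding weil_derivation_def by (rule clinear_weil_lift[OF word_linear_derivation])

lemma weil_derivation_word: "gen_linear D \<Longrightarrow> weil_derivation D (weil_word w) = weil_derivation_word D w"
  unfolding weil_derivation_def
  using weil_lift_word'[OF word_linear_derivation] clinear_0[OF clinear_weil_lift[OF word_linear_derivation]]
  by (cases "w = []") simp_all

lemma clinear_uword_letters:
  assumes "G \<in> {Gen, Omega}"
  shows "clinear (\<lambda>x. uword [G x])" "clinear (\<lambda>x. uword [G x, b])" "clinear (\<lambda>x. uword [a, G x])"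
    "clinear (\<lambda>x. uword [G x, b, c])" "clinear (\<lambda>x. uword [a, G x, c])" "clinear (\<lambda>x. uword [a, b, G x])"
  using word_linearD[OF word_linear_uword assms, of "[]" "[]"] word_linearD[OF word_linear_uword assms, of "[]" "[b]"]
    word_linearD[OF word_linear_uword assms, of "[a]" "[]"] word_linearD[OF word_linear_uword assms, of "[]" "[b, c]"]
    word_linearD[OF word_linear_uword assms, of "[a]" "[c]"] word_linearD[OF word_linear_uword assms, of "[a, b]" "[]"]
  by simp_all

context hopf_algebra
begin

lemma cbilinear_uword_pair: "F \<in> {Gen, Omega} \<Longrightarrow> G \<in> {Gen, Omega} \<Longrightarrow> cbilinear (\<lambda>x y. uword [F x, G y])"
  by (intro cbilinearI clinear_uword_letters)

lemma cbilinear_word_pair: "F \<in> {Gen, Omega} \<Longrightarrow> G \<in> {Gen, Omega} \<Longrightarrow> cbilinear (\<lambda>x y. weil_word [F x, G y])"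
  using clinear_snd[OF clinear_uword_letters(2)] clinear_snd[OF clinear_uword_letters(3)] by (intro cbilinearI) simp_all

lemma gen_linear_diff: "gen_linear (weil_diff_gen H)" "gen_linear (weil_diff0_gen H)"
  unfolding gen_linear_def weil_diff_gen.simps weil_diff0_gen.simps
  by (intro conjI clinear_sub clinear_uminus word_linear_single clinear_sweedler cbilinear_word_pair clinear_ident; simp)+

definition udiff_gen where "udiff_gen a = (0 :: complex, weil_diff_gen H a)"
definition udiff0_gen where "udiff0_gen a = (0 :: complex, weil_diff0_gen H a)"

lemma Pair0_sweedler: "(0, sweedler H h (\<lambda>x y. weil_word [F x, G y])) = sweedler H h (\<lambda>x y. uword [F x, G y])"
  using tensor_lift_commute[OF clinear_Pair0[OF clinear_ident], of "\<lambda>x y. weil_word [F x, G y]" "comult H h"]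
  by (simp add: Pair_weil_word)

lemma Pair0_diff: "(0, x - y) = (0, x) - ((0, y) :: complex \<times> 'a::ab_group_add)"
  and Pair0_minus: "(0, - x) = - ((0, x) :: complex \<times> 'a::ab_group_add)"
  by simp_all

lemma udiff_gen_simps:
  "udiff_gen (Gen h) = uword [Omega h] - sweedler H h (\<lambda>x y. uword [Gen x, Gen y])"
  "udiff_gen (Omega h) = sweedler H h (\<lambda>x y. uword [Omega x, Gen y]) - sweedler H h (\<lambda>x y. uword [Gen x, Omega y])"
  "udiff0_gen (Gen h) = - sweedler H h (\<lambda>x y. uword [Gen x, Gen y])"
  "udiff0_gen (Omega h) = sweedler H h (\<lambda>x y. uword [Omega x, Gen y]) - sweedler H h (\<lambda>x y. uword [Gen x, Omega y])"
  unfolding udiff_gen_def udiff0_gen_def weil_diff_gen.simps weil_diff0_gen.simps Pair0_diff Pair0_minus Pair0_sweedler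
  by (simp_all add: Pair_weil_word)

lemma clinear_weil_diff: "clinear (weil_diff H)"
  unfolding weil_diff_def by (rule clinear_weil_derivation[OF gen_linear_diff(1)])

section \<open>The Weil differential as an odd derivation of square zero\<close>

abbreviation ud where "ud \<equiv> udiff (weil_algebra H)"
abbreviation us where "us \<equiv> usign (weil_algebra H)"

lemma clinear_ud: "clinear ud"
  unfolding udiff_def weil_algebra_simps by (intro clinear_Pair0 clinear_comp[OF clinear_weil_diff] clinear_snd clinear_ident)

lemma ud_Pair0: "ud (0, x) = (0, weil_diff H x)"
  by (simp add: udiff_def)

lemma ud_one: "ud (1, 0) = 0"
  by (simp add: udiff_def clinear_0[OF clinear_weil_diff] zero_prod_def)

lemma ud_uword_Cons: "ud (uword (a # w)) = umult (udiff_gen a) (uword w) + koszul (gen_degree a) *\<^sub>C umult (uword [a]) (ud (uword w))"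
proof -
  have 1: "umult (udiff_gen a) (uword w) = (0, mult_word (weil_diff_gen H a) w)"
    by (simp add: mult_word_eq udiff_gen_def umult_def uword_def)
  have 2: "ud (uword v) = (0, weil_derivation_word (weil_diff_gen H) v)" for v
    by (simp add: udiff_def weil_diff_def weil_derivation_word[OF gen_linear_diff(1)])
  show ?thesis unfolding 1 2 by (simp add: uword_def umult_Pair0 scaleC_prod_def)
qed

lemma ud_single: "ud (uword [a]) = udiff_gen a"
  by (simp add: ud_uword_Cons ud_one umult_simps)

lemma ud_umult_single: "ud (umult (uword [a]) X) = umult (udiff_gen a) X + koszul (gen_degree a) *\<^sub>C umult (uword [a]) (ud X)"
proof (rule uword_eqI[of "\<lambda>X. ud (umult (uword [a]) X)"])
  show "ud (umult (uword [a]) (uword x)) = umult (udiff_gen a) (uword x) + koszul (gen_degree a) *\<^sub>C umult (uword [a]) (ud (uword x))" for x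
    by (simp add: umult_uword ud_uword_Cons)
qed (intro clinear_comp[OF clinear_ud] clinear_plus clinear_scale clinear_umult_right clinear_ud clinear_ident)+

lemma ud_umult: "ud (umult X Y) = umult (ud X) Y + umult (us X) (ud Y)"
proof (rule uword_eqI[of "\<lambda>X. ud (umult X Y)"])
  fix x
  show "ud (umult (uword x) Y) = umult (ud (uword x)) Y + umult (us (uword x)) (ud Y)"
  proof (induction x)
    case Nil show ?case by (simp add: ud_one usign_one umult_simps)
  next
    case (Cons a x)
    have e: "uword (a # x) = umult (uword [a]) (uword x)" by (simp add: umult_uword)
    have "ud (umult (uword (a # x)) Y) = ud (umult (uword [a]) (umult (uword x) Y))"
      by (simp add: e umult_assoc)
    also have "\<dots> = umult (ud (uword (a # x))) Y + umult (us (uword (a # x))) (ud Y)"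
      unfolding ud_umult_single Cons.IH unfolding e ud_umult_single usign_umult
      by (simp add: umult_simps umult_assoc usign_uword scaleC_add_right)
    finally show ?case .
  qed
qed (intro clinear_comp[OF clinear_ud] clinear_plus clinear_umult_left clinear_ud clinear_usign clinear_ident)+

lemma udiff_gen_degree: "udiff_gen a \<in> degree_span (gen_degree a + 1)" "udiff0_gen a \<in> degree_span (gen_degree a + 1)"
  by (cases a; auto simp: udiff_gen_simps intro!: complex_vector.subspace_diff[OF csubspace_degree_span]
      complex_vector.subspace_neg[OF csubspace_degree_span] tensor_lift_in csubspace_degree_span uword_degree_span)+

lemma ud_degree: "X \<in> degree_span k \<Longrightarrow> ud X \<in> degree_span (k + 1)"
proof -
  assume X: "X \<in> degree_span k"
  have word: "ud (uword w) \<in> degree_span (word_degree w + 1)" for w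
  proof (induction w)
    case Nil show ?case by (simp add: ud_one complex_vector.subspace_0[OF csubspace_degree_span])
  next
    case (Cons a w)
    have "umult (udiff_gen a) (uword w) \<in> degree_span ((gen_degree a + 1) + word_degree w)"
      by (intro umult_degree_span udiff_gen_degree uword_degree_span refl)
    moreover have "umult (uword [a]) (ud (uword w)) \<in> degree_span (gen_degree a + (word_degree w + 1))"
      by (intro umult_degree_span Cons uword_degree_span) simp
    ultimately show ?case
      unfolding ud_uword_Cons
      by (intro complex_vector.subspace_add[OF csubspace_degree_span] complex_vector.subspace_scale[OF csubspace_degree_span])
       (simp_all add: algebra_simps)
  qed
  show ?thesis
    by (rule clinear_cspan[OF clinear_ud csubspace_degree_span _ X[unfolded degree_span_def]])
      (use word in blast)
qed

text \<open>\<open>ud\<close> changes the parity of the degree while \<open>us\<close> is the sign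
  of the parity, hence the two anticommute.\<close>

lemma ud_us: "ud (us X) = - us (ud X)"
proof (rule uword_eqI[of "\<lambda>X. ud (us X)"])
  fix x
  have "us (ud (uword x)) = koszul (word_degree x + 1) *\<^sub>C ud (uword x)"
    by (intro usign_degree_span ud_degree uword_degree_span refl)
  then show "ud (us (uword x)) = - us (ud (uword x))"
    by (simp add: usign_uword clinear_scaleC[OF clinear_ud] koszul_def)
qed (intro clinear_comp[OF clinear_ud] clinear_uminus clinear_comp[OF clinear_usign] clinear_ud clinear_usign clinear_ident)+

lemma ud_pair: "ud (uword [a, b]) = umult (udiff_gen a) (uword [b]) + koszul (gen_degree a) *\<^sub>C umult (uword [a]) (udiff_gen b)"
  by (simp add: ud_uword_Cons[of a "[b]"] ud_single)

text \<open>For \<open>Gen h\<close> the terms of \<partial> \<omega>_h cancel the quadratic terms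
  of \<partial>(h_0 h_1), and the two cubic sums agree by coassociativity. For
  \<open>Omega h\<close> the terms with two letters \<open>Omega\<close> cancel directly and the
  cubic ones again by coassociativity.\<close>

lemma ud_udiff_gen: "ud (udiff_gen a) = 0"
proof -
  note comm = tensor_lift_commute[OF clinear_umult_left[OF clinear_ident]]
    tensor_lift_commute[OF clinear_umult_right[OF clinear_ident]] tensor_lift_commute[OF clinear_ud]
  note simps = udiff_gen_simps clinear_diff[OF clinear_ud] comm ud_single ud_pair
    umult_simps umult_uword tensor_lift_plus tensor_lift_sub tensor_lift_uminus koszul_def
  have co: "sweedler H h (\<lambda>a b. sweedler H a (\<lambda>x y. uword [F x, G y, K b])) =
      sweedler H h (\<lambda>a b. sweedler H b (\<lambda>x y. uword [F a, G x, K y]))"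
    if "F \<in> {Gen, Omega}" "G \<in> {Gen, Omega}" "K \<in> {Gen, Omega}" for F G K h
    by (rule sweedler_coassoc) (intro clinear_uword_letters that)+
  show ?thesis
    by (cases a) (simp_all add: simps co)
qed

text \<open>The square of an odd derivation is a derivation, the cross terms having opposite signs;
  hence vanishing on generators suffices.\<close>

lemma ud_ud: "ud (ud X) = 0"
proof (rule uword_eqI[of "\<lambda>X. ud (ud X)"])
  fix x
  show "ud (ud (uword x)) = 0"
  proof (induction x)
    case Nil show ?case by (simp add: ud_one clinear_0[OF clinear_ud])
  next
    case (Cons a x)
    have "us (udiff_gen a) = - koszul (gen_degree a) *\<^sub>C udiff_gen a"
      using usign_degree_span[OF udiff_gen_degree(1), of H a] by (simp add: koszul_def)
    then show ?case
      unfolding ud_uword_Cons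
      by (simp add: clinear_add[OF clinear_ud] clinear_scaleC[OF clinear_ud] ud_umult[of "udiff_gen a"]
        ud_umult_single ud_udiff_gen Cons umult_simps clinear_minus[OF clinear_umult_left[OF clinear_ident]])
  qed
qed (intro clinear_comp[OF clinear_ud] clinear_ud clinear_const0)+

lemma weil_diff_diff: "weil_diff H (weil_diff H x) = 0"
  using ud_ud[of "(0, x)"] by (simp add: ud_Pair0 zero_prod_def)

section \<open>Compatibility of the differential with action, grading and filtration\<close>

lemma uw_act_pair:
  assumes "F \<in> {Gen, Omega}" "G \<in> {Gen, Omega}"
  shows "uw_act g (sweedler H h (\<lambda>x y. uword [F x, G y])) = sweedler H (g * h) (\<lambda>x y. uword [F x, G y])"
proof -
  note f = cbilinear_uword_pair[OF assms]
  have "uw_act g (sweedler H h (\<lambda>x y. uword [F x, G y])) =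
      sweedler H h (\<lambda>x y. sweedler H g (\<lambda>a b. uword [F (a * x), G (b * y)]))"
    using assms by (auto simp: tensor_lift_commute[OF clinear_act(4)[OF clinear_ident]] uw_act_Cons[of _ _ "[_]"]
      uw_act_single umult_uword)
  also have "\<dots> = sweedler H g (\<lambda>a b. sweedler H h (\<lambda>x y. uword [F (a * x), G (b * y)]))"
    by (rule tensor_lift_swap)
  also have "\<dots> = sweedler H (g * h) (\<lambda>x y. uword [F x, G y])"
    by (simp add: comult_mult tensor_lift_commute[OF clinear_tensor_lift[OF f]] tensor_lift_pure[OF f])
  finally show ?thesis .
qed

lemma udiff_gen_act: "udiff_gen (gen_act g a) = uw_act g (udiff_gen a)" "udiff0_gen (gen_act g a) = uw_act g (udiff0_gen a)"
  by (cases a; simp add: udiff_gen_simps clinear_diff[OF clinear_act(4)[OF clinear_ident]]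
      clinear_minus[OF clinear_act(4)[OF clinear_ident]] uw_act_pair uw_act_single)+

lemma ud_act: "ud (uw_act g X) = uw_act g (ud X)"
proof (rule uword_eqI[of "\<lambda>X. ud (uw_act g X)"])
  fix x
  show "ud (uw_act g (uword x)) = uw_act g (ud (uword x))"
  proof (induction x arbitrary: g)
    case Nil
    have "ud (c, 0) = 0" for c by (simp add: udiff_def clinear_0[OF clinear_weil_diff] zero_prod_def)
    then show ?case by (simp add: ud_one uw_act_one clinear_0[OF clinear_act(4)[OF clinear_ident]])
  next
    case (Cons a x)
    have "uw_act g (umult (uword [a]) (ud (uword x))) =
        sweedler H g (\<lambda>g0 g1. umult (uword [gen_act g0 a]) (uw_act g1 (ud (uword x))))"
      by (simp add: uw_act_umult uw_act_single)
    then show ?case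
      by (simp add: uw_act_Cons[of _ a x] tensor_lift_commute[OF clinear_ud] ud_umult_single udiff_gen_act Cons
        ud_uword_Cons clinear_add[OF clinear_act(4)[OF clinear_ident]] clinear_scaleC[OF clinear_act(4)[OF clinear_ident]]
        uw_act_umult[of g "udiff_gen a"] tensor_lift_plus tensor_lift_scale)
  qed
qed (intro clinear_comp[OF clinear_ud] clinear_act clinear_ud clinear_ident)+

lemma weil_diff_act: "weil_diff H (weil_act H g x) = weil_act H g (weil_diff H x)"
  using ud_act[of g "(0, x)"] by (simp add: uw_act_Pair0 ud_Pair0)

lemma weil_diff_coinv: "x \<in> coinv \<delta> (weil_act H) \<Longrightarrow> weil_diff H x \<in> coinv \<delta> (weil_act H)"
  by (erule clinear_coinv[OF clinear_weil_diff csubspace_coinv, rotated])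
    (simp add: clinear_diff[OF clinear_weil_diff] clinear_scaleC[OF clinear_weil_diff] weil_diff_act coinv_base)

lemma weil_diff_degree: "x \<in> range (weil_comp k) \<Longrightarrow> weil_diff H x \<in> range (weil_comp (k + 1))"
  using ud_degree[of "(0, x)" k] by (simp add: weil_comp_range_iff ud_Pair0)

text \<open>The same span as in \<open>ideal_power_weil\<close>, hence
  \<open>ideal_power weil_ideal k\<close>; working in the unitization lets the tail of a word be
  empty.\<close>

definition ufilt :: "nat \<Rightarrow> (complex \<times> 'h weil) set" where
  "ufilt k = cspan {uword w | w. k \<le> omega_count w}"

lemma csubspace_ufilt: "csubspace (ufilt k)"
  unfolding ufilt_def by (rule csubspace_cspan)

lemma uword_ufilt: "k \<le> omega_count w \<Longrightarrow> uword w \<in> ufilt k"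
  unfolding ufilt_def by (rule complex_vector.span_base) blast

lemma umult_ufilt: "X \<in> ufilt k \<Longrightarrow> Y \<in> ufilt l \<Longrightarrow> umult X Y \<in> ufilt (k + l)"
  unfolding ufilt_def[of k] ufilt_def[of l]
  by (erule (1) cbilinear_cspan[OF cbilinear_umult csubspace_ufilt, rotated])
    (auto simp: umult_uword intro!: uword_ufilt)

lemma snd_ufilt: "X \<in> ufilt k \<Longrightarrow> snd X \<in> weil_filt k"
  unfolding ufilt_def
  by (erule clinear_cspan[OF clinear_snd[OF clinear_ident] csubspace_weil_filt, rotated])
    (auto intro: weil_filt_word)

text \<open>Only the summand \<open>Omega h\<close> in the differential of \<open>Gen h\<close>
  changes the number of letters \<open>Omega\<close>, and it raises it; so the differential
  preserves a filtration but not the count itself.\<close>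

lemma udiff_gen_filt: "udiff_gen a \<in> ufilt (omega_count [a])" "udiff0_gen a \<in> ufilt (omega_count [a])"
  by (cases a; auto simp: udiff_gen_simps intro!: complex_vector.subspace_diff[OF csubspace_ufilt]
      complex_vector.subspace_neg[OF csubspace_ufilt] tensor_lift_in csubspace_ufilt uword_ufilt)+

lemma ud_filt_word: "ud (uword w) \<in> ufilt (omega_count w)"
proof (induction w)
  case Nil show ?case by (simp add: ud_one complex_vector.subspace_0[OF csubspace_ufilt])
next
  case (Cons a w)
  then show ?case
    unfolding ud_uword_Cons omega_count_Cons[of a w]
    by (intro complex_vector.subspace_add[OF csubspace_ufilt] complex_vector.subspace_scale[OF csubspace_ufilt]
      umult_ufilt udiff_gen_filt uword_ufilt order_refl)
qed

lemma weil_filt_mono: "k \<le> l \<Longrightarrow> weil_filt l \<subseteq> weil_filt k"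
  unfolding weil_filt_def by (rule complex_vector.span_mono) auto

lemma weil_diff_filt: "x \<in> weil_filt k \<Longrightarrow> weil_diff H x \<in> weil_filt k"
proof (erule weil_filt_induct[OF _ clinear_weil_diff csubspace_weil_filt])
  fix w :: "'h weil_gen list" assume "w \<noteq> []" "k \<le> omega_count w"
  then show "weil_diff H (weil_word w) \<in> weil_filt k"
    using snd_ufilt[OF ud_filt_word[of w]] weil_filt_mono[of k "omega_count w"] by (auto simp: udiff_def)
qed

section \<open>The differential b\<close>

text \<open>The part of b_t before the rotation: \<partial>_0 on the first letter only. This map is
  equivariant, while \<open>t\<close> need not be; the factorization reduces properties of
  \<open>b\<close> to those already known for \<open>t\<close>.\<close>

definition weil_d0_first :: "'h weil \<Rightarrow> 'h weil" where
  "weil_d0_first = weil_lift (\<lambda>w. case w of [] \<Rightarrow> 0 | a # x \<Rightarrow> mult_word (weil_diff0_gen H a) x)"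

lemma weil_diff0_single: "weil_diff0 H (weil_word [a]) = weil_diff0_gen H a"
  by (simp add: weil_diff0_def weil_derivation_word[OF gen_linear_diff(2)] mult_word_def)

lemma word_linear_d0_first: "word_linear (\<lambda>w. case w of [] \<Rightarrow> 0 | a # x \<Rightarrow> mult_word (weil_diff0_gen H a) x)"
  by (rule word_linear_Cons, intro clinear_mult_word gen_linearD[OF gen_linear_diff(2)], assumption,
      rule word_linear_mult_word)

lemma clinear_d0_first: "clinear weil_d0_first"
  unfolding weil_d0_first_def by (rule clinear_weil_lift[OF word_linear_d0_first])

lemma d0_first_word: "weil_d0_first (weil_word (a # x)) = snd (umult (udiff0_gen a) (uword x))"
  unfolding weil_d0_first_def by (simp add: weil_lift_word'[OF word_linear_d0_first] mult_word_eq udiff0_gen_def)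

lemma weil_b_t_eq: "weil_b_t H x = weil_t (weil_d0_first x)"
proof -
  have e: "(\<lambda>w. case w of [] \<Rightarrow> 0 | a # x \<Rightarrow> weil_t (mult_word (weil_diff0 H (weil_word [a])) x)) =
      (\<lambda>w. weil_t (case w of [] \<Rightarrow> 0 | a # x \<Rightarrow> mult_word (weil_diff0_gen H a) x))"
    by (auto simp: fun_eq_iff weil_diff0_single clinear_0[OF clinear_weil_t] split: list.split)
  show ?thesis
    unfolding weil_b_t_def e weil_d0_first_def weil_lift_def by (simp add: free_lift_commute[OF clinear_weil_t])
qed

lemma clinear_weil_b: "clinear (weil_b H)"
  unfolding weil_b_def[abs_def] weil_b_t_eq
  by (intro clinear_plus clinear_weil_diff clinear_comp[OF clinear_weil_t clinear_d0_first])

text \<open>The first letter receives the first Sweedler factor and \<partial>_0 is equivariant on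
  generators, while the rest of the word is left alone.\<close>

lemma d0_first_act: "weil_d0_first (weil_act H g x) = weil_act H g (weil_d0_first x)"
proof (rule weil_eqI[of "\<lambda>x. weil_d0_first (weil_act H g x)"])
  fix w :: "'h weil_gen list" assume "w \<noteq> []"
  then obtain a x where w: "w = a # x" by (cases w) auto
  have L: "clinear (\<lambda>z. weil_d0_first (snd z))"
    by (intro clinear_comp[OF clinear_d0_first] clinear_snd clinear_ident)
  have e: "weil_d0_first (snd (umult (uword [c]) X)) = snd (umult (udiff0_gen c) X)" for c X
    by (rule uword_eqI[of "\<lambda>X. weil_d0_first (snd (umult (uword [c]) X))"])
      (simp_all add: umult_uword d0_first_word clinear_snd[OF clinear_umult_right[OF clinear_ident]]
        clinear_comp[OF L clinear_umult_right[OF clinear_ident]])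
  have "weil_d0_first (weil_act H g (weil_word w)) = weil_d0_first (snd (uw_act g (uword (a # x))))"
    by (simp add: w uword_def uw_act_Pair0)
  also have "\<dots> = snd (uw_act g (umult (udiff0_gen a) (uword x)))"
    by (simp add: uw_act_Cons tensor_lift_commute[OF clinear_d0_first] e udiff_gen_act uw_act_umult
      tensor_lift_commute[OF clinear_snd[OF clinear_ident]])
  also have "\<dots> = weil_act H g (weil_d0_first (weil_word w))"
    by (simp add: w d0_first_word uact_def)
  finally show "weil_d0_first (weil_act H g (weil_word w)) = weil_act H g (weil_d0_first (weil_word w))" .
qed (intro clinear_comp[OF clinear_d0_first clinear_weil_act] clinear_comp[OF clinear_weil_act clinear_d0_first])+

lemma d0_first_coinv: "x \<in> coinv \<delta> (weil_act H) \<Longrightarrow> weil_d0_first x \<in> coinv \<delta> (weil_act H)"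
  by (erule clinear_coinv[OF clinear_d0_first csubspace_coinv, rotated])
    (simp add: clinear_diff[OF clinear_d0_first] clinear_scaleC[OF clinear_d0_first] d0_first_act coinv_base)

lemma d0_first_filt: "x \<in> weil_filt k \<Longrightarrow> weil_d0_first x \<in> weil_filt k"
proof (erule weil_filt_induct[OF _ clinear_d0_first csubspace_weil_filt])
  fix w :: "'h weil_gen list" assume w: "w \<noteq> []" "k \<le> omega_count w"
  then obtain a x where ax: "w = a # x" by (cases w) auto
  have "umult (udiff0_gen a) (uword x) \<in> ufilt (omega_count w)"
    unfolding ax omega_count_Cons[of a x] by (intro umult_ufilt udiff_gen_filt uword_ufilt order_refl)
  then show "weil_d0_first (weil_word w) \<in> weil_filt k"
    using subsetD[OF weil_filt_mono[OF w(2)] snd_ufilt] by (simp add: ax d0_first_word)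
qed

lemma weil_b_filt: "x \<in> weil_filt k \<Longrightarrow> weil_b H x \<in> weil_filt k"
  unfolding weil_b_def weil_b_t_eq
  by (intro complex_vector.subspace_add[OF csubspace_weil_filt] weil_diff_filt weil_t_filt d0_first_filt)

lemma weil_b_degree: "x \<in> range (weil_comp k) \<Longrightarrow> weil_b H x \<in> range (weil_comp (k + 1))"
proof -
  assume x: "x \<in> range (weil_comp k)"
  have "weil_d0_first x \<in> range (weil_comp (k + 1))"
  proof (rule weil_comp_range_induct[OF x clinear_d0_first csubspace_weil_comp])
    fix w :: "'h weil_gen list" assume w: "w \<noteq> []" "word_degree w = k"
    then obtain a y where ay: "w = a # y" by (cases w) auto
    have "umult (udiff0_gen a) (uword y) \<in> degree_span ((gen_degree a + 1) + word_degree y)"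
      by (intro umult_degree_span udiff_gen_degree uword_degree_span refl)
    moreover have "umult (udiff0_gen a) (uword y) = (0, snd (umult (udiff0_gen a) (uword y)))"
      by (simp add: umult_def udiff0_gen_def)
    moreover have "(gen_degree a + 1) + word_degree y = k + 1" using w ay by simp
    ultimately show "weil_d0_first (weil_word w) \<in> range (weil_comp (k + 1))"
      by (simp add: ay d0_first_word weil_comp_range_iff)
  qed
  then show ?thesis
    unfolding weil_b_def weil_b_t_eq
    by (intro complex_vector.subspace_add[OF csubspace_weil_comp] weil_diff_degree x weil_t_degree)
qed

section \<open>The differential on one-forms\<close>

abbreviation fdiff where "fdiff \<equiv> form_diff (weil_algebra H)"

lemma cbilinear_form_diff_aux: "cbilinear (\<lambda>x y. ud x \<otimes>\<^sub>C y + us x \<otimes>\<^sub>C weil_diff H y)"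
  by (intro cbilinearI clinear_plus clinear_pure_left clinear_pure_right clinear_ud clinear_usign clinear_weil_diff clinear_ident)

lemma fdiff_pure: "fdiff (x \<otimes>\<^sub>C y) = ud x \<otimes>\<^sub>C y + us x \<otimes>\<^sub>C weil_diff H y"
  unfolding form_diff_def weil_algebra_simps by (rule tensor_lift_pure[OF cbilinear_form_diff_aux])

lemma clinear_fdiff: "clinear fdiff"
  unfolding form_diff_def weil_algebra_simps by (rule clinear_tensor_lift[OF cbilinear_form_diff_aux])

lemma fdiff_fdiff: "fdiff (fdiff z) = 0"
  by (rule tensor_eqI[of "\<lambda>z. fdiff (fdiff z)"])
    (auto simp: fdiff_pure clinear_add[OF clinear_fdiff] ud_ud ud_us weil_diff_diff pure_simps
        clinear_minus[OF clinear_pure_left[OF clinear_ident]]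
      intro: clinear_comp[OF clinear_fdiff clinear_fdiff] clinear_const0)

lemma fdiff_form_d: "fdiff (form_d x) = form_d (weil_diff H x)"
  by (simp add: form_d_def fdiff_pure ud_one usign_one pure_simps)

text \<open>An odd derivation is compatible with graded commutators: each Leibniz term raises the
  degree of one argument by one, and the Koszul signs adapt accordingly.\<close>

lemma form_b_fdiff: "form_b (weil_algebra H) (fdiff z) = weil_diff H (form_b (weil_algebra H) z)"
proof (rule forms_eqI[of "\<lambda>z. form_b (weil_algebra H) (fdiff z)"])
  fix u v :: "'h weil_gen list" assume v: "v \<noteq> []"
  let ?k = "word_degree u" and ?l = "word_degree v"
  have U: "uword u \<in> degree_span ?k" "ud (uword u) \<in> degree_span (?k + 1)"
    and V: "uword v \<in> degree_span ?l" "ud (uword v) \<in> degree_span (?l + 1)"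
    by (intro ud_degree uword_degree_span refl)+
  have dv: "(0, weil_diff H (weil_word v)) = ud (uword v)" by (simp add: udiff_def)
  have "form_b (weil_algebra H) (fdiff (uword u \<otimes>\<^sub>C weil_word v)) =
      snd (gcommutator (weil_algebra H) (ud (uword u)) (uword v) + koszul ?k *\<^sub>C gcommutator (weil_algebra H) (uword u) (ud (uword v)))"
    by (simp add: fdiff_pure clinear_add[OF clinear_form_b] usign_uword pure_simps clinear_scaleC[OF clinear_form_b]
      form_b_pure dv Pair_weil_word v snd_scaleC)
  also have "\<dots> = snd (ud (gcommutator (weil_algebra H) (uword u) (uword v)))"
    by (simp add: gcommutator_degree_span[OF U(2) V(1)] gcommutator_degree_span[OF U(1) V(2)]
      gcommutator_degree_span[OF U(1) V(1)] clinear_diff[OF clinear_ud] clinear_scaleC[OF clinear_ud] ud_umult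
      usign_uword umult_simps snd_scaleC scaleC_add_right complex_vector.scale_right_diff_distrib)
     (simp add: koszul_def)
  also have "\<dots> = weil_diff H (form_b (weil_algebra H) (uword u \<otimes>\<^sub>C weil_word v))"
    by (simp add: udiff_def form_b_pure Pair_weil_word v)
  finally show "form_b (weil_algebra H) (fdiff (uword u \<otimes>\<^sub>C weil_word v)) = weil_diff H (form_b (weil_algebra H) (uword u \<otimes>\<^sub>C weil_word v))" .
qed (intro clinear_comp[OF clinear_form_b clinear_fdiff] clinear_comp[OF clinear_weil_diff clinear_form_b])+

lemma fdiff_degree: "z \<in> form_homog (weil_algebra H) k \<Longrightarrow> fdiff z \<in> form_homog (weil_algebra H) (k + 1)"
proof (erule form_homog_induct[OF _ clinear_fdiff csubspace_form_homog])
  fix u v :: "'h weil_gen list" assume uv: "v \<noteq> []" "word_degree u + word_degree v = k"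
  have "ud (uword u) \<otimes>\<^sub>C weil_word v \<in> form_homog (weil_algebra H) ((word_degree u + 1) + word_degree v)"
    by (intro form_homog_pure ud_degree uword_degree_span weil_comp_range_word refl)
  moreover have "uword u \<otimes>\<^sub>C weil_diff H (weil_word v) \<in> form_homog (weil_algebra H) (word_degree u + (word_degree v + 1))"
    by (intro form_homog_pure weil_diff_degree uword_degree_span weil_comp_range_word refl)
  moreover have "(word_degree u + 1) + word_degree v = k + 1" "word_degree u + (word_degree v + 1) = k + 1"
    using uv by simp_all
  ultimately show "fdiff (uword u \<otimes>\<^sub>C weil_word v) \<in> form_homog (weil_algebra H) (k + 1)"
    by (simp add: fdiff_pure usign_uword pure_simps complex_vector.subspace_add[OF csubspace_form_homog]
      complex_vector.subspace_scale[OF csubspace_form_homog])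
qed

text \<open>\<open>snd (us (0, x))\<close> is the parity automorphism of W(H) itself, extracted from
  the unitization.\<close>

lemma weil_diff_mult: "weil_diff H (x * y) = weil_diff H x * y + snd (us (0, x)) * weil_diff H y"
proof -
  have e: "us (0, x) = (0, snd (us (0, x)))"
  proof -
    have "fst (us (0, x)) = 0"
      by (rule weil_eqI[OF clinear_fst[OF clinear_comp[OF clinear_usign clinear_Pair0[OF clinear_ident]]] clinear_const0])
        (simp add: Pair_weil_word usign_uword, simp add: uword_def scaleC_prod_def)
    then show ?thesis by (simp add: prod_eq_iff)
  qed
  have "(0, weil_diff H (x * y)) = ud (umult (0, x) (0, y))" by (simp add: umult_Pair0 ud_Pair0)
  also have "\<dots> = (0, weil_diff H x * y + snd (us (0, x)) * weil_diff H y)"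
    unfolding ud_umult by (subst e) (simp add: ud_Pair0 umult_Pair0)
  finally show ?thesis by simp
qed

text \<open>Leibniz rules hold for both module structures, so the differential of a commutator
  combines two commutators, of bidegrees (k + 1, l) and (k, l + 1).\<close>

lemma fdiff_commutators:
  assumes "z \<in> form_commutators (weil_algebra H)"
  shows "fdiff z \<in> form_commutators (weil_algebra H)"
proof (rule clinear_cspan[OF clinear_fdiff csubspace_form_commutators _ assms[unfolded form_commutators_weil]])
  fix s :: "'h weil forms" assume "s \<in> {word_commutator u v w |u v w. v \<noteq> [] \<and> w \<noteq> []}"
  then obtain u v w where s: "s = word_commutator u v w" and v: "v \<noteq> []" and w: "w \<noteq> []" by blast
  define z where "z = uword u \<otimes>\<^sub>C weil_word v"
  define a where "a = weil_word w"
  define k where "k = word_degree u + word_degree v"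
  define l where "l = word_degree w"
  let ?c = "\<lambda>z k a l. form_rmult z a - koszul (k * l) *\<^sub>C form_lmult a z"
  have comm: "?c z k a l \<in> form_commutators (weil_algebra H)"
    if "z \<in> form_homog (weil_algebra H) k" "a \<in> range (weil_comp l)" for z a k l
    unfolding form_commutators_def weil_algebra_simps
    by (rule complex_vector.span_base) (use that in blast)
  have z: "z \<in> form_homog (weil_algebra H) k" and a: "a \<in> range (weil_comp l)"
    using v by (auto simp: z_def a_def k_def l_def intro!: form_homog_word weil_comp_range_word)
  have se: "snd (us (0, weil_word x)) = koszul (word_degree x) *\<^sub>C weil_word x" for x
    by (cases "x = []") (simp_all add: Pair_weil_word usign_uword scaleC_prod_def clinear_0[OF clinear_usign] flip: zero_prod_def)
  have dv: "(0, weil_diff H (weil_word x)) = ud (uword x)" for x by (simp add: udiff_def)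
  have r: "fdiff (form_rmult z a) = form_rmult (fdiff z) a + koszul k *\<^sub>C form_rmult z (weil_diff H a)"
    by (simp add: z_def a_def form_rmult_pure fdiff_pure clinear_diff[OF clinear_fdiff]
      clinear_add[OF clinear_form_rmult(1)[OF clinear_ident]] clinear_scaleC[OF clinear_form_rmult(1)[OF clinear_ident]]
      weil_diff_mult se usign_uword pure_simps Pair_weil_word v ud_umult usign_umult umult_simps dv
      scaleC_add_right complex_vector.scale_right_diff_distrib k_def snd_scaleC mult.commute flip: koszul_mult)
  have l: "fdiff (form_lmult a z) = form_lmult (weil_diff H a) z + koszul l *\<^sub>C form_lmult a (fdiff z)"
    by (simp add: z_def a_def form_lmult_pure fdiff_pure
      clinear_add[OF clinear_form_lmult(2)[OF clinear_ident]] clinear_scaleC[OF clinear_form_lmult(2)[OF clinear_ident]]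
      usign_uword pure_simps Pair_weil_word w ud_umult usign_umult umult_simps dv
      scaleC_add_right l_def)
  have "fdiff s = ?c (fdiff z) (k + 1) a l + koszul k *\<^sub>C ?c z k (weil_diff H a) (l + 1)"
    unfolding s word_commutator_eq[OF v w, symmetric] z_def[symmetric] a_def[symmetric] k_def[symmetric] l_def[symmetric]
    by (simp add: clinear_diff[OF clinear_fdiff] clinear_scaleC[OF clinear_fdiff] r l scaleC_add_right
      complex_vector.scale_right_diff_distrib koszul_mult distrib_left distrib_right)
     (simp add: koszul_def)
  then show "fdiff s \<in> form_commutators (weil_algebra H)"
    using comm[OF fdiff_degree[OF z] a] comm[OF z weil_diff_degree[OF a]]
    by (simp add: complex_vector.subspace_add[OF csubspace_form_commutators]
      complex_vector.subspace_scale[OF csubspace_form_commutators])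
qed

lemma weil_to_form_umult_single:
  assumes "X \<in> degree_span k"
  shows "weil_to_form (snd (umult (uword [a]) X)) = koszul (gen_degree a * k) *\<^sub>C (X \<otimes>\<^sub>C weil_word [a])"
proof (rule degree_span_eqI[OF assms])
  show "clinear (\<lambda>X. weil_to_form (snd (umult (uword [a]) X)))"
    by (rule clinear_comp[OF clinear_weil_to_form clinear_snd[OF clinear_umult_right[OF clinear_ident]]])
  show "clinear (\<lambda>X. koszul (gen_degree a * k) *\<^sub>C (X \<otimes>\<^sub>C weil_word [a]))"
    by (intro clinear_scale clinear_pure_left clinear_ident)
qed (simp add: umult_uword weil_to_form_word)

text \<open>The quadratic part of \<open>\<partial> a\<close> contributes \<open>x d(u v) = x du v + x u dv\<close> to the differential of \<open>x da\<close>;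
  the two summands correspond to \<open>u v x\<close> and to its rotation, hence the term \<open>b\<^sub>t\<close>.\<close>

lemma weil_to_form_two_letters:
  assumes "Y \<in> cspan {uword v | v. length v = 2 \<and> word_degree v = k}"
  shows "weil_to_form (snd (umult Y (uword x)) + weil_t (snd (umult Y (uword x))))
      - koszul (k * word_degree x) *\<^sub>C (uword x \<otimes>\<^sub>C snd Y) \<in> form_commutators (weil_algebra H)"
proof (rule clinear_cspan[of "\<lambda>Y. weil_to_form (snd (umult Y (uword x)) + weil_t (snd (umult Y (uword x))))
      - koszul (k * word_degree x) *\<^sub>C (uword x \<otimes>\<^sub>C snd Y)", OF _ csubspace_form_commutators _ assms])
  note L = clinear_snd[OF clinear_umult_left[OF clinear_ident]]
  show "clinear (\<lambda>Y. weil_to_form (snd (umult Y (uword x)) + weil_t (snd (umult Y (uword x))))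
      - koszul (k * word_degree x) *\<^sub>C (uword x \<otimes>\<^sub>C snd Y))"
    by (rule clinear_sub[OF clinear_comp[OF clinear_weil_to_form clinear_plus[OF L clinear_comp[OF clinear_weil_t L]]]
      clinear_scale[OF clinear_pure_right[OF clinear_snd[OF clinear_ident]]]])
  fix s :: "complex \<times> 'h weil" assume "s \<in> {uword v | v. length v = 2 \<and> word_degree v = k}"
  then obtain v where s: "s = uword v" and v: "length v = 2" "word_degree v = k" by blast
  have v0: "v \<noteq> []" using v by auto
  let ?z = "uword x \<otimes>\<^sub>C weil_word v" and ?k = "koszul (k * word_degree x)"
  have "form_to_weil ?z = ?k *\<^sub>C (weil_word (v @ x) + weil_t (weil_word (v @ x)))"
    using weil_t_pow_word[of x v] v
    by (simp add: form_to_weil_pure[OF v0] numeral_2_eq_2 mult.commute scaleC_add_right clinear_scaleC[OF clinear_weil_t])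
  then have "weil_to_form (weil_word (v @ x) + weil_t (weil_word (v @ x))) = ?k *\<^sub>C weil_to_form (form_to_weil ?z)"
    by (simp add: clinear_scaleC[OF clinear_weil_to_form])
  then have "weil_to_form (snd (umult s (uword x)) + weil_t (snd (umult s (uword x)))) - ?k *\<^sub>C (uword x \<otimes>\<^sub>C snd s)
      = ?k *\<^sub>C (weil_to_form (form_to_weil ?z) - ?z)"
    by (simp add: s umult_uword complex_vector.scale_right_diff_distrib)
  then show "weil_to_form (snd (umult s (uword x)) + weil_t (snd (umult s (uword x)))) - ?k *\<^sub>C (uword x \<otimes>\<^sub>C snd s)
      \<in> form_commutators (weil_algebra H)"
    by (simp only:) (intro complex_vector.subspace_scale[OF csubspace_form_commutators] weil_to_form_to_weil)
qed

text \<open>The terms differentiating \<open>x\<close> and the one-letter part of \<partial> a match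
  exactly. Only the quadratic part \<partial>_0 a leaves a commutator behind, controlled by
  \<open>weil_to_form_two_letters\<close>.\<close>

lemma fdiff_weil_to_form:
  "fdiff (weil_to_form x) - weil_to_form (weil_b H x) \<in> form_commutators (weil_algebra H)"
proof (rule clinear_cspan[of "\<lambda>x. fdiff (weil_to_form x) - weil_to_form (weil_b H x)", OF _ csubspace_form_commutators])
  show "clinear (\<lambda>x. fdiff (weil_to_form x) - weil_to_form (weil_b H x))"
    by (intro clinear_sub clinear_comp[OF clinear_fdiff clinear_weil_to_form] clinear_comp[OF clinear_weil_to_form clinear_weil_b])
  show "x \<in> cspan {weil_word w | w. w \<noteq> []}" by (simp add: weil_words_span)
  fix s :: "'h weil" assume "s \<in> {weil_word w | w. w \<noteq> []}"
  then obtain a x where s: "s = weil_word (a # x)" by (auto simp: neq_Nil_conv)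
  \<comment> \<open>The one-letter part of the differential: \<open>Omega h\<close> for
    \<open>Gen h\<close>, and 0 for \<open>Omega h\<close>. It yields a one-letter form at once and
    needs no rotated companion.\<close>
  define D1 where "D1 = udiff_gen a - udiff0_gen a"
  let ?A = "gen_degree a" and ?X = "word_degree x"
  have D: "udiff_gen a = D1 + udiff0_gen a" by (simp add: D1_def)
  have D1: "weil_to_form (snd (umult D1 (uword x))) = koszul ((?A + 1) * ?X) *\<^sub>C (uword x \<otimes>\<^sub>C snd D1)"
    by (cases a) (simp_all add: D1_def udiff_gen_simps umult_uword weil_to_form_word umult_simps pure_simps
        clinear_0[OF clinear_weil_to_form])
  have "udiff0_gen a \<in> cspan {uword v | v. length v = 2 \<and> word_degree v = ?A + 1}"
    by (cases a; simp add: udiff_gen_simps)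
      (intro complex_vector.span_diff complex_vector.span_neg tensor_lift_in csubspace_cspan complex_vector.span_base;
        force)+
  note D0 = weil_to_form_two_letters[OF this, of x]
  have dx: "ud (uword x) \<in> degree_span (?X + 1)" by (intro ud_degree uword_degree_span refl)
  have "weil_diff H s = snd (ud (uword (a # x)))" by (simp add: s udiff_def)
  also have "\<dots> = snd (umult D1 (uword x)) + snd (umult (udiff0_gen a) (uword x))
      + koszul ?A *\<^sub>C snd (umult (uword [a]) (ud (uword x)))"
    by (simp add: ud_uword_Cons D umult_simps snd_scaleC)
  finally have b: "weil_b H s = snd (umult D1 (uword x)) + koszul ?A *\<^sub>C snd (umult (uword [a]) (ud (uword x)))
      + (snd (umult (udiff0_gen a) (uword x)) + weil_t (snd (umult (udiff0_gen a) (uword x))))"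
    by (simp add: weil_b_def weil_b_t_eq s d0_first_word)
  have da: "weil_diff H (weil_word [a]) = snd D1 + snd (udiff0_gen a)"
    using ud_single[of a] D by (simp add: udiff_def prod_eq_iff)
  have k: "koszul (?A * ?X) * koszul ?X = koszul ((?A + 1) * ?X)" "koszul ?A * koszul (?A * (?X + 1)) = koszul (?A * ?X)"
    by (simp_all add: koszul_mult distrib_left distrib_right) (simp add: koszul_def)
  have "fdiff (weil_to_form s) = koszul (?A * ?X) *\<^sub>C (ud (uword x) \<otimes>\<^sub>C weil_word [a])
      + koszul ((?A + 1) * ?X) *\<^sub>C (uword x \<otimes>\<^sub>C snd D1) + koszul ((?A + 1) * ?X) *\<^sub>C (uword x \<otimes>\<^sub>C snd (udiff0_gen a))"
    by (simp add: s weil_to_form_word clinear_scaleC[OF clinear_fdiff] fdiff_pure usign_uword da pure_simps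
      scaleC_add_right add.assoc flip: k(1))
  moreover have "weil_to_form (weil_b H s) = koszul (?A * ?X) *\<^sub>C (ud (uword x) \<otimes>\<^sub>C weil_word [a])
      + koszul ((?A + 1) * ?X) *\<^sub>C (uword x \<otimes>\<^sub>C snd D1)
      + weil_to_form (snd (umult (udiff0_gen a) (uword x)) + weil_t (snd (umult (udiff0_gen a) (uword x))))"
    unfolding b clinear_add[OF clinear_weil_to_form, of "_ + _ *\<^sub>C _"]
    unfolding clinear_add[OF clinear_weil_to_form, of _ "_ *\<^sub>C _"] clinear_scaleC[OF clinear_weil_to_form] D1
      weil_to_form_umult_single[OF dx] scaleC_scaleC k(2) by (simp add: add.commute)
  ultimately have "fdiff (weil_to_form s) - weil_to_form (weil_b H s) =
    - (weil_to_form (snd (umult (udiff0_gen a) (uword x)) + weil_t (snd (umult (udiff0_gen a) (uword x))))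
      - koszul ((?A + 1) * ?X) *\<^sub>C (uword x \<otimes>\<^sub>C snd (udiff0_gen a)))"
    by simp
  then show "fdiff (weil_to_form s) - weil_to_form (weil_b H s) \<in> form_commutators (weil_algebra H)"
    by (simp only:) (intro complex_vector.subspace_neg[OF csubspace_form_commutators] D0)
qed

text \<open>Since \<open>form_to_weil\<close> kills commutators, the congruence becomes an equation;
  the identities for \<open>b\<close> deduced from it hold in W(H) itself, before any
  quotient.\<close>

lemma form_to_weil_fdiff_to_form: "form_to_weil (fdiff (weil_to_form x)) = weil_b H x"
  using form_to_weil_commutators[OF fdiff_weil_to_form[of x]]
  by (simp add: clinear_diff[OF clinear_form_to_weil] form_to_weil_to_form)

lemma form_to_weil_fdiff: "form_to_weil (fdiff z) = weil_b H (form_to_weil z)"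
  using form_to_weil_commutators[OF fdiff_commutators[OF weil_to_form_to_weil[of z]]]
  by (simp add: clinear_diff[OF clinear_form_to_weil] clinear_diff[OF clinear_fdiff] form_to_weil_fdiff_to_form)

lemma weil_b_b: "weil_b H (weil_b H x) = 0"
  by (metis fdiff_fdiff form_to_weil_fdiff form_to_weil_to_form clinear_0[OF clinear_form_to_weil])

lemma weil_b_N: "weil_b H (weil_N x) = weil_N (weil_diff H x)"
  by (metis form_to_weil_d form_to_weil_fdiff fdiff_form_d)

lemma weil_t_b: "weil_t (weil_b H x) - weil_b H x = weil_diff H (weil_t x - x)"
  using form_b_fdiff[of "weil_to_form x"]
  by (simp add: form_b_eq form_to_weil_fdiff form_to_weil_to_form)

end

section \<open>Remaining properties of the norm operator\<close>

lemma weil_t_N: "weil_t (weil_N x) = weil_N x"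
proof (rule weil_eqI[of "\<lambda>x. weil_t (weil_N x)"])
  fix w :: "'a weil_gen list" assume w: "w \<noteq> []"
  let ?f = "\<lambda>i. (weil_t ^^ i) (weil_word w)"
  have "weil_t (weil_N (weil_word w)) = (\<Sum>i<length w. ?f (Suc i))"
    by (simp add: weil_N_word w clinear_setsum[OF clinear_weil_t])
  also have "\<dots> = (\<Sum>i<length w. ?f i)"
    using sum_lessThan_telescope[of ?f "length w"] weil_t_pow_length[of w]
    by (simp add: sum_subtractf)
  finally show "weil_t (weil_N (weil_word w)) = weil_N (weil_word w)"
    by (simp add: weil_N_word w)
qed (intro clinear_comp[OF clinear_weil_t clinear_weil_N] clinear_weil_N)+

lemma weil_N_filt: "x \<in> weil_filt k \<Longrightarrow> weil_N x \<in> weil_filt k"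
  by (erule weil_filt_induct[OF _ clinear_weil_N csubspace_weil_filt])
    (auto simp: weil_N_word intro!: complex_vector.subspace_sum[OF csubspace_weil_filt] weil_t_pow_filt weil_filt_word)

lemma weil_N_degree: "x \<in> range (weil_comp k) \<Longrightarrow> weil_N x \<in> range (weil_comp k)"
  by (erule weil_comp_range_induct[OF _ clinear_weil_N csubspace_weil_comp])
    (auto simp: weil_N_word intro!: complex_vector.subspace_sum[OF csubspace_weil_comp] weil_t_pow_degree weil_comp_range_word)

section \<open>The relations\<close>

context twisted_involutive
begin

abbreviation weil_relations where "weil_relations n \<equiv> ideal_power_coinv \<delta> (weil_algebra H) weil_ideal (Suc n)"
abbreviation omega_relations where "omega_relations n \<equiv> form_relations H \<delta> (weil_algebra H) weil_ideal n"

lemma weil_relations_eq: "weil_relations n = cspan (weil_filt (Suc n) \<union> coinv \<delta> (weil_act H))"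
  unfolding ideal_power_coinv_def by (simp only: ideal_power_weil_0 weil_algebra_simps)

lemma csubspace_weil_relations: "csubspace (weil_relations n)"
  unfolding weil_relations_eq by (rule csubspace_cspan)

lemma csubspace_omega_relations: "csubspace (omega_relations n)"
  unfolding form_relations_def by (rule csubspace_cspan)

lemma weil_relations_map:
  assumes "x \<in> weil_relations n" "clinear f" "csubspace T"
    "\<And>x. x \<in> weil_filt (Suc n) \<Longrightarrow> f x \<in> T" "\<And>x. x \<in> coinv \<delta> (weil_act H) \<Longrightarrow> f x \<in> T"
  shows "f x \<in> T"
  by (rule clinear_cspan[OF assms(2,3) _ assms(1)[unfolded weil_relations_eq]]) (use assms(4,5) in blast)

lemma weil_relationsI:
  "x \<in> weil_filt (Suc n) \<Longrightarrow> x \<in> weil_relations n" "x \<in> coinv \<delta> (weil_act H) \<Longrightarrow> x \<in> weil_relations n"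
  unfolding weil_relations_eq by (blast intro: complex_vector.span_base)+

lemma omega_relationsI:
  "z \<in> form_commutators (weil_algebra H) \<Longrightarrow> z \<in> omega_relations n" "z \<in> form_coinv \<Longrightarrow> z \<in> omega_relations n"
  "x \<in> ideal_power weil_ideal (Suc n) \<Longrightarrow> x \<otimes>\<^sub>C y \<in> omega_relations n"
  "x \<in> ideal_power weil_ideal n \<Longrightarrow> y \<in> weil_ideal \<Longrightarrow> x \<otimes>\<^sub>C y \<in> omega_relations n"
  unfolding form_relations_def Suc_eq_plus1 by (rule complex_vector.span_base; blast)+

lemma weil_t_relations: "x \<in> weil_relations n \<Longrightarrow> weil_t x \<in> weil_relations n"
  by (erule weil_relations_map[OF _ clinear_weil_t csubspace_weil_relations])
    (intro weil_relationsI(1) weil_t_filt, assumption, intro weil_relationsI(2) weil_t_coinv)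

lemma weil_diff_relations: "x \<in> weil_relations n \<Longrightarrow> weil_diff H x \<in> weil_relations n"
  by (erule weil_relations_map[OF _ clinear_weil_diff csubspace_weil_relations])
    (intro weil_relationsI(1) weil_diff_filt, assumption, intro weil_relationsI(2) weil_diff_coinv)

lemma weil_b_coinv: "x \<in> coinv \<delta> (weil_act H) \<Longrightarrow> weil_b H x \<in> coinv \<delta> (weil_act H)"
  unfolding weil_b_def weil_b_t_eq
  by (intro complex_vector.subspace_add[OF csubspace_coinv] weil_diff_coinv weil_t_coinv d0_first_coinv)

lemma weil_b_relations: "x \<in> weil_relations n \<Longrightarrow> weil_b H x \<in> weil_relations n"
  by (erule weil_relations_map[OF _ clinear_weil_b csubspace_weil_relations])
    (intro weil_relationsI(1) weil_b_filt, assumption, intro weil_relationsI(2) weil_b_coinv)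

text \<open>If the first letter is a \<open>Gen\<close>, all n + 1 letters \<open>Omega\<close>
  remain in \<open>x\<close> and the form is in I^(n+1) dR; if it is an \<open>Omega\<close>, n of
  them remain and the form is in I^n dI.\<close>

lemma weil_to_form_filt: "x \<in> weil_filt (Suc n) \<Longrightarrow> weil_to_form x \<in> omega_relations n"
proof (erule weil_filt_induct[OF _ clinear_weil_to_form csubspace_omega_relations])
  fix w :: "'h weil_gen list" assume w: "w \<noteq> []" "Suc n \<le> omega_count w"
  then obtain a x where ax: "w = a # x" by (cases w) auto
  have "uword x \<otimes>\<^sub>C weil_word [a] \<in> omega_relations n"
  proof (cases a)
    case (Gen h)
    then have "uword x \<in> ideal_power weil_ideal (Suc n)"
      using w ax unfolding ideal_power_weil by (intro complex_vector.span_base) auto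
    then show ?thesis by (rule omega_relationsI)
  next
    case (Omega h)
    then have "uword x \<in> ideal_power weil_ideal n"
      using w ax unfolding ideal_power_weil by (intro complex_vector.span_base) auto
    moreover have "weil_word [a] \<in> weil_ideal"
      unfolding weil_ideal_eq Omega by (rule weil_filt_word) simp
    ultimately show ?thesis by (rule omega_relationsI)
  qed
  then show "weil_to_form (weil_word w) \<in> omega_relations n"
    by (simp add: ax weil_to_form_word complex_vector.subspace_scale[OF csubspace_omega_relations])
qed

lemma weil_to_form_relations: "x \<in> weil_relations n \<Longrightarrow> weil_to_form x \<in> omega_relations n"
  by (erule weil_relations_map[OF _ clinear_weil_to_form csubspace_omega_relations])
    (erule weil_to_form_filt, intro omega_relationsI(2) weil_to_form_coinv)

lemma form_to_weil_relations:
  assumes "z \<in> omega_relations n"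
  shows "form_to_weil z \<in> weil_relations n"
proof -
  \<comment> \<open>One estimate for both families of relations: it is used with (k, l) = (n + 1, 0)
    and (n, 1).\<close>
  have 1: "form_to_weil (x \<otimes>\<^sub>C y) \<in> weil_relations n"
    if x: "x \<in> ideal_power weil_ideal k" and y: "y \<in> weil_filt l" and kl: "Suc n \<le> k + l" for x y k l
  proof (rule cbilinear_cspan[OF _ csubspace_weil_relations _ x[unfolded ideal_power_weil] y[unfolded weil_filt_def]])
    show "cbilinear (\<lambda>x y. form_to_weil (x \<otimes>\<^sub>C y))"
      by (rule cbilinearI; rule clinear_comp[OF clinear_form_to_weil];
          intro clinear_pure_left clinear_pure_right clinear_ident)
    fix s :: "complex \<times> 'h weil" and t :: "'h weil"
    assume "s \<in> {uword w |w. k \<le> omega_count w}" "t \<in> {weil_word w |w. w \<noteq> [] \<and> l \<le> omega_count w}"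
    then show "form_to_weil (s \<otimes>\<^sub>C t) \<in> weil_relations n"
      using kl by (auto intro!: weil_relationsI(1) form_to_weil_filt)
  qed
  have 2: "y \<in> weil_filt 0" for y :: "'h weil"
    by (simp add: weil_filt_def weil_words_span)
  show ?thesis
  proof (rule clinear_cspan[OF clinear_form_to_weil csubspace_weil_relations _ assms[unfolded form_relations_def]], elim UnE)
    fix s assume "s \<in> form_commutators (weil_algebra H)"
    then show "form_to_weil s \<in> weil_relations n"
      by (simp add: form_to_weil_commutators complex_vector.subspace_0[OF csubspace_weil_relations])
  next
    fix s assume "s \<in> form_coinv"
    then show "form_to_weil s \<in> weil_relations n" by (intro weil_relationsI(2) form_to_weil_coinv)
  next
    fix s :: "'h weil forms" assume "s \<in> {x \<otimes>\<^sub>C y |x y. x \<in> ideal_power weil_ideal (n + 1)}"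
    then show "form_to_weil s \<in> weil_relations n" using 1[OF _ 2] by fastforce
  next
    fix s :: "'h weil forms" assume "s \<in> {x \<otimes>\<^sub>C y |x y. x \<in> ideal_power weil_ideal n \<and> y \<in> weil_ideal}"
    then show "form_to_weil s \<in> weil_relations n" using 1[of _ n _ 1] by (fastforce simp: weil_ideal_eq)
  qed
qed

lemma weil_to_form_to_weil_relations: "weil_to_form (form_to_weil z) - z \<in> omega_relations n"
  by (intro omega_relationsI(1) weil_to_form_to_weil)

lemma form_d_relations:
  assumes "x \<in> weil_relations n"
  shows "form_d x \<in> omega_relations n"
proof (rule weil_relations_map[OF assms clinear_form_d csubspace_omega_relations])
  fix x :: "'h weil" assume "x \<in> weil_filt (Suc n)"
  \<comment> \<open>Instead of a Leibniz expansion, \<open>form_d x\<close> is replaced modulo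
    commutators by the image of \<open>weil_N x\<close>, and \<open>N\<close> preserves the
    filtration.\<close>
  then have "weil_to_form (weil_N x) \<in> omega_relations n" by (intro weil_to_form_filt weil_N_filt)
  from complex_vector.subspace_diff[OF csubspace_omega_relations this weil_to_form_to_weil_relations[of "form_d x"]]
  show "form_d x \<in> omega_relations n" by (simp add: form_to_weil_d)
next
  \<comment> \<open>\<open>d\<close> is equivariant because \<open>H\<close> acts on the unit
    through the counit.\<close>
  have e: "form_act H (weil_algebra H) h (form_d v) = form_d (weil_act H h v)" for h and v :: "'h weil"
  proof -
    have L: "clinear (\<lambda>h. (1 :: complex, 0 :: 'h weil) \<otimes>\<^sub>C weil_act H h v)" by (intro clinear_pure_right clinear_act clinear_ident)
    have c: "(c, 0 :: 'h weil) = c *\<^sub>C (1, 0)" for c by (simp add: scaleC_prod_def)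
    show ?thesis
      using tensor_lift_commute[OF L, of "\<lambda>a b. counit H a *\<^sub>C b" "comult H h"]
      by (simp add: form_d_def form_act_pure uw_act_one c[of "counit H _"] pure_simps counit_left clinear_scaleC[OF L])
  qed
  show "form_d x \<in> omega_relations n" if "x \<in> coinv \<delta> (weil_act H)" for x
    by (rule clinear_coinv[OF clinear_form_d csubspace_omega_relations _ that])
      (simp add: clinear_diff[OF clinear_form_d] clinear_scaleC[OF clinear_form_d] coinv_base omega_relationsI(2) flip: e)
qed

text \<open>\<open>N\<close> is \<open>form_to_weil\<close> after \<open>d\<close>, and both are
  known to respect the relations.\<close>

lemma weil_N_relations: "x \<in> weil_relations n \<Longrightarrow> weil_N x \<in> weil_relations n"
  unfolding form_to_weil_d[symmetric] by (intro form_to_weil_relations form_d_relations)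

lemma form_b_relations: "z \<in> omega_relations n \<Longrightarrow> form_b (weil_algebra H) z \<in> weil_relations n"
  unfolding form_b_eq
  by (intro complex_vector.subspace_diff[OF csubspace_weil_relations] weil_t_relations form_to_weil_relations)

text \<open>The relations are carried to W(H), where \<open>b\<close> preserves them, and back; this
  replaces a computation of the action on differentials of forms.\<close>

lemma fdiff_relations:
  assumes "z \<in> omega_relations n"
  shows "fdiff z \<in> omega_relations n"
proof -
  note sub = csubspace_omega_relations[of n]
  have "weil_to_form (weil_b H (form_to_weil z)) \<in> omega_relations n"
    by (intro weil_to_form_relations weil_b_relations form_to_weil_relations assms)
  from complex_vector.subspace_diff[OF sub this weil_to_form_to_weil_relations[of "fdiff z" n]]
  show ?thesis by (simp add: form_to_weil_fdiff)
qed

text \<open>The composite corresponds to N(t - 1) = 0 in W(H), but a form with image 0 is only a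
  combination of commutators, so it vanishes modulo the relations. The opposite composite is exactly
  0.\<close>

lemma form_d_form_b: "form_d (form_b (weil_algebra H) z) \<in> omega_relations n"
proof -
  have "form_to_weil (form_d (form_b (weil_algebra H) z)) = 0"
    by (simp add: form_to_weil_d form_b_eq clinear_diff[OF clinear_weil_N] weil_N_t)
  then show ?thesis
    using complex_vector.subspace_neg[OF csubspace_omega_relations weil_to_form_to_weil_relations[of "form_d (form_b (weil_algebra H) z)"]]
    by (simp add: clinear_0[OF clinear_weil_to_form])
qed

lemma form_b_form_d: "form_b (weil_algebra H) (form_d x) = 0"
  by (simp add: form_b_eq form_to_weil_d weil_t_N)

end

section \<open>Quotient bicomplexes\<close>

lemma coset_eq_iff:
  assumes "csubspace U"
  shows "coset U a = coset U b \<longleftrightarrow> a - b \<in> U"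
proof
  assume "coset U a = coset U b"
  moreover have "a \<in> coset U a"
    unfolding coset_def by (rule image_eqI[of _ _ 0]) (simp_all add: complex_vector.subspace_0[OF assms])
  ultimately obtain u where "a = b + u" "u \<in> U" by (auto simp: coset_def)
  then show "a - b \<in> U" by simp
next
  have "coset U a \<subseteq> coset U b" if "a - b \<in> U" for a b
    unfolding coset_def
  proof safe
    fix u assume "u \<in> U"
    then have "(a - b) + u \<in> U" using that complex_vector.subspace_add[OF assms] by blast
    then show "a + u \<in> (+) b ` U" by (rule image_eqI[rotated]) simp
  qed
  moreover assume "a - b \<in> U"
  moreover have "b - a \<in> U" using complex_vector.subspace_neg[OF assms \<open>a - b \<in> U\<close>] by simp
  ultimately show "coset U a = coset U b" by blast
qed

lemma coset_mem: "x \<in> coset U a \<longleftrightarrow> x - a \<in> U"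
  by (auto simp: coset_def image_iff intro!: bexI[of _ "x - a"])

lemma coset_self: "csubspace U \<Longrightarrow> a \<in> coset U a"
  by (simp add: coset_mem complex_vector.subspace_0)

lemma coset_zero: "coset U 0 = U"
  by (simp add: coset_def)

text \<open>\<open>descend\<close> is a union over all representatives; when \<open>f\<close> maps
  \<open>U\<close> into \<open>U'\<close>, all cosets in this union coincide.\<close>

lemma descend_coset:
  assumes "csubspace U" "csubspace U'" "clinear f" "\<And>u. u \<in> U \<Longrightarrow> f u \<in> U'"
  shows "descend U' f (coset U a) = coset U' (f a)"
proof -
  have "coset U' (f x) = coset U' (f a)" if "x \<in> coset U a" for x
    using that assms(4)[of "x - a"] by (simp add: coset_eq_iff[OF assms(2)] coset_mem clinear_diff[OF assms(3)])
  then show ?thesis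
    unfolding descend_def using coset_self[OF assms(1)] by blast
qed

lemma quot_add_coset:
  assumes "csubspace U"
  shows "vs_add (quot V U) (coset U a) (coset U b) = coset U (a + b)"
proof -
  have "coset U (x + y) = coset U (a + b)" if "x \<in> coset U a" "y \<in> coset U b" for x y
    using that complex_vector.subspace_add[OF assms, of "x - a" "y - b"]
    by (simp add: coset_eq_iff[OF assms] coset_mem algebra_simps)
  then have "(\<Union>x\<in>coset U a. \<Union>y\<in>coset U b. coset U (x + y)) = (\<Union>x\<in>coset U a. \<Union>y\<in>coset U b. coset U (a + b))"
    by (intro SUP_cong refl)
  also have "\<dots> = coset U (a + b)"
    using coset_self[OF assms, of a] coset_self[OF assms, of b] by auto
  finally show ?thesis by (simp add: quot_def)
qed

lemma quot_scale_coset: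
  assumes "csubspace U"
  shows "vs_scale (quot V U) c (coset U a) = coset U (c *\<^sub>C a)"
  using descend_coset[OF assms assms, of "\<lambda>x. c *\<^sub>C x" a] complex_vector.subspace_scale[OF assms]
  by (simp add: quot_def descend_def clinear_scale clinear_ident)

lemma quot_carrier: "vs_carrier (quot V U) = coset U ` V"
  and quot_zero: "vs_zero (quot V U) = coset U 0"
  by (simp_all add: quot_def coset_zero)

lemma is_cspace_quot:
  assumes V: "csubspace V" and U: "csubspace U"
  shows "is_cspace (quot V U)"
proof -
  note V' = complex_vector.subspace_0[OF V] complex_vector.subspace_add[OF V] complex_vector.subspace_scale[OF V]
  have inv: "\<exists>y\<in>V. coset U (x + y) = coset U 0" if "x \<in> V" for x
    using complex_vector.subspace_neg[OF V that] by (intro bexI[of _ "- x"]) simp_all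
  show ?thesis
    unfolding is_cspace_def Let_def quot_carrier quot_zero
    using V' inv
    by (auto simp: quot_add_coset[OF U] quot_scale_coset[OF U] scaleC_add_left scaleC_add_right add_ac intro!: imageI)
qed

lemma vs_linear_descend:
  assumes "csubspace U" "csubspace U'" "clinear f" "\<And>u. u \<in> U \<Longrightarrow> f u \<in> U'" "\<And>x. x \<in> V \<Longrightarrow> f x \<in> V'"
  shows "vs_linear (quot V U) (quot V' U') (descend U' f)"
  unfolding vs_linear_def quot_carrier
  using assms(5)
  by (auto simp: quot_add_coset[OF assms(1)] quot_add_coset[OF assms(2)] quot_scale_coset[OF assms(1)]
      quot_scale_coset[OF assms(2)] descend_coset[OF assms(1-4)] clinear_add[OF assms(3)] clinear_scaleC[OF assms(3)])

text \<open>Injectivity is phrased as reflecting the relations and surjectivity only up to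
  \<open>U'\<close>, because the map on representatives need not be onto;
  \<open>weil_to_form\<close>, for instance, reaches only one-letter forms.\<close>

lemma vs_iso_descend:
  assumes "csubspace U" "csubspace U'" "csubspace V" "clinear f" "\<And>u. u \<in> U \<Longrightarrow> f u \<in> U'" "\<And>x. x \<in> V \<Longrightarrow> f x \<in> V'"
    and inj: "\<And>x. f x \<in> U' \<Longrightarrow> x \<in> U"
    and surj: "\<And>y. y \<in> V' \<Longrightarrow> \<exists>x\<in>V. f x - y \<in> U'"
  shows "vs_iso (quot V U) (quot V' U') (descend U' f)"
proof -
  note d = descend_coset[OF assms(1,2,4,5)]
  have "inj_on (descend U' f) (coset U ` V)"
    by (auto simp: inj_on_def d coset_eq_iff[OF assms(1)] coset_eq_iff[OF assms(2)] inj simp flip: clinear_diff[OF assms(4)])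
  moreover have "descend U' f ` (coset U ` V) = coset U' ` V'"
  proof
    show "descend U' f ` (coset U ` V) \<subseteq> coset U' ` V'" using assms(6) by (auto simp: d)
    show "coset U' ` V' \<subseteq> descend U' f ` (coset U ` V)"
    proof safe
      fix y assume "y \<in> V'"
      then obtain x where "x \<in> V" "coset U' y = coset U' (f x)"
        using surj coset_eq_iff[OF assms(2)] by metis
      then show "coset U' y \<in> descend U' f ` (coset U ` V)" using d by blast
    qed
  qed
  ultimately show ?thesis
    using vs_linear_descend[OF assms(1,2,4,5,6)] by (simp add: vs_iso_def bij_betw_def quot_carrier)
qed

text \<open>Common form of both bicomplexes: relations and maps depend on the column, homogeneous
  pieces also on the row. The bicomplex identities are required modulo \<open>U\<close>, as
  \<open>d\<close> after the commutator map vanishes only there.\<close>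

locale quotient_bicomplex =
  fixes U :: "int \<Rightarrow> 'a::complex_vector set" and V :: "int \<Rightarrow> int \<Rightarrow> 'a set"
    and h v :: "int \<Rightarrow> 'a \<Rightarrow> 'a"
  assumes U: "csubspace (U p)" and V: "csubspace (V p q)"
    and h: "clinear (h p)" and v: "clinear (v p)"
    and h_U: "x \<in> U p \<Longrightarrow> h p x \<in> U (p + 1)" and v_U: "x \<in> U p \<Longrightarrow> v p x \<in> U p"
    and h_V: "x \<in> V p q \<Longrightarrow> h p x \<in> V (p + 1) q" and v_V: "x \<in> V p q \<Longrightarrow> v p x \<in> V p (q + 1)"
    and h_h: "x \<in> V p q \<Longrightarrow> h (p + 1) (h p x) \<in> U (p + 2)" and v_v: "x \<in> V p q \<Longrightarrow> v p (v p x) \<in> U p"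
    and h_v: "x \<in> V p q \<Longrightarrow> h p (v p x) - v (p + 1) (h p x) \<in> U (p + 1)"
begin

definition bicomplex :: "'a set bicomplex" where
  "bicomplex = \<lparr>obj = (\<lambda>p q. quot (V p q) (U p)), hor = (\<lambda>p q. descend (U (p + 1)) (h p)),
    vert = (\<lambda>p q. descend (U p) (v p))\<rparr>"

lemma hor_coset: "hor bicomplex p q (coset (U p) x) = coset (U (p + 1)) (h p x)"
  unfolding bicomplex_def by (simp add: descend_coset[OF U U h h_U])

lemma vert_coset: "vert bicomplex p q (coset (U p) x) = coset (U p) (v p x)"
  unfolding bicomplex_def by (simp add: descend_coset[OF U U v v_U])

lemma obj_bicomplex: "obj bicomplex p q = quot (V p q) (U p)"
  unfolding bicomplex_def by simp

lemma is_bicomplex: "is_bicomplex bicomplex"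
  unfolding is_bicomplex_def
proof (intro allI conjI ballI)
  fix p q
  show "is_cspace (obj bicomplex p q)" unfolding obj_bicomplex by (intro is_cspace_quot U V)
  show "vs_linear (obj bicomplex p q) (obj bicomplex (p + 1) q) (hor bicomplex p q)"
    unfolding bicomplex_def by (simp add: vs_linear_descend[OF U U h h_U h_V])
  show "vs_linear (obj bicomplex p q) (obj bicomplex p (q + 1)) (vert bicomplex p q)"
    unfolding bicomplex_def by (simp add: vs_linear_descend[OF U U v v_U v_V])
  fix x assume "x \<in> vs_carrier (obj bicomplex p q)"
  then obtain y where y: "y \<in> V p q" "x = coset (U p) y" by (auto simp: obj_bicomplex quot_carrier)
  show "hor bicomplex (p + 1) q (hor bicomplex p q x) = vs_zero (obj bicomplex (p + 2) q)"
    using h_h[OF y(1)] hor_coset[of "p + 1" q "h p y"]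
    by (simp add: y hor_coset obj_bicomplex quot_zero coset_eq_iff[OF U] add.assoc)
  show "vert bicomplex p (q + 1) (vert bicomplex p q x) = vs_zero (obj bicomplex p (q + 2))"
    using v_v[OF y(1)] by (simp add: y vert_coset obj_bicomplex quot_zero coset_eq_iff[OF U])
  show "hor bicomplex p (q + 1) (vert bicomplex p q x) = vert bicomplex (p + 1) q (hor bicomplex p q x)"
    using h_v[OF y(1)] by (simp add: y vert_coset hor_coset coset_eq_iff[OF U])
qed

end

text \<open>The comparison maps are given on representatives; they have to be bijective and commute
  with the differentials only modulo the relations.\<close>

lemma quotient_bicomplex_iso:
  assumes "quotient_bicomplex U V h v" "quotient_bicomplex U' V' h' v'"
    and f: "\<And>p. clinear (f p)" and f_U: "\<And>p x. x \<in> U p \<Longrightarrow> f p x \<in> U' p"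
    and f_V: "\<And>p q x. x \<in> V p q \<Longrightarrow> f p x \<in> V' p q"
    and f_inj: "\<And>p x. f p x \<in> U' p \<Longrightarrow> x \<in> U p"
    and f_surj: "\<And>p q y. y \<in> V' p q \<Longrightarrow> \<exists>x\<in>V p q. f p x - y \<in> U' p"
    and f_h: "\<And>p x. f (p + 1) (h p x) - h' p (f p x) \<in> U' (p + 1)"
    and f_v: "\<And>p x. f p (v p x) - v' p (f p x) \<in> U' p"
  shows "bicomplex_iso (quotient_bicomplex.bicomplex U V h v) (quotient_bicomplex.bicomplex U' V' h' v')"
proof -
  interpret A: quotient_bicomplex U V h v by fact
  interpret B: quotient_bicomplex U' V' h' v' by fact
  note d = descend_coset[OF A.U B.U f f_U]
  have "vs_iso (obj A.bicomplex p q) (obj B.bicomplex p q) (descend (U' p) (f p)) \<and>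
      (\<forall>x\<in>vs_carrier (obj A.bicomplex p q).
        descend (U' (p + 1)) (f (p + 1)) (hor A.bicomplex p q x) = hor B.bicomplex p q (descend (U' p) (f p) x) \<and>
        descend (U' p) (f p) (vert A.bicomplex p q x) = vert B.bicomplex p q (descend (U' p) (f p) x))" for p q
    unfolding A.obj_bicomplex B.obj_bicomplex quot_carrier
    by (auto simp: d A.hor_coset A.vert_coset B.hor_coset B.vert_coset coset_eq_iff[OF B.U] f_h f_v
        intro!: vs_iso_descend A.U B.U A.V f f_U f_V f_inj f_surj)
  then show ?thesis
    unfolding bicomplex_iso_def using A.is_bicomplex B.is_bicomplex
    by (intro conjI exI[of _ "\<lambda>p q. descend (U' p) (f p)"]) blast+
qed

lemma is_bicomplex_vshift:
  assumes "is_bicomplex B"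
  shows "is_bicomplex (vshift k B)"
proof -
  have e: "q + 1 + k = (q + k) + 1" "q + 2 + k = (q + k) + 2" for q by simp_all
  show ?thesis
    using assms unfolding is_bicomplex_def vshift_def by (simp add: e)
qed

lemma bicomplex_iso_vshift:
  assumes "bicomplex_iso A B"
  shows "bicomplex_iso (vshift k A) (vshift k B)"
proof -
  have e: "q + 1 + k = (q + k) + 1" for q by simp
  from assms obtain \<Phi> where "\<forall>p q. vs_iso (obj A p q) (obj B p q) (\<Phi> p q) \<and>
      (\<forall>x\<in>vs_carrier (obj A p q). \<Phi> (p + 1) q (hor A p q x) = hor B p q (\<Phi> p q x) \<and>
        \<Phi> p (q + 1) (vert A p q x) = vert B p q (\<Phi> p q x))"
    by (auto simp: bicomplex_iso_def)
  then show ?thesis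
    using assms is_bicomplex_vshift[of A k] is_bicomplex_vshift[of B k]
    unfolding bicomplex_iso_def by (intro conjI exI[of _ "\<lambda>p q. \<Phi> p (q + k)"]) (auto simp: vshift_def e)
qed

section \<open>The isomorphism\<close>

lemma csubspace_Times0: "csubspace A \<Longrightarrow> csubspace (A \<times> {0})" "csubspace A \<Longrightarrow> csubspace ({0} \<times> A)"
  by (auto intro!: complex_vector.subspaceI simp: scaleC_prod_def zero_prod_def complex_vector.subspace_0
      complex_vector.subspace_add complex_vector.subspace_scale)

context twisted_involutive
begin

abbreviation "weil_hor p \<equiv> (if even p then weil_N else (\<lambda>x. weil_t x - x))"
abbreviation "weil_vert p \<equiv> (if even p then weil_diff H else weil_b H)"
abbreviation "X_obj p q \<equiv> (if even p then range (weil_comp q) \<times> {0} else {0} \<times> form_homog (weil_algebra H) q)"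
abbreviation "X_hor \<equiv> (\<lambda>(x, z). (form_b (weil_algebra H) z, form_d x))"
abbreviation "X_vert \<equiv> (\<lambda>(x, z). (weil_diff H x, fdiff z))"

lemma weil_quotient_bicomplex:
  "quotient_bicomplex (\<lambda>p. weil_relations n) (\<lambda>p q. range (weil_comp q)) (\<lambda>p :: int. weil_hor p) (\<lambda>p. weil_vert p)"
proof
  note sub = csubspace_weil_relations csubspace_weil_comp
  note L = clinear_weil_N clinear_weil_t clinear_weil_diff clinear_weil_b
  fix p q :: int and x :: "'h weil"
  show "clinear (weil_hor p)" "clinear (weil_vert p)"
    by (auto intro!: L clinear_sub clinear_ident)
  show "weil_hor p x \<in> weil_relations n" if "x \<in> weil_relations n"
    using that by (auto intro!: weil_N_relations complex_vector.subspace_diff[OF sub(1)] weil_t_relations)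
  show "weil_vert p x \<in> weil_relations n" if "x \<in> weil_relations n"
    using that by (auto intro!: weil_diff_relations weil_b_relations)
  show "weil_hor p x \<in> range (weil_comp q)" if "x \<in> range (weil_comp q)"
    using weil_N_degree[OF that] complex_vector.subspace_diff[OF sub(2) weil_t_degree[OF that] that] by simp
  show "weil_vert p x \<in> range (weil_comp (q + 1))" if "x \<in> range (weil_comp q)"
    using weil_diff_degree[OF that] weil_b_degree[OF that] by simp
  show "weil_hor (p + 1) (weil_hor p x) \<in> weil_relations n"
    by (simp add: weil_t_N clinear_diff[OF clinear_weil_N] weil_N_t complex_vector.subspace_0[OF sub(1)])
  show "weil_vert p (weil_vert p x) \<in> weil_relations n"
    by (simp add: weil_diff_diff weil_b_b complex_vector.subspace_0[OF sub(1)])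
  show "weil_hor p (weil_vert p x) - weil_vert (p + 1) (weil_hor p x) \<in> weil_relations n"
    by (simp add: weil_b_N weil_t_b complex_vector.subspace_0[OF sub(1)])
qed (rule csubspace_weil_relations csubspace_weil_comp)+

lemma X_quotient_bicomplex:
  "quotient_bicomplex (X_relations H \<delta> (weil_algebra H) weil_ideal n) X_obj (\<lambda>p. X_hor) (\<lambda>p. X_vert)"
proof
  note sub = csubspace_weil_relations csubspace_weil_comp csubspace_omega_relations csubspace_form_homog
  note zero = clinear_0[OF clinear_form_b] clinear_0[OF clinear_form_d] clinear_0[OF clinear_weil_diff] clinear_0[OF clinear_fdiff]
  fix p q :: int and x :: "'h weil \<times> 'h weil forms"
  show "csubspace (X_relations H \<delta> (weil_algebra H) weil_ideal n p)" "csubspace (X_obj p q)"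
    unfolding X_relations_def by (simp_all add: csubspace_Times0 sub)
  show "clinear X_hor" "clinear X_vert"
    unfolding case_prod_unfold
    by (intro clinear_Pair clinear_comp[OF clinear_form_b] clinear_comp[OF clinear_form_d] clinear_comp[OF clinear_weil_diff]
        clinear_comp[OF clinear_fdiff] clinear_fst clinear_snd clinear_ident)+
  show "X_hor x \<in> X_relations H \<delta> (weil_algebra H) weil_ideal n (p + 1)" if "x \<in> X_relations H \<delta> (weil_algebra H) weil_ideal n p"
    using that form_b_relations[of _ n] form_d_relations[of _ n]
    by (auto simp: X_relations_def zero split: if_splits)
  show "X_vert x \<in> X_relations H \<delta> (weil_algebra H) weil_ideal n p" if "x \<in> X_relations H \<delta> (weil_algebra H) weil_ideal n p"
    using that weil_diff_relations[of _ n] fdiff_relations[of _ n]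
    by (auto simp: X_relations_def zero split: if_splits)
  show "X_hor x \<in> X_obj (p + 1) q" if "x \<in> X_obj p q"
    using that form_b_degree[of _ H q] form_d_degree[of _ q H]
    by (auto simp: zero split: if_splits)
  show "X_vert x \<in> X_obj p (q + 1)" if "x \<in> X_obj p q"
    using that weil_diff_degree[of _ q] fdiff_degree[of _ q]
    by (auto simp: zero split: if_splits)
  have z: "0 \<in> X_relations H \<delta> (weil_algebra H) weil_ideal n p" for p
    by (auto simp: X_relations_def zero_prod_def complex_vector.subspace_0[OF sub(1)[of n]] complex_vector.subspace_0[OF sub(3)])
  show "X_hor (X_hor x) \<in> X_relations H \<delta> (weil_algebra H) weil_ideal n (p + 2)" if "x \<in> X_obj p q"
    using that form_d_form_b[of _ n] z[of p]
    by (auto simp: X_relations_def form_b_form_d zero zero_prod_def split: if_splits)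
  show "X_vert (X_vert x) \<in> X_relations H \<delta> (weil_algebra H) weil_ideal n p"
    using z[of p] by (simp add: case_prod_unfold weil_diff_diff fdiff_fdiff zero_prod_def)
  show "X_hor (X_vert x) - X_vert (X_hor x) \<in> X_relations H \<delta> (weil_algebra H) weil_ideal n (p + 1)"
    using z[of "p + 1"] by (simp add: case_prod_unfold form_b_fdiff fdiff_form_d zero_prod_def)
qed

lemma weil_CC_X_iso: "bicomplex_iso (weil_CC H \<delta> n) (X_bicomplex H \<delta> (weil_algebra H) weil_ideal n)"
proof -
  interpret A: quotient_bicomplex "\<lambda>p. weil_relations n" "\<lambda>p q. range (weil_comp q)" "\<lambda>p :: int. weil_hor p" "\<lambda>p. weil_vert p"
    by (rule weil_quotient_bicomplex)
  interpret B: quotient_bicomplex "X_relations H \<delta> (weil_algebra H) weil_ideal n" X_obj "\<lambda>p. X_hor" "\<lambda>p. X_vert"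
    by (rule X_quotient_bicomplex)
  have A: "weil_CC H \<delta> n = A.bicomplex"
    by (simp add: weil_CC_def A.bicomplex_def Let_def)
  have B: "X_bicomplex H \<delta> (weil_algebra H) weil_ideal n = B.bicomplex"
    unfolding X_bicomplex_def B.bicomplex_def weil_algebra_simps by (rule refl)
  \<comment> \<open>The identity on columns carrying the algebra and \<open>weil_to_form\<close> on
    those carrying one-forms; the zero component appears because both kinds of column sit in one
    ambient direct sum.\<close>
  let ?f = "\<lambda>p :: int. if even p then (\<lambda>x. (x, 0)) else (\<lambda>x. (0, weil_to_form x))"
  let ?U = "X_relations H \<delta> (weil_algebra H) weil_ideal n"
  have z: "0 \<in> ?U p" for p by (rule complex_vector.subspace_0[OF B.U])
  show ?thesis unfolding A B
  proof (rule quotient_bicomplex_iso[OF weil_quotient_bicomplex X_quotient_bicomplex, where f = ?f])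
    fix p q :: int and x :: "'h weil" and y :: "'h weil \<times> 'h weil forms"
    show "clinear (?f p)" by (auto intro!: clinear_intros clinear_weil_to_form)
    show "?f p x \<in> ?U p" if "x \<in> weil_relations n"
      using that weil_to_form_relations[of x n] by (simp add: X_relations_def)
    show "?f p x \<in> X_obj p q" if "x \<in> range (weil_comp q)"
      using weil_to_form_degree[OF that] that by simp
    \<comment> \<open>\<open>form_to_weil\<close> preserves the relations and is a left inverse of
      \<open>weil_to_form\<close>, so the latter reflects them.\<close>
    show "x \<in> weil_relations n" if "?f p x \<in> ?U p"
      using that form_to_weil_relations[of "weil_to_form x" n]
      by (simp add: X_relations_def form_to_weil_to_form split: if_splits)
    show "\<exists>x\<in>range (weil_comp q). ?f p x - y \<in> ?U p" if y: "y \<in> X_obj p q"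
    proof (cases "even p")
      case True
      then show ?thesis using y z[of p] by (intro bexI[of _ "fst y"]) (auto simp: zero_prod_def)
    next
      case False
      \<comment> \<open>The preimage of a form is its image under \<open>form_to_weil\<close>; it
        returns the form up to commutators, which are relations.\<close>
      then have "form_to_weil (snd y) \<in> range (weil_comp q)" using y form_to_weil_degree by auto
      then show ?thesis
        using False y weil_to_form_to_weil_relations[of "snd y" n]
        by (intro bexI[of _ "form_to_weil (snd y)"]) (auto simp: X_relations_def)
    qed
    \<comment> \<open>For even \<open>p\<close>, \<open>form_d x\<close> agrees with the image of
      \<open>weil_N x\<close> modulo commutators; for odd \<open>p\<close>, the commutator map on
      \<open>weil_to_form x\<close> is exactly \<open>weil_t x - x\<close>.\<close>
    show "?f (p + 1) (weil_hor p x) - X_hor (?f p x) \<in> ?U (p + 1)"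
      using weil_to_form_to_weil_relations[of "form_d x" n] z[of "p + 1"]
      by (auto simp: X_relations_def form_to_weil_d form_b_eq form_to_weil_to_form clinear_0[OF clinear_form_to_weil] clinear_0[OF clinear_weil_t]
          clinear_0[OF clinear_form_d] zero_prod_def)
    show "?f p (weil_vert p x) - X_vert (?f p x) \<in> ?U p"
      using complex_vector.subspace_neg[OF csubspace_omega_relations omega_relationsI(1)[OF fdiff_weil_to_form[of x]], of n] z[of p]
      by (auto simp: X_relations_def clinear_0[OF clinear_weil_diff] clinear_0[OF clinear_fdiff] zero_prod_def)
  qed
qed

end

theorem theorem7p9:
  fixes H :: "'h::complex_algebra_1 hopf_data"
    and \<delta> :: "'h \<Rightarrow> complex"
    and n :: nat
  assumes "hopf_algebra H"
    and "character \<delta>"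
    and "twisted_antipode H \<delta> \<circ> twisted_antipode H \<delta> = id"
  shows "bicomplex_iso (hopf_CC H \<delta> n)
    (vshift 1 (X_bicomplex H \<delta> (weil_algebra H) weil_ideal n))"
proof -
  interpret hopf_algebra H by fact
  interpret twisted_involutive H \<delta>
    by unfold_locales (use assms in \<open>simp_all add: character_def\<close>)
  \<comment> \<open>\<open>hopf_CC\<close> already contains the shift by one, so shifting the other
    side equally reduces the claim to the unshifted bicomplexes.\<close>
  show ?thesis unfolding hopf_CC_def by (rule bicomplex_iso_vshift[OF weil_CC_X_iso])
qed

end
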